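(* Let $d-3 \le s < d$. Suppose that $v$ is bounded from below, $\mathcal{C}^2$ in the extended sense on $[0,\infty)$, with $v''$ finite on $(0,\infty)$, and such that $I_{s,V}$ has a unique equilibrium measure $\mu_{\mathrm{eq}}$. If $d=2$ and $-1\le s<0$, assume also that $\lim_{\rho\to 0^+}\rho^{\frac{s}{2}+1}v'(\rho)=0$. Writing $x=r\theta$ with $r\in[0,\infty)$ and $\theta\in\mathbb{S}^{d-1}$, let $\nu\in\mathcal{P}([0,\infty))$ be such that $$\mathrm{d}\mu_{\mathrm{eq}}(x)=\mathrm{d}\sigma(\theta)\,\mathrm{d}\nu(r).$$ Then $\operatorname{supp}(\nu)$ is a perfect set, i.e. closed with no isolated points.
   Context: Throughout, $d\ge 2$ is an integer and $-2<s<d$ is real. $\|\cdot\|$ is the Euclidean norm on $\mathbb{R}^d$, and $\mathcal{P}(X)$ is the set of Borel probability measures on $X$. The Riesz kernel is $K_s(x)=\frac{1}{s\|x\|^s}$ if $s\neq 0$ and $K_0(x)=-\log\|x\|$. The external field $V:\mathbb{R}^d\to(-\infty,+\infty]$ is radial: $V(x)=v(\|x\|^2)$, where $v:[0,\infty)\to(-\infty,+\infty]$ is lower semicontinuous, bounded from below, and finite on some interval $(a,b)$. The energy of $\mu\in\mathcal{P}(\mathbb{R}^d)$ is $$I_{s,V}(\mu)=\iint\big(K_s(x-y)+V(x)+V(y)\big)\,\mathrm{d}\mu(x)\,\mathrm{d}\mu(y)\in(-\infty,+\infty].$$ An equilibrium measure is a minimizer of $I_{s,V}$ over $\mathcal{P}(\mathbb{R}^d)$.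 When it is unique it is radially symmetric (invariant under rotations), so a measure $\nu$ as in the claim exists. $\sigma$ denotes the uniform probability measure on the unit sphere $\mathbb{S}^{d-1}\subset\mathbb{R}^d$. A function $f:I\to\mathbb{R}\cup\{\pm\infty\}$ on an interval $I$ is $\mathcal{C}^k$ in the extended sense on $I$ when for each $\ell\in\{0,\dots,k\}$ and $y\in I$, $f^{(\ell)}(y)$ exists as an element of $\mathbb{R}\cup\{\pm\infty\}$ and is finite except at a finite set of values in $I$, and $\lim_{x\to y}f^{(\ell)}(x)=f^{(\ell)}(y)$ (one-sided limits at endpoints of $I$). *)

theory Defs
  imports "HOL-Probability.Probability"
begin

section \<open>Measures\<close>

text \<open>Borel probability measures on a subspace \<open>X\<close>; such a measure has space \<open>X\<close>.\<close>

definition borel_probs :: "'a::topological_space set \<Rightarrow> 'a measure set" where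
  "borel_probs X = {\<mu>. prob_space \<mu> \<and> sets \<mu> = sets (restrict_space borel X)}"

definition msupp :: "'a::topological_space measure \<Rightarrow> 'a set" where
  "msupp \<mu> = {x \<in> space \<mu>. \<forall>U. open U \<and> x \<in> U \<longrightarrow> emeasure \<mu> (U \<inter> space \<mu>) > 0}"

definition perfect_set :: "'a::topological_space set \<Rightarrow> bool" where
  "perfect_set S \<longleftrightarrow> closed S \<and> \<not> (\<exists>x. x isolated_in S)"

text \<open>The uniform probability measure on the unit sphere, as a Borel measure on the ambient space:
  the law of \<open>x / \<parallel>x\<parallel>\<close> for \<open>x\<close> uniform in the unit ball.  It is carried by the sphere and invariant
  under orthogonal transformations; see the lemmas at the end of this theory.\<close>

definition unif_sphere :: "'a::euclidean_space measure" where
  "unif_sphere = distr (uniform_measure lborel (ball 0 1)) borel sgn"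

text \<open>The measure \<open>d\<sigma>(\<theta>) d\<nu>(r)\<close> in polar coordinates \<open>x = r \<theta>\<close>.\<close>

definition radial_measure :: "real measure \<Rightarrow> 'a::euclidean_space measure" where
  "radial_measure \<nu> = distr (\<nu> \<Otimes>\<^sub>M unif_sphere) borel (\<lambda>(r, \<theta>). r *\<^sub>R \<theta>)"

section \<open>Riesz energy with external field\<close>

text \<open>The value at the origin is the limit of the kernel there.\<close>

definition riesz_kernel :: "real \<Rightarrow> 'a::real_normed_vector \<Rightarrow> ereal" where
  "riesz_kernel s x =
     (if x = 0 then (if s \<ge> 0 then \<infinity> else 0)
      else if s = 0 then ereal (- ln (norm x))
      else ereal (1 / (s * norm x powr s)))"

definition radial_field :: "(real \<Rightarrow> ereal) \<Rightarrow> 'a::real_normed_vector \<Rightarrow> ereal" where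
  "radial_field v x = v ((norm x)\<^sup>2)"

text \<open>Integral of the positive part minus integral of the negative part (\<^const>\<open>e2ennreal\<close> truncates
  negative values to 0).  In \<^typ>\<open>ereal\<close> we have \<open>\<infinity> - \<infinity> = \<infinity>\<close>, so an undefined integral counts as \<open>\<infinity>\<close>.\<close>

definition ereal_integral :: "'a measure \<Rightarrow> ('a \<Rightarrow> ereal) \<Rightarrow> ereal" where
  "ereal_integral M f =
     enn2ereal (\<integral>\<^sup>+ x. e2ennreal (f x) \<partial>M) - enn2ereal (\<integral>\<^sup>+ x. e2ennreal (- f x) \<partial>M)"

definition riesz_energy ::
  "real \<Rightarrow> ('a::euclidean_space \<Rightarrow> ereal) \<Rightarrow> 'a measure \<Rightarrow> ereal" where
  "riesz_energy s V \<mu> =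
     ereal_integral (\<mu> \<Otimes>\<^sub>M \<mu>) (\<lambda>(x, y). riesz_kernel s (x - y) + V x + V y)"

definition equilibrium_measure ::
  "real \<Rightarrow> ('a::euclidean_space \<Rightarrow> ereal) \<Rightarrow> 'a measure \<Rightarrow> bool" where
  "equilibrium_measure s V \<mu> \<longleftrightarrow>
     \<mu> \<in> borel_probs UNIV \<and> (\<forall>\<mu>' \<in> borel_probs UNIV. riesz_energy s V \<mu> \<le> riesz_energy s V \<mu>')"

section \<open>Regularity of the radial profile\<close>

text \<open>Values of profiles outside \<open>[0, \<infinity>)\<close> are irrelevant throughout.\<close>

definition lsc_on :: "'a::topological_space set \<Rightarrow> ('a \<Rightarrow> ereal) \<Rightarrow> bool" where
  "lsc_on I f \<longleftrightarrow> (\<forall>x\<in>I. f x \<le> Liminf (at x within I) f)"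

definition bounded_below_on :: "'a set \<Rightarrow> ('a \<Rightarrow> ereal) \<Rightarrow> bool" where
  "bounded_below_on I f \<longleftrightarrow> (\<exists>c::real. \<forall>x\<in>I. ereal c \<le> f x)"

definition finite_on_some_interval :: "(real \<Rightarrow> ereal) \<Rightarrow> bool" where
  "finite_on_some_interval v \<longleftrightarrow> (\<exists>a b. 0 \<le> a \<and> a < b \<and> (\<forall>x\<in>{a<..<b}. \<bar>v x\<bar> \<noteq> \<infinity>))"

text \<open>Difference quotients and derivatives relative to \<open>I\<close> (one-sided at endpoints), computed in
  \<^typ>\<open>ereal\<close>, so that points where \<open>f\<close> itself is infinite are allowed.\<close>

definition ext_quotient :: "(real \<Rightarrow> ereal) \<Rightarrow> real \<Rightarrow> real \<Rightarrow> ereal" where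
  "ext_quotient f y x = (f x - f y) / ereal (x - y)"

definition ext_deriv :: "real set \<Rightarrow> (real \<Rightarrow> ereal) \<Rightarrow> real \<Rightarrow> ereal" where
  "ext_deriv I f y = Lim (at y within I) (ext_quotient f y)"

definition ext_Ck_on :: "nat \<Rightarrow> real set \<Rightarrow> (real \<Rightarrow> ereal) \<Rightarrow> bool" where
  "ext_Ck_on k I f \<longleftrightarrow>
     (\<forall>l<k. \<forall>y\<in>I. \<exists>D. (ext_quotient ((ext_deriv I ^^ l) f) y \<longlongrightarrow> D) (at y within I)) \<and>
     (\<forall>l\<le>k. finite {y \<in> I. \<bar>(ext_deriv I ^^ l) f y\<bar> = \<infinity>}) \<and>
     (\<forall>l\<le>k. \<forall>y\<in>I. ((ext_deriv I ^^ l) f \<longlongrightarrow> (ext_deriv I ^^ l) f y) (at y within I))"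

section \<open>Basic properties of the uniform measure on the sphere\<close>

lemma prob_space_unif_ball: "prob_space (uniform_measure lborel (ball (0::'a::euclidean_space) 1))"
  by (rule prob_space_uniform_measure)
     (use unit_ball_vol_pos[of "real DIM('a)"] in \<open>auto simp: emeasure_ball simp del: unit_ball_vol_pos\<close>)

lemma measurable_sgn [measurable]: "(sgn :: 'a::euclidean_space \<Rightarrow> 'a) \<in> borel_measurable borel"
  unfolding sgn_div_norm by measurable

lemma prob_space_unif_sphere: "prob_space (unif_sphere :: 'a::euclidean_space measure)"
  unfolding unif_sphere_def
  by (rule prob_space.prob_space_distr[OF prob_space_unif_ball]) simp

lemma AE_unif_sphere: "AE x in (unif_sphere :: 'a::euclidean_space measure). x \<in> sphere 0 1"
proof -
  have "AE x::'a in uniform_measure lborel (ball 0 1). sgn x \<in> sphere 0 1"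
    by (rule AE_uniform_measureI) (use AE_lborel_singleton[of "0::'a"] in \<open>auto simp: norm_sgn\<close>)
  then show ?thesis
    unfolding unif_sphere_def by (subst AE_distr_iff) auto
qed

lemma lborel_distr_orthogonal:
  fixes f :: "'a::euclidean_space \<Rightarrow> 'a"
  assumes f: "orthogonal_transformation f"
  shows "distr lborel borel f = lborel"
proof (rule measure_eqI)
  have lin: "linear f" and nf: "\<And>x. norm (f x) = norm x"
    using f by (auto simp: orthogonal_transformation)
  have [measurable]: "f \<in> borel_measurable borel"
    using lin by (intro borel_measurable_continuous_onI linear_continuous_on)
      (simp add: linear_conv_bounded_linear)
  define M where "M = distr lborel borel f"
  define B where "B = ball (0::'a) 1"
  have [simp, measurable_cong]: "sets M = sets borel" and [simp]: "space M = UNIV"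
    by (auto simp: M_def)
  have [measurable]: "B \<in> sets borel" by (simp add: B_def)
  have tr: "distr lborel borel ((+) c) = lborel" for c :: 'a
    using lborel_affine[of 1 c] by (simp add: density_1)
  have trM: "(\<integral>\<^sup>+ x. g (c + x) \<partial>M) = (\<integral>\<^sup>+ x. g x \<partial>M)"
    if [measurable]: "g \<in> borel_measurable borel" for g and c :: 'a
  proof -
    obtain c' where c': "c = f c'"
      using orthogonal_transformation_surj[OF f] by (metis surjD)
    have "(\<integral>\<^sup>+ x. g (c + x) \<partial>M) = (\<integral>\<^sup>+ x. g (f (c' + x)) \<partial>lborel)"
      by (simp add: M_def nn_integral_distr c' linear_add[OF lin])
    also have "\<dots> = (\<integral>\<^sup>+ x. g (f x) \<partial>distr lborel borel ((+) c'))"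
      by (simp add: nn_integral_distr)
    also have "\<dots> = (\<integral>\<^sup>+ x. g x \<partial>M)"
      by (simp add: tr M_def nn_integral_distr)
    finally show ?thesis .
  qed
  have trL: "(\<integral>\<^sup>+ x. g (c + x) \<partial>lborel) = (\<integral>\<^sup>+ x. g x \<partial>lborel)"
    if [measurable]: "g \<in> borel_measurable borel" for g and c :: 'a
  proof -
    have "(\<integral>\<^sup>+ x. g (c + x) \<partial>lborel) = (\<integral>\<^sup>+ x. g x \<partial>distr lborel borel ((+) c))"
      by (simp add: nn_integral_distr)
    then show ?thesis by (simp add: tr)
  qed
  have MB: "emeasure M (ball 0 r) = emeasure lborel (ball (0::'a) r)" for r
  proof -
    have "f -` ball 0 r = ball 0 r" by (auto simp: nf)
    then show ?thesis by (simp add: M_def emeasure_distr)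
  qed
  interpret M: sigma_finite_measure M
  proof
    show "\<exists>A::'a set set. countable A \<and> A \<subseteq> sets M \<and> \<Union> A = space M \<and> (\<forall>a\<in>A. emeasure M a \<noteq> \<infinity>)"
      by (rule exI[of _ "range (\<lambda>n::nat. ball 0 (real n))"])
         (auto simp: MB emeasure_ball intro: reals_Archimedean2)
  qed
  interpret P: pair_sigma_finite M lborel ..
  show "sets (distr lborel borel f) = sets (lborel :: 'a measure)" by simp
  fix A assume "A \<in> sets (distr lborel borel f)"
  then have [measurable]: "A \<in> sets borel" by simp
  have "emeasure M A * emeasure lborel B = (\<integral>\<^sup>+ y. \<integral>\<^sup>+ x. indicator A x * indicator B y \<partial>M \<partial>lborel)"
    by (simp add: nn_integral_multc nn_integral_cmult)
  also have "\<dots> = (\<integral>\<^sup>+ y. \<integral>\<^sup>+ x. indicator A (y + x) * indicator B y \<partial>M \<partial>lborel)"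
    by (subst trM[where g = "\<lambda>x. indicator A x * indicator B _"]) simp_all
  also have "\<dots> = (\<integral>\<^sup>+ x. \<integral>\<^sup>+ y. indicator A (y + x) * indicator B y \<partial>lborel \<partial>M)"
    by (rule P.Fubini') measurable
  also have "\<dots> = (\<integral>\<^sup>+ x. \<integral>\<^sup>+ y. indicator A y * indicator B (y - x) \<partial>lborel \<partial>M)"
  proof (rule nn_integral_cong)
    fix x
    show "(\<integral>\<^sup>+ y. indicator A (y + x) * indicator B y \<partial>lborel)
        = (\<integral>\<^sup>+ y. indicator A y * indicator B (y - x) \<partial>lborel)"
      by (subst trL[where g = "\<lambda>y. indicator A y * indicator B (y - x)" and c = x, symmetric])
         (simp_all add: add.commute)
  qed
  also have "\<dots> = (\<integral>\<^sup>+ y. \<integral>\<^sup>+ x. indicator A y * indicator B (y - x) \<partial>M \<partial>lborel)"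
    by (rule P.Fubini'[symmetric]) measurable
  also have "\<dots> = (\<integral>\<^sup>+ y. \<integral>\<^sup>+ x. indicator A y * indicator B x \<partial>M \<partial>lborel)"
  proof (rule nn_integral_cong)
    fix y
    have "(\<integral>\<^sup>+ x. indicator A y * indicator B (y - x) \<partial>M)
        = (\<integral>\<^sup>+ x. indicator A y * indicator B (y - (y + x)) \<partial>M)"
      by (rule trM[symmetric]) simp
    also have "\<dots> = (\<integral>\<^sup>+ x. indicator A y * indicator B x \<partial>M)"
      by (simp add: B_def indicator_def)
    finally show "(\<integral>\<^sup>+ x. indicator A y * indicator B (y - x) \<partial>M)
        = (\<integral>\<^sup>+ x. indicator A y * indicator B x \<partial>M)" .
  qed
  also have "\<dots> = emeasure lborel A * emeasure M B"
    by (simp add: nn_integral_multc nn_integral_cmult)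
  also have "emeasure M B = emeasure lborel B"
    by (simp add: B_def MB)
  finally have "emeasure M A * emeasure lborel B = emeasure lborel A * emeasure lborel B" .
  moreover have "emeasure lborel B \<noteq> 0" "emeasure lborel B \<noteq> \<infinity>"
    using unit_ball_vol_pos[of "real DIM('a)"] by (auto simp: B_def emeasure_ball simp del: unit_ball_vol_pos)
  ultimately show "emeasure (distr lborel borel f) A = emeasure lborel A"
    unfolding M_def by (metis ennreal_mult_cancel_left infinity_ennreal_def mult.commute)
qed

lemma unif_sphere_orthogonal:
  fixes f :: "'a::euclidean_space \<Rightarrow> 'a"
  assumes f: "orthogonal_transformation f"
  shows "distr unif_sphere borel f = unif_sphere"
proof (rule measure_eqI)
  have lin: "linear f" and nf: "\<And>x. norm (f x) = norm x"
    using f by (auto simp: orthogonal_transformation)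
  have [measurable]: "f \<in> borel_measurable borel"
    using lin by (intro borel_measurable_continuous_onI linear_continuous_on)
      (simp add: linear_conv_bounded_linear)
  have fsgn: "f (sgn x) = sgn (f x)" for x
    by (simp add: sgn_div_norm linear_scale[OF lin] nf)
  show "sets (distr unif_sphere borel f) = sets (unif_sphere :: 'a measure)"
    by (simp add: unif_sphere_def)
  fix A assume "A \<in> sets (distr (unif_sphere :: 'a measure) borel f)"
  then have [measurable]: "A \<in> sets borel" by simp
  let ?B = "ball (0::'a) 1"
  have eq: "?B \<inter> sgn -` (f -` A) = f -` (?B \<inter> sgn -` A)"
    by (auto simp: fsgn nf)
  have m: "sgn -` A \<in> sets (borel :: 'a measure)" "f -` A \<in> sets borel"
    "sgn -` (f -` A) \<in> sets borel"
    using measurable_sets[of sgn borel borel A] measurable_sets[of f borel borel A]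
      measurable_sets[of sgn borel borel "f -` A"] by auto
  have "emeasure lborel (?B \<inter> sgn -` (f -` A)) = emeasure (distr lborel borel f) (?B \<inter> sgn -` A)"
    unfolding eq using m by (subst emeasure_distr) auto
  also have "\<dots> = emeasure lborel (?B \<inter> sgn -` A)"
    by (simp add: lborel_distr_orthogonal[OF f])
  finally show "emeasure (distr unif_sphere borel f) A = emeasure unif_sphere A"
    using m by (simp add: unif_sphere_def emeasure_distr)
qed

end

theory Submission
  imports Defs
begin

text \<open>Suppose \<open>supp \<nu>\<close> has an isolated point \<open>r\<close>, so that \<open>\<mu>eq\<close> charges the sphere of radius \<open>r\<close> and no
  other point near it.  Replace a small part of the mass on this sphere by its displacements in the radial
  direction by \<open>\<plusminus>t\<close>, half of it each.  By minimality the first-order change of the energy is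
  nonnegative.  The external field, which is \<open>C\<^sup>2\<close> near \<open>r\<close>, and the interaction with the remaining
  mass, which is at positive distance, contribute \<open>O(t\<^sup>2)\<close>.  The interaction of the sphere with itself
  contributes at most \<open>O(t\<^sup>2) - t\<^sup>2 \<integral>\<integral> (\<parallel>x - y\<parallel>\<^sup>2 + t\<^sup>2) powr (- s / 2 - 1)\<close>, and the double integral over the
  sphere tends to \<open>\<infinity>\<close> as \<open>t \<rightarrow> 0\<close> because \<open>s + 2 \<ge> d - 1\<close>: a contradiction.  For \<open>r = 0\<close> the energy can only
  be finite if \<open>s < 0\<close>, hence \<open>d = 2\<close>; then the self-interaction drops by a multiple of \<open>t powr (- s)\<close>, while
  the condition on \<open>v'\<close> at \<open>0\<close> says that the field increases by \<open>o(t powr (- s))\<close> only.\<close>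

section \<open>Second differences\<close>

text \<open>The energy is quadratic in the measure, so to first order in the displaced mass only the
  interaction of an unmoved point with a moved one counts; moved points do not see each other. The
  two signs of t remove the terms of order t. In the squared distance X the kernel has derivative
  \<open>- (X powr (- s / 2 - 1)) / 2\<close> for every s, so it is decreasing and convex, and
  displacing one endpoint of a chord of the sphere raises X by t^2 on average: this is the gain. If
  s + 2 = d - 1 the double integral diverges only logarithmically, so every dyadic scale has to be
  counted. The obstacle is integrability. Kernel and field are not known to be integrable
  separately, an energy may have the form \<infinity> - \<infinity>, and for s \<le> 0 the kernel is
  unbounded below at infinity. Uniqueness of the minimizer yields integrability of the pair energy
  itself, and all displaced pair energies are dominated by it pointwise.\<close>

lemma second_difference_le:
  fixes f f' f'' :: "real \<Rightarrow> real"
  assumes f: "\<And>x. \<bar>x - y\<bar> \<le> \<bar>b\<bar> \<Longrightarrow> (f has_real_derivative f' x) (at x)"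
    and f': "\<And>x. \<bar>x - y\<bar> \<le> \<bar>b\<bar> \<Longrightarrow> (f' has_real_derivative f'' x) (at x)"
    and B: "\<And>x. \<bar>x - y\<bar> \<le> \<bar>b\<bar> \<Longrightarrow> f'' x \<le> B"
  shows "f (y + b) + f (y - b) - 2 * f y \<le> B * b\<^sup>2"
proof -
  \<comment> \<open>Lagrange form of the remainder; adding the bounds for \<open>c = b\<close> and
    \<open>c = - b\<close> cancels the first-order terms.\<close>
  have taylor: "f (y + c) \<le> f y + f' y * c + B / 2 * c\<^sup>2" if c: "\<bar>c\<bar> = \<bar>b\<bar>" "c \<noteq> 0" for c
  proof -
    define D where "D = (\<lambda>m::nat. if m = 0 then f else if m = 1 then f' else f'')"
    have "\<exists>t. (if y + c < y then y + c < t \<and> t < y else y < t \<and> t < y + c) \<and>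
      f (y + c) = (\<Sum>m<2. D m y / fact m * (y + c - y) ^ m) + D 2 t / fact 2 * (y + c - y) ^ 2"
    proof (rule Taylor[where a = "y - \<bar>b\<bar>" and b = "y + \<bar>b\<bar>"])
      show "\<forall>m t. m < 2 \<and> y - \<bar>b\<bar> \<le> t \<and> t \<le> y + \<bar>b\<bar> \<longrightarrow> DERIV (D m) t :> D (Suc m) t"
        using f f' by (auto simp: D_def less_2_cases_iff)
    qed (use c in \<open>auto simp: D_def\<close>)
    then obtain t where t0: "if y + c < y then y + c < t \<and> t < y else y < t \<and> t < y + c"
      "f (y + c) = f y + f' y * c + f'' t / 2 * c\<^sup>2"
      by (auto simp: D_def eval_nat_numeral)
    then have t: "\<bar>t - y\<bar> \<le> \<bar>c\<bar>" by (auto split: if_splits)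
    have "f'' t / 2 * c\<^sup>2 \<le> B / 2 * c\<^sup>2"
      using B[of t] t c by (intro mult_right_mono) auto
    then show ?thesis using t0 by simp
  qed
  show ?thesis
  proof (cases "b = 0")
    case False
    then show ?thesis using taylor[of b] taylor[of "-b"] by (simp add: algebra_simps)
  qed simp
qed

section \<open>The Riesz kernel as a function of the squared distance\<close>

text \<open>The kernel in terms of the squared distance, a variable that is explicit for displaced
  points and in which the kernel is convex. At 0 the conventions \<open>0 powr a = 0\<close> and
  \<open>ln 0 = 0\<close> give the value 0, which is the value of the kernel at the origin only for
  \<open>s < 0\<close>; hence the recurring alternative
  \<open>x \<noteq> y \<or> s < 0\<close>.\<close>

definition riesz_sq :: "real \<Rightarrow> real \<Rightarrow> real" where
  "riesz_sq s X = (if s = 0 then - ln X / 2 else X powr (- s / 2) / s)"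

lemma riesz_kernel_eq_riesz_sq:
  assumes "z \<noteq> 0 \<or> s < 0"
  shows "riesz_kernel s z = ereal (riesz_sq s ((norm z)\<^sup>2))"
proof (cases "z = 0")
  case False
  have "((norm z)\<^sup>2) powr (- s / 2) = norm z powr (- s)"
    using False by (simp add: powr_power powr_powr flip: powr_numeral)
  then show ?thesis using False
    by (auto simp: riesz_kernel_def riesz_sq_def ln_realpow powr_minus field_simps)
qed (use assms in \<open>auto simp: riesz_kernel_def riesz_sq_def\<close>)

text \<open>The normalisation by 1/s makes the derivative the same expression for all s, logarithm
  included, so that later estimates can treat all s at once.\<close>

lemma riesz_sq_deriv:
  assumes "X > 0"
  shows "(riesz_sq s has_real_derivative - (X powr (- s / 2 - 1)) / 2) (at X)"
proof (cases "s = 0")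
  case True
  have "((\<lambda>X. - ln X / 2) has_real_derivative - (X powr - 1) / 2) (at X)"
    using assms by (auto intro!: derivative_eq_intros simp: powr_minus_divide)
  moreover have "riesz_sq s = (\<lambda>X. - ln X / 2)" using True by (auto simp: riesz_sq_def)
  ultimately show ?thesis using True by simp
next
  case False
  have "((\<lambda>X. X powr (- s / 2) / s) has_real_derivative - (X powr (- s / 2 - 1)) / 2) (at X)"
    using assms False by (auto intro!: derivative_eq_intros)
  moreover have "riesz_sq s = (\<lambda>X. X powr (- s / 2) / s)" using False by (auto simp: riesz_sq_def)
  ultimately show ?thesis by simp
qed

lemma riesz_sq_antimono:
  assumes "0 < X \<or> s < 0" "0 \<le> X" "X \<le> Y"
  shows "riesz_sq s Y \<le> riesz_sq s X"
proof (cases "s = 0")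
  case False
  then show ?thesis
  proof (cases "s > 0")
    case True
    then have "Y powr (- s / 2) \<le> X powr (- s / 2)"
      using assms by (intro powr_mono2') auto
    then show ?thesis using True by (simp add: riesz_sq_def divide_right_mono)
  next
    assume "s \<noteq> 0" "\<not> s > 0"
    moreover from this have "X powr (- s / 2) \<le> Y powr (- s / 2)"
      using assms by (intro powr_mono2) auto
    ultimately show ?thesis by (simp add: riesz_sq_def divide_right_mono_neg)
  qed
qed (use assms in \<open>auto simp: riesz_sq_def\<close>)

text \<open>The second derivative \<open>(s / 2 + 1) / 2 * X powr (- s / 2 - 2)\<close> is
  nonnegative and decreasing for \<open>s > -2\<close>, so on the interval it is at most its value
  at \<open>L\<close>.\<close>

lemma riesz_sq_second_difference:
  assumes s: "s > -2" and L: "0 < L" "L \<le> Y - \<bar>b\<bar>"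
  shows "riesz_sq s (Y + b) + riesz_sq s (Y - b) - 2 * riesz_sq s Y
    \<le> (s / 2 + 1) / 2 * L powr (- s / 2 - 2) * b\<^sup>2"
proof (rule second_difference_le)
  fix x assume "\<bar>x - Y\<bar> \<le> \<bar>b\<bar>"
  with L have x: "L \<le> x" by linarith
  with L show "(riesz_sq s has_real_derivative - (x powr (- s / 2 - 1)) / 2) (at x)"
    by (intro riesz_sq_deriv) auto
  show "((\<lambda>x. - (x powr (- s / 2 - 1)) / 2) has_real_derivative
      (s / 2 + 1) / 2 * x powr (- s / 2 - 2)) (at x)"
    using x L by (auto intro!: derivative_eq_intros simp: field_simps)
  show "(s / 2 + 1) / 2 * x powr (- s / 2 - 2) \<le> (s / 2 + 1) / 2 * L powr (- s / 2 - 2)"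
    using x L s by (intro mult_left_mono powr_mono2') auto
qed

lemma riesz_sq_diff_le:
  assumes "0 < X \<or> s < 0" "0 \<le> X" "s > -2" "h > 0"
  shows "riesz_sq s (X + h) - riesz_sq s X \<le> - (h / 2 * (X + h) powr (- s / 2 - 1))"
proof (cases "X = 0")
  case True
  have "h * h powr (- s / 2 - 1) = h powr (- s / 2)"
    using assms by (simp add: powr_diff)
  \<comment> \<open>There is no derivative at \<open>X = 0\<close>, but the values are explicit, and
    \<open>1 / s \<le> - (1 / 2)\<close> because \<open>-2 < s < 0\<close>.\<close>
  moreover have "h powr (- s / 2) / s \<le> h powr (- s / 2) * (- (1 / 2))"
    unfolding divide_inverse using assms True
    by (intro mult_left_mono) (auto simp: field_simps)
  ultimately show ?thesis using True assms by (simp add: riesz_sq_def)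
next
  case False
  then have "\<exists>z. X < z \<and> z < X + h \<and>
      riesz_sq s (X + h) - riesz_sq s X = (X + h - X) * (- (z powr (- s / 2 - 1)) / 2)"
    using assms by (intro MVT2 riesz_sq_deriv) auto
  then obtain z where z: "X < z" "z < X + h"
    "riesz_sq s (X + h) - riesz_sq s X = h * (- (z powr (- s / 2 - 1)) / 2)" by auto
  have "(X + h) powr (- s / 2 - 1) \<le> z powr (- s / 2 - 1)"
    using z assms by (intro powr_mono2') auto
  then have "h / 2 * (X + h) powr (- s / 2 - 1) \<le> h / 2 * z powr (- s / 2 - 1)"
    using assms by (intro mult_left_mono) auto
  then show ?thesis using z by simp
qed

lemma norm_add_sq: "(norm (z + w))\<^sup>2 = (norm z)\<^sup>2 + (norm w)\<^sup>2 + 2 * (z \<bullet> w)"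
  for z w :: "'a::real_inner"
  by (simp add: power2_norm_eq_inner inner_add inner_commute)

lemma norm_diff_sq: "(norm (z - w))\<^sup>2 = (norm z)\<^sup>2 + (norm w)\<^sup>2 - 2 * (z \<bullet> w)"
  for z w :: "'a::real_inner"
  by (simp add: power2_norm_eq_inner inner_diff inner_commute)

text \<open>The two squared distances are \<open>Y + b\<close> and \<open>Y - b\<close>.
  Monotonicity replaces \<open>X\<close> by \<open>Y\<close> in the middle term, convexity bounds
  the rest by a multiple of \<open>b\<^sup>2\<close>, and Cauchy-Schwarz turns this into
  \<open>4 * X * (norm w)\<^sup>2\<close>. The bound is uniform in \<open>z\<close> because
  \<open>- s - 2 < 0\<close>.\<close>

lemma riesz_sq_far_second_difference:
  fixes z w :: "'a::real_inner"
  assumes s: "s > -2" and \<delta>: "\<delta> > 0" "\<delta> \<le> norm z" "norm w \<le> \<delta> / 2"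
  shows "riesz_sq s ((norm (z + w))\<^sup>2) + riesz_sq s ((norm (z - w))\<^sup>2) - 2 * riesz_sq s ((norm z)\<^sup>2)
    \<le> (s + 2) * 4 powr (s / 2 + 2) * \<delta> powr (- s - 2) * (norm w)\<^sup>2"
proof -
  define X where "X = (norm z)\<^sup>2"
  define b where "b = 2 * (z \<bullet> w)"
  define Y where "Y = X + (norm w)\<^sup>2"
  have z0: "norm z > 0" using \<delta> by linarith
  have b: "\<bar>b\<bar> \<le> 2 * (norm z * norm w)" unfolding b_def using Cauchy_Schwarz_ineq2[of z w] by simp
  have "norm w \<le> norm z / 2" using \<delta> by linarith
  then have "(norm z / 2)\<^sup>2 \<le> (norm z - norm w)\<^sup>2" by (intro power_mono) auto
  also have "\<dots> = Y - 2 * (norm z * norm w)"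
    by (simp add: Y_def X_def power2_eq_square algebra_simps)
  also have "\<dots> \<le> Y - \<bar>b\<bar>" using b by linarith
  finally have L: "X / 4 \<le> Y - \<bar>b\<bar>" by (simp add: X_def power2_eq_square)
  have X0: "X > 0" using z0 by (simp add: X_def)
  have "riesz_sq s Y \<le> riesz_sq s X" using X0 by (intro riesz_sq_antimono) (auto simp: Y_def)
  then have "riesz_sq s (Y + b) + riesz_sq s (Y - b) - 2 * riesz_sq s X \<le>
     riesz_sq s (Y + b) + riesz_sq s (Y - b) - 2 * riesz_sq s Y" by simp
  also have "\<dots> \<le> (s / 2 + 1) / 2 * (X / 4) powr (- s / 2 - 2) * b\<^sup>2"
    using L X0 s by (intro riesz_sq_second_difference) auto
  also have "\<dots> \<le> (s / 2 + 1) / 2 * (X / 4) powr (- s / 2 - 2) * (4 * X * (norm w)\<^sup>2)"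
  proof (intro mult_left_mono)
    have "\<bar>b\<bar>\<^sup>2 \<le> (2 * (norm z * norm w))\<^sup>2" using b by (intro power_mono) auto
    then show "b\<^sup>2 \<le> 4 * X * (norm w)\<^sup>2" by (simp add: X_def power_mult_distrib)
  qed (use s in auto)
  also have "\<dots> = (s + 2) * 4 powr (s / 2 + 2) * X powr (- s / 2 - 1) * (norm w)\<^sup>2"
  proof -
    have "(X / 4) powr (- s / 2 - 2) = X powr (- s / 2 - 2) * 4 powr (s / 2 + 2)"
      using X0 by (simp add: powr_divide powr_diff powr_minus powr_add field_simps)
    moreover have "X powr (- s / 2 - 2) * X = X powr (- s / 2 - 1)"
    proof -
      have e: "- s / 2 - 1 = (- s / 2 - 2) + 1" by simp
      show ?thesis unfolding e powr_add using X0 by simp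
    qed
    moreover have "(s / 2 + 1) / 2 * (P * Q) * (4 * X * W) = (s + 2) * Q * (P * X) * W" for P Q W
      by (simp add: algebra_simps)
    ultimately show ?thesis by (simp only:)
  qed
  also have "\<dots> \<le> (s + 2) * 4 powr (s / 2 + 2) * \<delta> powr (- s - 2) * (norm w)\<^sup>2"
  proof (intro mult_left_mono mult_right_mono)
    have "X powr (- s / 2 - 1) = norm z powr (- s - 2)"
      unfolding X_def using z0 by (simp add: powr_powr flip: powr_numeral)
    also have "\<dots> \<le> \<delta> powr (- s - 2)" using s \<delta> by (intro powr_mono2') auto
    finally show "X powr (- s / 2 - 1) \<le> \<delta> powr (- s - 2)" .
  qed (use s in auto)
  finally show ?thesis unfolding norm_add_sq norm_diff_sq Y_def X_def b_def .
qed

text \<open>As a function of the distance the kernel has derivative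
  \<open>- (r powr (- s - 1))\<close>, which is bounded away from 0 when \<open>s \<ge> -1\<close>.
  So the change stays bounded although \<open>norm z\<close> is not, which keeps displaced energies
  integrable at infinity.\<close>

lemma riesz_sq_far_difference:
  fixes z w :: "'a::real_inner"
  assumes s: "s \<ge> -1" and \<delta>: "\<delta> > 0" "\<delta> \<le> norm z" "norm w \<le> \<delta> / 2"
  shows "\<bar>riesz_sq s ((norm (z + w))\<^sup>2) - riesz_sq s ((norm z)\<^sup>2)\<bar> \<le> (\<delta> / 2) powr (- s)"
proof -
  have deriv: "((\<lambda>r. riesz_sq s (r\<^sup>2)) has_real_derivative - (r powr (- s - 1))) (at r within {\<delta>/2..})"
    if "r \<in> {\<delta>/2..}" for r
  proof -
    have r: "r > 0" using that \<delta> by auto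
    have "((\<lambda>r. riesz_sq s (r\<^sup>2)) has_real_derivative - ((r\<^sup>2) powr (- s / 2 - 1)) / 2 * (2 * r)) (at r)"
      using r by (intro DERIV_chain2[OF riesz_sq_deriv]) (auto intro!: derivative_eq_intros)
    moreover have "(r\<^sup>2) powr (- s / 2 - 1) * r = r powr (- s - 1)"
    proof -
      have "(r\<^sup>2) powr (- s / 2 - 1) = r powr (- s - 2)"
        using r by (simp add: powr_powr flip: powr_numeral)
      moreover have e: "- s - 1 = (- s - 2) + 1" by simp
      ultimately show ?thesis unfolding e powr_add using r by simp
    qed
    ultimately show ?thesis by (simp add: has_field_derivative_at_within)
  qed
  have "\<bar>norm (z + w) - norm z\<bar> \<le> norm w"
    using norm_triangle_ineq3[of "z + w" z] by simp
  then have nz: "norm z \<in> {\<delta>/2..}" "norm (z + w) \<in> {\<delta>/2..}" "\<bar>norm (z + w) - norm z\<bar> \<le> \<delta> / 2"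
    using \<delta> by auto
  have "norm (riesz_sq s ((norm (z + w))\<^sup>2) - riesz_sq s ((norm z)\<^sup>2))
     \<le> (\<delta>/2) powr (- s - 1) * norm (norm (z + w) - norm z)"
  proof (rule field_differentiable_bound[OF _ deriv])
    fix r assume "r \<in> {\<delta>/2..}"
    then show "norm (- (r powr (- s - 1))) \<le> (\<delta>/2) powr (- s - 1)"
      using s \<delta> by (auto intro!: powr_mono2')
  qed (use nz in auto)
  also have "\<dots> \<le> (\<delta>/2) powr (- s - 1) * (\<delta> / 2)"
    using nz by (intro mult_left_mono) auto
  also have "\<dots> = (\<delta>/2) powr (- s)" using \<delta> powr_add[of "\<delta>/2" "- s - 1" 1] by simp
  finally show ?thesis by simp
qed

section \<open>Extended derivatives of the profile\<close>

text \<open>Next to finite values an infinite \<open>f y\<close> makes the quotients equal to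
  \<open>- f y\<close> on the right and to \<open>f y\<close> on the left, so they have no two-sided
  limit.\<close>

lemma ext_quotient_convergent_imp_finite:
  assumes lim: "(ext_quotient f y \<longlongrightarrow> D) (at y)"
    and near: "\<forall>\<^sub>F x in at y. \<bar>f x\<bar> \<noteq> \<infinity>"
  shows "\<bar>f y\<bar> \<noteq> \<infinity>"
proof
  assume inf: "\<bar>f y\<bar> = \<infinity>"
  have near': "\<forall>\<^sub>F x in at_right y. \<bar>f x\<bar> \<noteq> \<infinity>" "\<forall>\<^sub>F x in at_left y. \<bar>f x\<bar> \<noteq> \<infinity>"
    using near by (auto simp: eventually_at_split)
  have lim': "(ext_quotient f y \<longlongrightarrow> D) (at_right y)" "(ext_quotient f y \<longlongrightarrow> D) (at_left y)"
    using lim by (auto simp: filterlim_at_split)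
  have gt: "\<forall>\<^sub>F x in at_right y. x > y" and lt: "\<forall>\<^sub>F x in at_left y. x < y"
    by (auto simp: eventually_at_filter)
  have "\<forall>\<^sub>F x in at_right y. ext_quotient f y x = - f y"
    using near'(1) gt
  proof eventually_elim
    case (elim x)
    then show ?case using inf
      by (cases "f x"; cases "f y") (auto simp: ext_quotient_def divide_ereal_def)
  qed
  then have "((\<lambda>_. - f y) \<longlongrightarrow> D) (at_right y)"
    using lim'(1) by (rule Lim_transform_eventually[rotated])
  then have "D = - f y" by (simp add: tendsto_const_iff)
  have "\<forall>\<^sub>F x in at_left y. ext_quotient f y x = f y"
    using near'(2) lt
  proof eventually_elim
    case (elim x)
    then show ?case using inf
      by (cases "f x"; cases "f y") (auto simp: ext_quotient_def divide_ereal_def)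
  qed
  then have "((\<lambda>_. f y) \<longlongrightarrow> D) (at_left y)"
    using lim'(2) by (rule Lim_transform_eventually[rotated])
  then have "D = f y" by (simp add: tendsto_const_iff)
  with \<open>D = - f y\<close> inf show False by (cases "f y") auto
qed

lemma at_within_half_line: "y > 0 \<Longrightarrow> at y within {0..} = at (y::real)"
  by (rule at_within_open_subset[of _ "{0<..}"]) auto

lemma eventually_not_in_finite:
  fixes F :: "'a::t1_space set"
  assumes "finite F"
  shows "\<forall>\<^sub>F x in at y. x \<notin> F"
proof -
  have "open (- (F - {y}))" using assms by (intro open_Compl finite_imp_closed) auto
  then show ?thesis unfolding eventually_at_topological by blast
qed

lemma ext_deriv_finite_imp_has_real_derivative:
  assumes y: "y > 0"
    and conv: "(ext_quotient f y \<longlongrightarrow> D) (at y within {0..})"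
    and fin: "finite {x \<in> {0..}. \<bar>f x\<bar> = \<infinity>}"
    and D: "\<bar>ext_deriv {0..} f y\<bar> \<noteq> \<infinity>"
  shows "((\<lambda>x. real_of_ereal (f x)) has_real_derivative real_of_ereal (ext_deriv {0..} f y)) (at y)"
proof -
  have lim: "(ext_quotient f y \<longlongrightarrow> D) (at y)" using conv at_within_half_line[OF y] by simp
  \<comment> \<open>\<open>ext_deriv\<close> is a \<open>Lim\<close>, which means something only
    under convergence; \<open>conv\<close> identifies it.\<close>
  have "D = ext_deriv {0..} f y"
    using lim at_within_half_line[OF y] unfolding ext_deriv_def by (simp add: tendsto_Lim)
  with lim have lim: "(ext_quotient f y \<longlongrightarrow> ext_deriv {0..} f y) (at y)" by simp
  have "\<forall>\<^sub>F x in at y. x > 0" using y by (intro order_tendstoD(1)[OF tendsto_ident_at])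
  with eventually_not_in_finite[OF fin, of y] have near: "\<forall>\<^sub>F x in at y. \<bar>f x\<bar> \<noteq> \<infinity>"
    by eventually_elim auto
  have fy: "\<bar>f y\<bar> \<noteq> \<infinity>" by (rule ext_quotient_convergent_imp_finite[OF lim near])
  have "((\<lambda>x. real_of_ereal (ext_quotient f y x)) \<longlongrightarrow> real_of_ereal (ext_deriv {0..} f y)) (at y)"
    using lim D by (intro lim_real_of_ereal) (simp add: ereal_real)
  moreover have "\<forall>\<^sub>F x in at y. real_of_ereal (ext_quotient f y x)
      = (real_of_ereal (f x) - real_of_ereal (f y)) / (x - y)"
    using near eventually_neq_at_within[of y y UNIV]
  proof eventually_elim
    case (elim x)
    then show ?case using fy
      by (cases "f x"; cases "f y") (auto simp: ext_quotient_def)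
  qed
  ultimately show ?thesis unfolding has_field_derivative_iff
    by (rule Lim_transform_eventually)
qed

text \<open>Finiteness on the open half line is assumed for the second derivative of the profile;
  for the lower orders it follows from here. Exceptional points are finitely many, so each has
  finite values around it, and the difference quotient converges there.\<close>

lemma ext_Ck_on_imp_finite:
  assumes "ext_Ck_on k {0..} f" "l < k" "y > 0"
  shows "\<bar>(ext_deriv {0..} ^^ l) f y\<bar> \<noteq> \<infinity>"
proof -
  obtain D where D: "(ext_quotient ((ext_deriv {0..} ^^ l) f) y \<longlongrightarrow> D) (at y within {0..})"
    using assms(1-3) unfolding ext_Ck_on_def by (meson atLeast_iff less_imp_le)
  have fin: "finite {y \<in> {0..}. \<bar>(ext_deriv {0..} ^^ l) f y\<bar> = \<infinity>}"
    using assms unfolding ext_Ck_on_def by auto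
  have "\<forall>\<^sub>F x in at y. x > 0" using assms by (intro order_tendstoD(1)[OF tendsto_ident_at])
  with eventually_not_in_finite[OF fin, of y]
  have "\<forall>\<^sub>F x in at y. \<bar>(ext_deriv {0..} ^^ l) f x\<bar> \<noteq> \<infinity>"
    by eventually_elim auto
  then show ?thesis
    using D at_within_half_line[OF \<open>y > 0\<close>] by (intro ext_quotient_convergent_imp_finite) auto
qed

lemma ext_Ck_on_has_real_derivative:
  assumes "ext_Ck_on k {0..} f" "l < k" "y > 0" "\<bar>(ext_deriv {0..} ^^ Suc l) f y\<bar> \<noteq> \<infinity>"
  shows "((\<lambda>x. real_of_ereal ((ext_deriv {0..} ^^ l) f x)) has_real_derivative
    real_of_ereal ((ext_deriv {0..} ^^ Suc l) f y)) (at y)"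
proof -
  obtain D where D: "(ext_quotient ((ext_deriv {0..} ^^ l) f) y \<longlongrightarrow> D) (at y within {0..})"
    using assms(1-3) unfolding ext_Ck_on_def by (meson atLeast_iff less_imp_le)
  have fin: "finite {y \<in> {0..}. \<bar>(ext_deriv {0..} ^^ l) f y\<bar> = \<infinity>}"
    using assms unfolding ext_Ck_on_def by auto
  show ?thesis
    using ext_deriv_finite_imp_has_real_derivative[OF \<open>y > 0\<close> D fin] assms(4) by simp
qed

lemma ext_Ck_on_isCont:
  assumes "ext_Ck_on k {0..} f" "l \<le> k" "y > 0" "\<bar>(ext_deriv {0..} ^^ l) f y\<bar> \<noteq> \<infinity>"
  shows "isCont (\<lambda>x. real_of_ereal ((ext_deriv {0..} ^^ l) f x)) y"
proof -
  have "((ext_deriv {0..} ^^ l) f \<longlongrightarrow> (ext_deriv {0..} ^^ l) f y) (at y within {0..})"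
    using assms unfolding ext_Ck_on_def by auto
  then show ?thesis
    unfolding isCont_def using assms at_within_half_line[OF \<open>y > 0\<close>]
    by (intro lim_real_of_ereal) (simp add: ereal_real)
qed

lemma ext_Ck_on_imp_continuous_on:
  assumes "ext_Ck_on k {0..} f"
  shows "continuous_on {0..} f"
proof -
  have "\<forall>l\<le>k. \<forall>y\<in>{0..}.
      ((ext_deriv {0..} ^^ l) f \<longlongrightarrow> (ext_deriv {0..} ^^ l) f y) (at y within {0..})"
    using assms unfolding ext_Ck_on_def by blast
  from this[rule_format, of 0] show ?thesis by (simp add: continuous_on_def)
qed

text \<open>\<open>\<phi>''\<close> is the second derivative of
  \<open>\<lambda>x. f (x\<^sup>2)\<close>. It is continuous at \<open>r\<close>, hence at most
  \<open>\<phi>'' r + 1\<close> nearby.\<close>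

lemma radial_second_difference:
  fixes f f' f'' :: "real \<Rightarrow> real"
  assumes r: "r > 0"
    and f: "\<And>x. x > 0 \<Longrightarrow> (f has_real_derivative f' x) (at x)"
    and f': "\<And>x. x > 0 \<Longrightarrow> (f' has_real_derivative f'' x) (at x)"
    and f'': "isCont f'' (r\<^sup>2)"
  shows "\<exists>C \<epsilon>. \<epsilon> > 0 \<and> (\<forall>t. \<bar>t\<bar> \<le> \<epsilon> \<longrightarrow> f ((r + t)\<^sup>2) + f ((r - t)\<^sup>2) - 2 * f (r\<^sup>2) \<le> C * t\<^sup>2)"
proof -
  define \<phi>'' where "\<phi>'' = (\<lambda>x. 2 * f' (x\<^sup>2) + 4 * x\<^sup>2 * f'' (x\<^sup>2))"
  have r2: "r\<^sup>2 > 0" using r by simp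
  have "isCont (\<lambda>x. f' (x\<^sup>2)) r"
    by (rule isCont_o2[where f = "\<lambda>x. x\<^sup>2"]) (simp_all add: DERIV_isCont[OF f'[OF r2]])
  moreover have "isCont (\<lambda>x. f'' (x\<^sup>2)) r"
    by (rule isCont_o2[where f = "\<lambda>x. x\<^sup>2"]) (simp_all add: f'')
  ultimately have "isCont \<phi>'' r" unfolding \<phi>''_def
    by (intro continuous_intros)
  then have "\<forall>\<^sub>F x in at r. \<phi>'' x < \<phi>'' r + 1"
    unfolding isCont_def by (rule order_tendstoD) simp
  then obtain d where d: "d > 0" "\<And>x. x \<noteq> r \<Longrightarrow> dist x r < d \<Longrightarrow> \<phi>'' x < \<phi>'' r + 1"
    unfolding eventually_at by auto
  define \<epsilon> where "\<epsilon> = min (d / 2) (r / 2)"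
  have "f ((r + t)\<^sup>2) + f ((r - t)\<^sup>2) - 2 * f (r\<^sup>2) \<le> (\<phi>'' r + 1) * t\<^sup>2" if t: "\<bar>t\<bar> \<le> \<epsilon>" for t
  proof (rule second_difference_le[where f = "\<lambda>x. f (x\<^sup>2)" and f' = "\<lambda>x. f' (x\<^sup>2) * (2 * x)"])
    fix x assume x: "\<bar>x - r\<bar> \<le> \<bar>t\<bar>"
    then have "\<bar>x - r\<bar> \<le> r / 2" "\<bar>x - r\<bar> \<le> d / 2"
      using t by (auto simp: \<epsilon>_def)
    then have "x > 0" using r by linarith
    then have x0: "x\<^sup>2 > 0" "x > 0" by auto
    show "((\<lambda>x. f (x\<^sup>2)) has_real_derivative f' (x\<^sup>2) * (2 * x)) (at x)"
      using x0 by (intro DERIV_chain2[OF f]) (auto intro!: derivative_eq_intros)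
    have "((\<lambda>x. f' (x\<^sup>2)) has_real_derivative f'' (x\<^sup>2) * (2 * x)) (at x)"
      using x0 by (intro DERIV_chain2[OF f']) (auto intro!: derivative_eq_intros)
    then show "((\<lambda>x. f' (x\<^sup>2) * (2 * x)) has_real_derivative \<phi>'' x) (at x)"
      by (auto intro!: derivative_eq_intros simp: \<phi>''_def power2_eq_square algebra_simps)
    show "\<phi>'' x \<le> \<phi>'' r + 1"
      using d(2)[of x] \<open>\<bar>x - r\<bar> \<le> d / 2\<close> d(1) by (cases "x = r") (auto simp: dist_real_def)
  qed
  moreover have "\<epsilon> > 0" using d r by (simp add: \<epsilon>_def)
  ultimately show ?thesis by blast
qed

text \<open>Comparison: \<open>\<lambda>y. g y - \<eta> * y powr p\<close> has nonpositive
  derivative near 0 and is continuous at 0. With \<open>p = - s / 2\<close> and argument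
  \<open>t\<^sup>2\<close> this bounds the growth of the field at the origin by
  \<open>\<eta> * t powr (- s)\<close>.\<close>

lemma growth_at_zero:
  fixes g g' :: "real \<Rightarrow> real"
  assumes p: "p > 0" and \<eta>: "\<eta> > 0"
    and cont: "(g \<longlongrightarrow> g 0) (at_right 0)"
    and g: "\<And>x. x > 0 \<Longrightarrow> (g has_real_derivative g' x) (at x)"
    and g': "((\<lambda>x. x powr (1 - p) * g' x) \<longlongrightarrow> 0) (at_right 0)"
  shows "\<exists>\<epsilon>>0. \<forall>x. 0 < x \<and> x < \<epsilon> \<longrightarrow> g x - g 0 \<le> \<eta> * x powr p"
proof -
  have "\<forall>\<^sub>F x in at_right 0. x powr (1 - p) * g' x < \<eta> * p"
    using g' p \<eta> by (intro order_tendstoD(2)[OF g']) auto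
  then obtain \<epsilon> where \<epsilon>: "\<epsilon> > 0" "\<And>x. 0 < x \<Longrightarrow> x < \<epsilon> \<Longrightarrow> x powr (1 - p) * g' x < \<eta> * p"
    unfolding eventually_at_right_field by auto
  have "g x - g 0 \<le> \<eta> * x powr p" if x: "0 < x" "x < \<epsilon>" for x
  proof -
    define h where "h = (\<lambda>y. g y - \<eta> * y powr p)"
    have "h x \<le> h 0"
    proof (rule DERIV_nonpos_imp_decreasing_open[where f = h])
      show "(0::real) \<le> x" using x by simp
      show "\<exists>D. (h has_real_derivative D) (at y) \<and> D \<le> 0" if y: "0 < y" "y < x" for y
      proof (rule exI[of _ "g' y - \<eta> * (p * y powr (p - 1))"], rule conjI)
        show "(h has_real_derivative g' y - \<eta> * (p * y powr (p - 1))) (at y)"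
          unfolding h_def using y g by (auto intro!: derivative_eq_intros)
        have "y powr (p - 1) * (y powr (1 - p) * g' y) \<le> y powr (p - 1) * (\<eta> * p)"
          using \<epsilon>(2)[of y] y x by (intro mult_left_mono) auto
        also have "y powr (p - 1) * (y powr (1 - p) * g' y) = g' y"
          using y by (simp add: mult.assoc[symmetric] flip: powr_add)
        finally show "g' y - \<eta> * (p * y powr (p - 1)) \<le> 0"
          by (simp add: mult_ac)
      qed
      have "continuous (at y within {0..x}) g" if "y \<in> {0..x}" for y
      proof (cases "y = 0")
        case True
        have "at 0 within {0..x} = at_right 0" using x by (simp add: at_within_Icc_at_right)
        then show ?thesis using True cont by (simp add: continuous_within)
      next
        case False
        then show ?thesis using that DERIV_isCont[OF g, of y] continuous_at_imp_continuous_at_within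
          by auto
      qed
      then have "continuous_on {0..x} g" by (simp add: continuous_on_eq_continuous_within)
      moreover have "continuous_on {0..x} (\<lambda>y. y powr p)"
        using p by (intro continuous_on_powr' continuous_intros) auto
      ultimately show "continuous_on {0..x} h" unfolding h_def
        by (intro continuous_on_diff continuous_on_mult continuous_on_const)
    qed
    then show ?thesis using p by (simp add: h_def)
  qed
  with \<epsilon>(1) show ?thesis by blast
qed

section \<open>Mass of spherical caps\<close>

text \<open>Since \<open>unif_sphere\<close> is the law of \<open>sgn x\<close> for \<open>x\<close>
  uniform in the ball, the mass of a cap is the normalised volume of the cone over it. For a cap
  around a coordinate vector this cone contains a box of length 1/4 in that direction and width of
  order \<rho> in the other d - 1; orthogonal invariance carries the bound to every
  \<theta>.\<close>

lemma unif_sphere_cap: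
  "\<exists>c>0. \<forall>\<theta> \<rho>. norm \<theta> = 1 \<longrightarrow> 0 < \<rho> \<longrightarrow> \<rho> \<le> 1 \<longrightarrow>
     c * \<rho> ^ (CARD('n) - 1) \<le> measure unif_sphere (ball (\<theta> :: real ^ 'n) \<rho>)"
proof -
  fix i :: 'n
  define d where "d = real CARD('n)"
  define e :: "real ^ 'n" where "e = axis i 1"
  define B where "B = ball (0 :: real ^ 'n) 1"
  have d: "d > 0" by (simp add: d_def)
  have ne: "norm e = 1" by (simp add: e_def)
  have Bpos: "measure lborel B > 0"
    using unit_ball_vol_pos[of d] by (simp add: B_def d_def content_ball del: unit_ball_vol_pos)
  define c where "c = 1 / 4 * (1 / (4 * d)) ^ (CARD('n) - 1) / measure lborel B"
  have c: "c > 0" using d Bpos by (simp add: c_def)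
  have cap: "c * \<rho> ^ (CARD('n) - 1) \<le> measure unif_sphere (ball e \<rho>)" if \<rho>: "0 < \<rho>" "\<rho> \<le> 1" for \<rho>
  proof -
    \<comment> \<open>The transversal part of \<open>x\<close> has norm at most
      \<open>\<rho> / 8\<close>. Hence \<open>norm x\<close> exceeds \<open>x $ i\<close> by at most
      \<open>\<rho> / 8\<close> and \<open>x\<close> is within \<open>\<rho> / 4\<close> of
      \<open>norm x *\<^sub>R e\<close>; as \<open>norm x \<ge> 1/2\<close>, the distance after
      normalisation is below \<rho>. The ball contains the box because
      \<open>3/4 + 1/8 < 1\<close>.\<close>
    define l u :: "real ^ 'n" where "l = (\<chi> j. if j = i then 1/2 else - \<rho> / (8 * d))"
      and "u = (\<chi> j. if j = i then 3/4 else \<rho> / (8 * d))"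
    have sub: "cbox l u \<subseteq> B \<inter> sgn -` ball e \<rho>"
    proof
      fix x assume "x \<in> cbox l u"
      then have lu: "l $ j \<le> x $ j" "x $ j \<le> u $ j" for j by (auto simp: mem_box_cart)
      have xi: "1/2 \<le> x $ i" "x $ i \<le> 3/4" using lu[of i] by (auto simp: l_def u_def)
      have "norm (x - (x $ i) *\<^sub>R e) \<le> (\<Sum>j\<in>UNIV. \<bar>(x - (x $ i) *\<^sub>R e) $ j\<bar>)"
        by (rule norm_le_l1_cart)
      also have "\<dots> \<le> (\<Sum>j\<in>(UNIV::'n set). \<rho> / (8 * d))"
      proof (rule sum_mono)
        fix j
        show "\<bar>(x - (x $ i) *\<^sub>R e) $ j\<bar> \<le> \<rho> / (8 * d)"
          using lu[of j] \<rho> d by (cases "j = i") (auto simp: e_def axis_def l_def u_def)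
      qed
      also have "\<dots> = \<rho> / 8" using d by (simp add: d_def)
      finally have y: "norm (x - (x $ i) *\<^sub>R e) \<le> \<rho> / 8" .
      have nx1: "norm x \<le> x $ i + \<rho> / 8"
        using norm_triangle_ineq[of "x - (x $ i) *\<^sub>R e" "(x $ i) *\<^sub>R e"] y ne xi by simp
      have nx2: "x $ i \<le> norm x" using component_le_norm_cart[of x i] by simp
      have nx: "norm x > 0" using nx2 xi by linarith
      have "norm (x - norm x *\<^sub>R e) \<le> norm (x - (x $ i) *\<^sub>R e) + norm ((x $ i - norm x) *\<^sub>R e)"
        using norm_triangle_ineq[of "x - (x $ i) *\<^sub>R e" "(x $ i - norm x) *\<^sub>R e"]
        by (simp add: algebra_simps)
      also have "\<dots> \<le> \<rho> / 8 + \<rho> / 8" using y nx1 nx2 ne by (intro add_mono) auto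
      also have "\<dots> < \<rho> * norm x"
      proof -
        have "\<rho> * (1/2) \<le> \<rho> * norm x" using nx2 xi \<rho> by (intro mult_left_mono) auto
        then show ?thesis using \<rho> by linarith
      qed
      finally have "norm (x - norm x *\<^sub>R e) < \<rho> * norm x" .
      moreover have "norm (sgn x - e) = norm (x - norm x *\<^sub>R e) / norm x"
      proof -
        have eq: "sgn x - e = (1 / norm x) *\<^sub>R (x - norm x *\<^sub>R e)"
          using nx by (simp add: sgn_div_norm algebra_simps divide_inverse)
        show ?thesis unfolding eq norm_scaleR by simp
      qed
      ultimately have "norm (sgn x - e) < \<rho>"
        using nx by (simp add: pos_divide_less_eq)
      moreover have "norm x < 1" using nx1 xi \<rho> by linarith
      ultimately show "x \<in> B \<inter> sgn -` ball e \<rho>" by (simp add: B_def dist_norm norm_minus_commute)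
    qed
    have ms: "sgn -` ball e \<rho> \<in> sets (borel :: (real ^ 'n) measure)"
      using measurable_sets[OF measurable_sgn, of "ball e \<rho>"] by simp
    have "1 / 4 * (\<rho> / (4 * d)) ^ (CARD('n) - 1) = (\<Prod>j\<in>UNIV. u $ j - l $ j)"
    proof -
      have "(\<Prod>j\<in>UNIV. u $ j - l $ j) = (u $ i - l $ i) * (\<Prod>j\<in>UNIV - {i}. u $ j - l $ j)"
        by (rule prod.remove) auto
      also have "(\<Prod>j\<in>UNIV - {i}. u $ j - l $ j) = (\<Prod>j\<in>UNIV - {i}. \<rho> / (4 * d))"
        by (rule prod.cong) (auto simp: u_def l_def field_simps)
      finally show ?thesis by (simp add: u_def l_def card_Diff_singleton)
    qed
    also have "\<dots> = measure lborel (cbox l u)"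
      using \<rho> d by (intro content_cbox_cart[symmetric]) (auto simp: interval_ne_empty_cart l_def u_def)
    also have "\<dots> \<le> measure lborel (B \<inter> sgn -` ball e \<rho>)"
    proof (rule measure_mono_fmeasurable[OF sub])
      have "B \<in> fmeasurable lborel"
        using emeasure_lborel_ball_finite[of "0 :: real ^ 'n" 1]
        by (intro fmeasurableI) (simp_all add: B_def)
      then show "B \<inter> sgn -` ball e \<rho> \<in> fmeasurable lborel"
        using ms by (intro fmeasurable_Int_fmeasurable) auto
    qed simp
    finally have *: "1 / 4 * (\<rho> / (4 * d)) ^ (CARD('n) - 1) \<le> measure lborel (B \<inter> sgn -` ball e \<rho>)" .
    have "measure unif_sphere (ball e \<rho>) = measure (uniform_measure lborel B) (sgn -` ball e \<rho>)"
      by (simp add: unif_sphere_def measure_distr B_def)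
    also have "\<dots> = measure lborel (B \<inter> sgn -` ball e \<rho>) / measure lborel B"
    proof (rule measure_uniform_measure)
      show "emeasure lborel B \<noteq> 0" using Bpos by (auto simp: measure_def)
      show "emeasure lborel B \<noteq> \<infinity>"
        using emeasure_lborel_ball_finite[of "0 :: real ^ 'n" 1] by (simp add: B_def)
    qed (use ms in simp)
    finally have "measure unif_sphere (ball e \<rho>)
        = measure lborel (B \<inter> sgn -` ball e \<rho>) / measure lborel B" .
    moreover have "c * \<rho> ^ (CARD('n) - 1)
        = 1 / 4 * (\<rho> / (4 * d)) ^ (CARD('n) - 1) / measure lborel B"
      by (simp add: c_def power_divide)
    ultimately show ?thesis using * Bpos by (simp only: divide_right_mono less_imp_le)
  qed
  have "c * \<rho> ^ (CARD('n) - 1) \<le> measure unif_sphere (ball \<theta> \<rho>)"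
    if \<theta>: "norm \<theta> = 1" and \<rho>: "0 < \<rho>" "\<rho> \<le> 1" for \<theta> :: "real ^ 'n" and \<rho>
  proof -
    obtain f where f: "orthogonal_transformation f" "f e = \<theta>"
      using orthogonal_transformation_exists_1[OF ne \<theta>] .
    have lin: "linear f" using f by (simp add: orthogonal_transformation_linear)
    have [measurable]: "f \<in> borel_measurable borel"
      using lin by (intro borel_measurable_continuous_onI linear_continuous_on)
        (simp add: linear_conv_bounded_linear)
    have "dist \<theta> (f x) = dist e x" for x
      unfolding dist_norm f(2)[symmetric] linear_diff[OF lin, symmetric]
      by (rule orthogonal_transformation_norm[OF f(1)])
    then have "f -` ball \<theta> \<rho> = ball e \<rho>" by auto
    moreover have "measure unif_sphere (ball \<theta> \<rho>) = measure (distr unif_sphere borel f) (ball \<theta> \<rho>)"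
      using unif_sphere_orthogonal[OF f(1)] by simp
    moreover have "f \<in> measurable unif_sphere borel" by (simp add: unif_sphere_def)
    ultimately have "measure unif_sphere (ball \<theta> \<rho>) = measure unif_sphere (ball e \<rho>)"
      by (simp add: measure_distr unif_sphere_def)
    then show ?thesis using cap[OF \<rho>] by simp
  qed
  with c show ?thesis by blast
qed

lemma geometric_sum_le:
  fixes k N :: nat
  assumes "k \<ge> 1"
  shows "(\<Sum>j\<le>N. (2 ^ j) ^ k) \<le> (2 * (2 ^ N) ^ k :: real)"
proof (induction N)
  case (Suc N)
  have "(2::real) * (2 ^ N) ^ k \<le> 2 ^ k * (2 ^ N) ^ k"
    using power_increasing[OF assms, of "2::real"] by (intro mult_right_mono) auto
  also have "\<dots> = (2 ^ Suc N) ^ k" by (simp add: power_mult_distrib)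
  finally show ?case using Suc unfolding sum.atMost_Suc by linarith
qed simp

text \<open>The terms at least double, so the sum over the scales up to \<open>z\<close> is
  controlled by its largest term, whatever \<open>N\<close> is.\<close>

lemma truncated_geometric_sum_le:
  fixes z :: real
  assumes "k \<ge> 1" "z \<ge> 0"
  shows "(\<Sum>j\<le>N. if 2 ^ j \<le> z then (2 ^ j) ^ k else 0) \<le> 2 * z ^ k"
proof (induction N)
  case 0
  have z: "0 \<le> z ^ k" "1 \<le> z \<Longrightarrow> 1 \<le> z ^ k" using assms by simp_all
  show ?case
  proof (cases "1 \<le> z")
    case True
    then have "1 \<le> 2 * z ^ k" using z by linarith
    with True show ?thesis by simp
  next
    case False
    with z(1) show ?thesis by simp
  qed
next
  case (Suc N)
  show ?case
  proof (cases "2 ^ Suc N \<le> z")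
    case True
    have "(\<Sum>j\<le>Suc N. if 2 ^ j \<le> z then (2 ^ j) ^ k else 0) \<le> (\<Sum>j\<le>Suc N. (2 ^ j) ^ k :: real)"
      by (rule sum_mono) auto
    also have "\<dots> \<le> 2 * (2 ^ Suc N) ^ k" by (rule geometric_sum_le[OF assms(1)])
    also have "\<dots> \<le> 2 * z ^ k" using True by (intro mult_left_mono power_mono) auto
    finally show ?thesis .
  qed (use Suc in auto)
qed

text \<open>Dyadic counting. Each scale \<open>j \<le> N\<close> contributes at least
  \<open>c\<close> to the integral of the sum of \<open>(2 ^ j) ^ k * indicator (E j)\<close>, and a
  multiple of that sum lies pointwise below the integrand. So the integral grows at least linearly
  in \<open>N\<close>, that is logarithmically in \<open>1 / t\<close>, even in the borderline case
  \<open>real k = 2 * \<beta>\<close>.\<close>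

lemma (in finite_measure) unbounded_truncated_energy:
  fixes D :: "'a \<Rightarrow> real" and k :: nat
  assumes [measurable]: "D \<in> borel_measurable M" "A \<in> sets M"
    and D: "\<And>x. D x \<ge> 0"
    and c: "c > 0" "\<And>\<rho>. 0 < \<rho> \<Longrightarrow> \<rho> \<le> 1 \<Longrightarrow> c * \<rho> ^ k \<le> measure M {x \<in> A. D x < \<rho>}"
    and k: "k \<ge> 1" "real k \<le> 2 * \<beta>" and t0: "t0 > 0"
    and B: "\<And>t. 0 < t \<Longrightarrow> t \<le> t0 \<Longrightarrow> (\<integral>x. indicator A x * ((D x)\<^sup>2 + t\<^sup>2) powr (- \<beta>) \<partial>M) \<le> B"
  shows False
proof -
  \<comment> \<open>The factor 1/2 pays for the geometric sum, \<open>2 powr (- \<beta>)\<close> for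
    the step \<open>(D x)\<^sup>2 + t\<^sup>2 \<le> 2 * m\<^sup>2\<close> with
    \<open>m = max (D x) t\<close>.\<close>
  define K where "K = 2 powr (- \<beta>) / 2"
  have K: "K > 0" by (simp add: K_def)
  have \<beta>: "\<beta> > 0" using k by simp
  obtain N1 where N1: "(1/2) ^ N1 < min t0 (1::real)"
    using t0 real_arch_pow_inv[of "min t0 1" "1/2"] by auto
  obtain N2 where N2: "real N2 > B / (K * c)" using reals_Archimedean2 by blast
  define N where "N = max N1 N2"
  \<comment> \<open>The truncation sits at the finest scale counted, so \<open>x \<in> E j\<close>
    still gives \<open>max (D x) t \<le> (1/2) ^ j\<close> for \<open>j \<le> N\<close>.
    \<open>N1\<close> makes \<open>t\<close> admissible, and \<open>N2\<close> makes the counted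
    scales add up to more than \<open>B\<close>.\<close>
  define t where "t = (1/2 :: real) ^ N"
  have "0 < t" by (simp add: t_def)
  moreover have "t \<le> (1/2) ^ N1" unfolding t_def N_def by (rule power_decreasing) auto
  ultimately have t: "0 < t" "t \<le> t0" "t \<le> 1" using N1 by linarith+
  define E where "E = (\<lambda>j::nat. {x \<in> A. D x < (1/2) ^ j})"
  have AM: "A \<subseteq> space M" using assms(2) by (rule sets.sets_into_space)
  have [measurable]: "E j \<in> sets M" for j
  proof -
    have "E j = {x \<in> space M. x \<in> A \<and> D x < (1/2) ^ j}" using AM by (auto simp: E_def)
    then show ?thesis by simp
  qed
  have point: "K * (\<Sum>j\<le>N. (2 ^ j) ^ k * indicator (E j) x)
    \<le> indicator A x * ((D x)\<^sup>2 + t\<^sup>2) powr (- \<beta>)" for x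
  proof (cases "x \<in> A \<and> D x < 1")
    case False
    have "D x < 1" if "D x < (1/2) ^ j" for j
      using that power_le_one[of "1/2::real" j] by linarith
    with False have "x \<notin> E j" for j unfolding E_def by blast
    then show ?thesis by simp
  next
    case True
    define m where "m = max (D x) t"
    have m: "0 < m" "m \<le> 1" "D x \<le> m" "t \<le> m" using True t by (auto simp: m_def)
    have "(\<Sum>j\<le>N. (2 ^ j) ^ k * indicator (E j) x)
      \<le> (\<Sum>j\<le>N. if 2 ^ j \<le> 1 / m then (2 ^ j) ^ k else 0 :: real)"
    proof (rule sum_mono)
      fix j assume j: "j \<in> {..N}"
      have "2 ^ j \<le> 1 / m" if "x \<in> E j"
      proof -
        have "t \<le> (1/2) ^ j" unfolding t_def using j by (intro power_decreasing) auto
        then have "m \<le> (1/2) ^ j" using that by (auto simp: m_def E_def)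
        then show ?thesis using m by (simp add: field_simps power_divide)
      qed
      then show "(2 ^ j) ^ k * indicator (E j) x \<le> (if 2 ^ j \<le> 1 / m then (2 ^ j) ^ k else 0 :: real)"
        by (auto simp: indicator_def)
    qed
    also have "\<dots> \<le> 2 * (1 / m) ^ k" using m by (intro truncated_geometric_sum_le k) auto
    finally have "K * (\<Sum>j\<le>N. (2 ^ j) ^ k * indicator (E j) x) \<le> K * (2 * (1 / m) ^ k)"
      using K by (intro mult_left_mono) auto
    also have "\<dots> = 2 powr (- \<beta>) * m powr (- real k)"
    proof -
      have "m powr (- real k) = (1 / m) ^ k"
        using m by (simp add: powr_minus powr_realpow power_one_over inverse_eq_divide)
      then show ?thesis by (simp add: K_def)
    qed
    also have "\<dots> \<le> 2 powr (- \<beta>) * m powr (- (2 * \<beta>))"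
      using m k by (intro mult_left_mono powr_mono') auto
    also have "\<dots> = (2 * m\<^sup>2) powr (- \<beta>)"
    proof -
      have "(m\<^sup>2) powr (- \<beta>) = m powr (- (2 * \<beta>))"
        using m by (simp add: powr_powr flip: powr_numeral)
      moreover have "(2 * m\<^sup>2) powr (- \<beta>) = 2 powr (- \<beta>) * (m\<^sup>2) powr (- \<beta>)"
        by (rule powr_mult)
      ultimately show ?thesis by simp
    qed
    also have "\<dots> \<le> ((D x)\<^sup>2 + t\<^sup>2) powr (- \<beta>)"
    proof (rule powr_mono2')
      have "(D x)\<^sup>2 \<le> m\<^sup>2" "t\<^sup>2 \<le> m\<^sup>2" using m D t by (auto intro: power_mono)
      then show "(D x)\<^sup>2 + t\<^sup>2 \<le> 2 * m\<^sup>2" by simp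
      show "0 < (D x)\<^sup>2 + t\<^sup>2" using t by (simp add: add_nonneg_pos)
    qed (use \<beta> in auto)
    finally show ?thesis using True by simp
  qed
  have "B < K * (c * real (Suc N))"
  proof -
    have "B / (K * c) < real (Suc N)" using N2 by (simp add: N_def)
    then show ?thesis using K c by (simp add: field_simps)
  qed
  also have "\<dots> = K * (\<Sum>j\<le>N. c)" by simp
  also have "\<dots> \<le> K * (\<Sum>j\<le>N. (2 ^ j) ^ k * measure M (E j))"
  proof (intro mult_left_mono sum_mono)
    fix j
    have "c * ((1/2) ^ j) ^ k \<le> measure M (E j)"
      unfolding E_def by (rule c(2)) (auto intro: power_le_one)
    then have "(2 ^ j) ^ k * (c * ((1/2) ^ j) ^ k) \<le> (2 ^ j) ^ k * measure M (E j)"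
      by (intro mult_left_mono) auto
    moreover have "(2 ^ j) ^ k * (c * ((1/2) ^ j) ^ k) = c"
      by (simp add: power_divide)
    ultimately show "c \<le> (2 ^ j) ^ k * measure M (E j)" by simp
  qed (use K in auto)
  also have "\<dots> = (\<integral>x. K * (\<Sum>j\<le>N. (2 ^ j) ^ k * indicator (E j) x) \<partial>M)"
  proof -
    have "(\<integral>x. (\<Sum>j\<le>N. (2 ^ j) ^ k * indicat_real (E j) x) \<partial>M)
      = (\<Sum>j\<le>N. \<integral>x. (2 ^ j) ^ k * indicator (E j) x \<partial>M)"
      by (rule Bochner_Integration.integral_sum) (simp add: emeasure_finite less_top[symmetric])
    then show ?thesis by simp
  qed
  also have "\<dots> \<le> (\<integral>x. indicator A x * ((D x)\<^sup>2 + t\<^sup>2) powr (- \<beta>) \<partial>M)"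
  proof (rule integral_mono[OF _ _ point])
    show "integrable M (\<lambda>x. K * (\<Sum>j\<le>N. (2 ^ j) ^ k * indicat_real (E j) x))"
      by (intro integrable_mult_right Bochner_Integration.integrable_sum)
        (simp add: emeasure_finite less_top[symmetric])
    show "integrable M (\<lambda>x. indicator A x * ((D x)\<^sup>2 + t\<^sup>2) powr (- \<beta>))"
    proof (rule integrable_const_bound[where B = "(t\<^sup>2) powr (- \<beta>)"])
      have "norm (indicator A x * ((D x)\<^sup>2 + t\<^sup>2) powr (- \<beta>)) \<le> (t\<^sup>2) powr (- \<beta>)" for x
        using t \<beta> by (auto simp: indicator_def intro!: powr_mono2')
      then show "AE x in M. norm (indicator A x * ((D x)\<^sup>2 + t\<^sup>2) powr (- \<beta>)) \<le> (t\<^sup>2) powr (- \<beta>)" by simp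
    qed simp
  qed
  also have "\<dots> \<le> B" by (rule B) (use t in auto)
  finally show False by simp
qed

section \<open>Variations of a minimizer\<close>

lemma borel_measurable_riesz_kernel [measurable]:
  "riesz_kernel s \<in> borel_measurable (borel :: 'a::euclidean_space measure)"
  unfolding riesz_kernel_def[abs_def] by measurable

lemma borel_probs_UNIV: "M \<in> borel_probs UNIV \<longleftrightarrow> prob_space M \<and> sets M = sets borel"
  by (simp add: borel_probs_def)

text \<open>The convex combination of \<open>M\<close> and \<open>N\<close> is realised by tossing
  an \<epsilon>-coin and sampling from one of them; later only its integrals matter.\<close>

lemma exists_mixture:
  fixes M N :: "'a::topological_space measure"
  assumes "M \<in> borel_probs UNIV" "N \<in> borel_probs UNIV" "0 \<le> \<epsilon>" "\<epsilon> \<le> 1"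
  shows "\<exists>Q \<in> borel_probs UNIV. \<forall>g \<in> borel_measurable borel.
    (\<integral>\<^sup>+ x. g x \<partial>Q) = ennreal (1 - \<epsilon>) * (\<integral>\<^sup>+ x. g x \<partial>M) + ennreal \<epsilon> * (\<integral>\<^sup>+ x. g x \<partial>N)"
proof -
  define p where "p = bernoulli_pmf \<epsilon>"
  define K where "K = (\<lambda>b. if b then N else M)"
  have K: "K \<in> measurable (measure_pmf p) (subprob_algebra borel)"
    using assms by (auto simp: K_def borel_probs_UNIV space_subprob_algebra prob_space_imp_subprob_space)
  have "prob_space (measure_pmf p \<bind> K)"
    using assms by (intro measure_pmf.prob_space_bind[OF _ K]) (auto simp: K_def borel_probs_UNIV)
  moreover have "sets (measure_pmf p \<bind> K) = sets borel"
    using assms by (intro sets_bind) (auto simp: K_def borel_probs_UNIV)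
  moreover have "(\<integral>\<^sup>+ x. g x \<partial>(measure_pmf p \<bind> K)) =
      ennreal (1 - \<epsilon>) * (\<integral>\<^sup>+ x. g x \<partial>M) + ennreal \<epsilon> * (\<integral>\<^sup>+ x. g x \<partial>N)"
    if "g \<in> borel_measurable borel" for g
  proof -
    have "(\<integral>\<^sup>+ x. g x \<partial>(measure_pmf p \<bind> K)) = (\<integral>\<^sup>+ b. \<integral>\<^sup>+ x. g x \<partial>K b \<partial>measure_pmf p)"
      by (rule nn_integral_bind[OF that K])
    also have "\<dots> = (\<integral>\<^sup>+ x. g x \<partial>K True) * ennreal \<epsilon> + (\<integral>\<^sup>+ x. g x \<partial>K False) * ennreal (1 - \<epsilon>)"
      unfolding p_def by (rule nn_integral_bernoulli_pmf) (use assms in auto)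
    finally show ?thesis by (simp only: K_def if_True if_False ac_simps)
  qed
  ultimately show ?thesis
    by (intro bexI[of _ "measure_pmf p \<bind> K"]) (auto simp: borel_probs_UNIV)
qed

text \<open>Mutual energy as a bilinear form. With the positive or the negative part of the pair
  energy for \<open>F\<close>, all expansions take place in \<open>ennreal\<close>, where
  \<infinity> - \<infinity> cannot occur; differences are formed only once both parts are
  finite.\<close>

abbreviation mutual :: "('a \<times> 'a \<Rightarrow> ennreal) \<Rightarrow> 'a measure \<Rightarrow> 'a measure \<Rightarrow> ennreal" where
  "mutual F A B \<equiv> \<integral>\<^sup>+ x. \<integral>\<^sup>+ y. F (x, y) \<partial>B \<partial>A"

lemma mutual_pair:
  fixes F :: "'a::euclidean_space \<times> 'a \<Rightarrow> ennreal"
  assumes "A \<in> borel_probs UNIV" "B \<in> borel_probs UNIV" "F \<in> borel_measurable (borel \<Otimes>\<^sub>M borel)"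
  shows "mutual F A B = (\<integral>\<^sup>+ z. F z \<partial>(A \<Otimes>\<^sub>M B))"
proof -
  interpret B: prob_space B using assms by (simp add: borel_probs_UNIV)
  have "sets (A \<Otimes>\<^sub>M B) = sets (borel \<Otimes>\<^sub>M borel)"
    using assms by (intro sets_pair_measure_cong) (auto simp: borel_probs_UNIV)
  then have "F \<in> borel_measurable (A \<Otimes>\<^sub>M B)"
    using assms(3) by (simp cong: measurable_cong_sets)
  then show ?thesis by (rule B.nn_integral_fst)
qed

lemma mutual_commute:
  fixes F :: "'a::euclidean_space \<times> 'a \<Rightarrow> ennreal"
  assumes "A \<in> borel_probs UNIV" "B \<in> borel_probs UNIV" "F \<in> borel_measurable (borel \<Otimes>\<^sub>M borel)"
    and sym: "\<And>x y. F (x, y) = F (y, x)"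
  shows "mutual F A B = mutual F B A"
proof -
  interpret A: prob_space A using assms by (simp add: borel_probs_UNIV)
  interpret B: prob_space B using assms by (simp add: borel_probs_UNIV)
  interpret pair_sigma_finite A B ..
  have "sets (A \<Otimes>\<^sub>M B) = sets (borel \<Otimes>\<^sub>M borel)"
    using assms by (intro sets_pair_measure_cong) (auto simp: borel_probs_UNIV)
  then have "F \<in> borel_measurable (A \<Otimes>\<^sub>M B)"
    using assms(3) by (simp cong: measurable_cong_sets)
  then have "mutual F A B = (\<integral>\<^sup>+ y. \<integral>\<^sup>+ x. F (x, y) \<partial>A \<partial>B)"
    using Fubini'[of "\<lambda>x y. F (x, y)"] by simp
  also have "\<dots> = mutual F B A" by (intro nn_integral_cong) (rule sym)
  finally show ?thesis .
qed

text \<open>Along the segment from \<open>M\<close> to \<open>L\<close> the energy is a quadratic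
  polynomial in \<epsilon> whose slope at 0 is twice the difference of cross energy and self-energy
  of \<open>M\<close>. Its minimum is at 0, so the slope is nonnegative; the finite energy of
  \<open>L\<close> makes the quadratic term negligible for small \<epsilon>.\<close>

lemma energy_convexity:
  fixes E :: "'a::euclidean_space \<times> 'a \<Rightarrow> ereal"
  assumes M: "M \<in> borel_probs UNIV" and L: "L \<in> borel_probs UNIV"
    and E [measurable]: "E \<in> borel_measurable (borel \<Otimes>\<^sub>M borel)"
    and sym: "\<And>x y. E (x, y) = E (y, x)"
    and minimal: "\<And>Q. Q \<in> borel_probs UNIV \<Longrightarrow> ereal_integral (M \<Otimes>\<^sub>M M) E \<le> ereal_integral (Q \<Otimes>\<^sub>M Q) E"
    and self: "mutual (\<lambda>z. e2ennreal (E z)) M M = ennreal a1" "mutual (\<lambda>z. e2ennreal (- E z)) M M = ennreal a2"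
    and cross: "mutual (\<lambda>z. e2ennreal (E z)) M L = ennreal b1" "mutual (\<lambda>z. e2ennreal (- E z)) M L = ennreal b2"
    and self_L: "mutual (\<lambda>z. e2ennreal (E z)) L L = ennreal c1" "mutual (\<lambda>z. e2ennreal (- E z)) L L = ennreal c2"
    and nn0: "a1 \<ge> 0" "a2 \<ge> 0" "b1 \<ge> 0" "b2 \<ge> 0" "c1 \<ge> 0" "c2 \<ge> 0"
  shows "a1 - a2 \<le> b1 - b2"
proof -
  have setsM: "sets M = sets borel" and setsL: "sets L = sets borel"
    using M L by (auto simp: borel_probs_UNIV)
  have main: "a1 - a2 \<le> (1 - \<epsilon>)\<^sup>2 * (a1 - a2) + 2 * \<epsilon> * (1 - \<epsilon>) * (b1 - b2) + \<epsilon>\<^sup>2 * (c1 - c2)"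
    if \<epsilon>: "0 \<le> \<epsilon>" "\<epsilon> \<le> 1" for \<epsilon>
  proof -
    obtain Q where Q: "Q \<in> borel_probs UNIV"
      and mix: "\<And>g. g \<in> borel_measurable borel \<Longrightarrow> (\<integral>\<^sup>+ x. g x \<partial>Q)
        = ennreal (1 - \<epsilon>) * (\<integral>\<^sup>+ x. g x \<partial>M) + ennreal \<epsilon> * (\<integral>\<^sup>+ x. g x \<partial>L)"
      using exists_mixture[OF M L \<epsilon>] by blast
    interpret M: prob_space M using M by (simp add: borel_probs_UNIV)
    interpret L: prob_space L using L by (simp add: borel_probs_UNIV)
    have expand: "mutual F Q Q = ennreal ((1 - \<epsilon>)\<^sup>2 * a + 2 * \<epsilon> * (1 - \<epsilon>) * b + \<epsilon>\<^sup>2 * c)"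
      if F [measurable]: "F \<in> borel_measurable (borel \<Otimes>\<^sub>M borel)" and symF: "\<And>x y. F (x, y) = F (y, x)"
        and abc: "mutual F M M = ennreal a" "mutual F M L = ennreal b" "mutual F L L = ennreal c"
          "a \<ge> 0" "b \<ge> 0" "c \<ge> 0" for F a b c
    proof -
      have [measurable]: "(\<lambda>x. \<integral>\<^sup>+ y. F (x, y) \<partial>M) \<in> borel_measurable borel"
        "(\<lambda>x. \<integral>\<^sup>+ y. F (x, y) \<partial>L) \<in> borel_measurable borel"
        using setsM setsL by (auto intro!: M.borel_measurable_nn_integral L.borel_measurable_nn_integral
            simp: measurable_cong_sets[OF sets_pair_measure_cong[OF refl setsM] refl]
              measurable_cong_sets[OF sets_pair_measure_cong[OF refl setsL] refl])
      have LM: "mutual F L M = ennreal b"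
        using mutual_commute[OF L M F symF] abc by simp
      have inner: "(\<integral>\<^sup>+ y. F (x, y) \<partial>Q) =
          ennreal (1 - \<epsilon>) * (\<integral>\<^sup>+ y. F (x, y) \<partial>M) + ennreal \<epsilon> * (\<integral>\<^sup>+ y. F (x, y) \<partial>L)" for x
        by (rule mix) simp
      have int: "(\<integral>\<^sup>+ x. ennreal (1 - \<epsilon>) * (\<integral>\<^sup>+ y. F (x, y) \<partial>M) + ennreal \<epsilon> * (\<integral>\<^sup>+ y. F (x, y) \<partial>L) \<partial>R)
        = ennreal (1 - \<epsilon>) * mutual F R M + ennreal \<epsilon> * mutual F R L"
        if "sets R = sets borel" for R
      proof -
        have [measurable]: "(\<lambda>x. \<integral>\<^sup>+ y. F (x, y) \<partial>M) \<in> borel_measurable R"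
          "(\<lambda>x. \<integral>\<^sup>+ y. F (x, y) \<partial>L) \<in> borel_measurable R"
          by (simp_all add: measurable_cong_sets[OF that refl])
        show ?thesis by (simp add: nn_integral_add nn_integral_cmult)
      qed
      have "mutual F Q Q = ennreal (1 - \<epsilon>) * (ennreal (1 - \<epsilon>) * mutual F M M + ennreal \<epsilon> * mutual F M L)
          + ennreal \<epsilon> * (ennreal (1 - \<epsilon>) * mutual F L M + ennreal \<epsilon> * mutual F L L)"
        unfolding inner by (subst mix) (simp_all add: int setsM setsL)
      also have "\<dots> = ennreal ((1 - \<epsilon>) * ((1 - \<epsilon>) * a + \<epsilon> * b) + \<epsilon> * ((1 - \<epsilon>) * b + \<epsilon> * c))"
        unfolding abc LM using \<epsilon> abc(4-6) by (simp flip: ennreal_mult ennreal_plus)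
      also have "(1 - \<epsilon>) * ((1 - \<epsilon>) * a + \<epsilon> * b) + \<epsilon> * ((1 - \<epsilon>) * b + \<epsilon> * c)
        = (1 - \<epsilon>)\<^sup>2 * a + 2 * \<epsilon> * (1 - \<epsilon>) * b + \<epsilon>\<^sup>2 * c"
        by (simp add: power2_eq_square algebra_simps)
      finally show ?thesis .
    qed
    have m1: "(\<lambda>z. e2ennreal (E z)) \<in> borel_measurable (borel \<Otimes>\<^sub>M borel)"
      and m2: "(\<lambda>z. e2ennreal (- E z)) \<in> borel_measurable (borel \<Otimes>\<^sub>M borel)" by simp_all
    have nn: "0 \<le> (1 - \<epsilon>)\<^sup>2 * a + 2 * \<epsilon> * (1 - \<epsilon>) * b + \<epsilon>\<^sup>2 * c" if "a \<ge> 0" "b \<ge> 0" "c \<ge> 0" for a b c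
      using that \<epsilon> by (intro add_nonneg_nonneg mult_nonneg_nonneg) auto
    have "ereal (a1 - a2) = ereal_integral (M \<Otimes>\<^sub>M M) E"
      unfolding ereal_integral_def using self nn0
      by (simp add: mutual_pair[OF M M m1, symmetric] mutual_pair[OF M M m2, symmetric] enn2ereal_ennreal)
    also have "\<dots> \<le> ereal_integral (Q \<Otimes>\<^sub>M Q) E" by (rule minimal[OF Q])
    also have "\<dots> = ereal (((1 - \<epsilon>)\<^sup>2 * a1 + 2 * \<epsilon> * (1 - \<epsilon>) * b1 + \<epsilon>\<^sup>2 * c1) -
        ((1 - \<epsilon>)\<^sup>2 * a2 + 2 * \<epsilon> * (1 - \<epsilon>) * b2 + \<epsilon>\<^sup>2 * c2))"
      unfolding ereal_integral_def mutual_pair[OF Q Q m1, symmetric] mutual_pair[OF Q Q m2, symmetric]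
        expand[OF m1 arg_cong[where f = e2ennreal, OF sym] self(1) cross(1) self_L(1) nn0(1,3,5)]
        expand[OF m2 arg_cong[where f = "\<lambda>r. e2ennreal (- r)", OF sym] self(2) cross(2) self_L(2) nn0(2,4,6)]
      using nn[OF nn0(1,3,5)] nn[OF nn0(2,4,6)] by (simp add: enn2ereal_ennreal)
    finally show ?thesis by (simp add: algebra_simps)
  qed
  show ?thesis
  proof (rule ccontr)
    define a b c where "a = a1 - a2" and "b = b1 - b2" and "c = c1 - c2"
    assume "\<not> ?thesis"
    then have ab: "b < a" by (simp add: a_def b_def)
    \<comment> \<open>With \<open>\<epsilon> = (a - b) / q\<close> the second-order term is at most
      \<open>\<epsilon> * (a - b)\<close>, half of the first-order decrease
      \<open>2 * \<epsilon> * (a - b)\<close>. The summand \<open>a - b\<close> in \<open>q\<close>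
      ensures \<open>\<epsilon> \<le> 1\<close>.\<close>
    define q where "q = \<bar>a - 2 * b + c\<bar> + (a - b)"
    have q: "q > 0" "a - b \<le> q" "a - 2 * b + c \<le> q" using ab by (auto simp: q_def)
    define \<epsilon> where "\<epsilon> = (a - b) / q"
    have \<epsilon>: "0 < \<epsilon>" "\<epsilon> \<le> 1" using ab q by (auto simp: \<epsilon>_def field_simps)
    have "0 \<le> \<epsilon> * (2 * (b - a) + \<epsilon> * (a - 2 * b + c))"
      using main[of \<epsilon>] \<epsilon> unfolding a_def[symmetric] b_def[symmetric] c_def[symmetric]
      by (simp add: power2_eq_square algebra_simps)
    then have "0 \<le> 2 * (b - a) + \<epsilon> * (a - 2 * b + c)" using \<epsilon> by (simp add: zero_le_mult_iff)
    also have "\<dots> \<le> 2 * (b - a) + \<epsilon> * q" using q \<epsilon> by (intro add_left_mono mult_left_mono) auto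
    also have "\<dots> = b - a" using q by (simp add: \<epsilon>_def)
    finally show False using ab by simp
  qed
qed

section \<open>Passage to real integrals, the first variation, and finiteness of the minimal
  energy\<close>

lemma e2ennreal_eq_ennreal: "\<bar>r\<bar> \<noteq> \<infinity> \<Longrightarrow> e2ennreal r = ennreal (real_of_ereal r)"
  by (cases r) (auto simp: ennreal.rep_eq e2ennreal_ereal)

lemma e2ennreal_infinity: "e2ennreal \<infinity> = \<infinity>"
  using e2ennreal_enn2ereal[of \<infinity>] by simp

lemma integrable_real_of_ereal:
  fixes f :: "'a \<Rightarrow> ereal"
  assumes [measurable]: "f \<in> borel_measurable M"
    and pos: "(\<integral>\<^sup>+ x. e2ennreal (f x) \<partial>M) \<noteq> \<infinity>" and neg: "(\<integral>\<^sup>+ x. e2ennreal (- f x) \<partial>M) \<noteq> \<infinity>"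
  shows "AE x in M. \<bar>f x\<bar> \<noteq> \<infinity>" "integrable M (\<lambda>x. real_of_ereal (f x))"
proof -
  have "AE x in M. e2ennreal (f x) \<noteq> \<infinity>" by (rule nn_integral_PInf_AE[OF _ pos]) simp
  moreover have "AE x in M. e2ennreal (- f x) \<noteq> \<infinity>" by (rule nn_integral_PInf_AE[OF _ neg]) simp
  ultimately show fin: "AE x in M. \<bar>f x\<bar> \<noteq> \<infinity>"
  proof eventually_elim
    case (elim x)
    then show ?case by (cases "f x") (simp_all add: e2ennreal_infinity)
  qed
  have "(\<integral>\<^sup>+ x. ennreal (real_of_ereal (f x)) \<partial>M) = (\<integral>\<^sup>+ x. e2ennreal (f x) \<partial>M)"
    by (intro nn_integral_cong_AE) (use fin in \<open>eventually_elim, simp add: e2ennreal_eq_ennreal\<close>)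
  moreover have "(\<integral>\<^sup>+ x. ennreal (- real_of_ereal (f x)) \<partial>M) = (\<integral>\<^sup>+ x. e2ennreal (- f x) \<partial>M)"
    by (intro nn_integral_cong_AE) (use fin in \<open>eventually_elim, simp add: e2ennreal_eq_ennreal\<close>)
  ultimately show "integrable M (\<lambda>x. real_of_ereal (f x))"
    using pos neg unfolding real_integrable_def by simp
qed

lemma nn_integral_e2ennreal_eq:
  fixes f :: "'a \<Rightarrow> ereal"
  assumes fin: "AE x in M. \<bar>f x\<bar> \<noteq> \<infinity>" and int: "integrable M (\<lambda>x. real_of_ereal (f x))"
  shows "(\<integral>\<^sup>+ x. e2ennreal (f x) \<partial>M) = ennreal (enn2real (\<integral>\<^sup>+ x. e2ennreal (f x) \<partial>M))"
    and "(\<integral>\<^sup>+ x. e2ennreal (- f x) \<partial>M) = ennreal (enn2real (\<integral>\<^sup>+ x. e2ennreal (- f x) \<partial>M))"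
    and "(\<integral>x. real_of_ereal (f x) \<partial>M) =
      enn2real (\<integral>\<^sup>+ x. e2ennreal (f x) \<partial>M) - enn2real (\<integral>\<^sup>+ x. e2ennreal (- f x) \<partial>M)"
proof -
  have "(\<integral>\<^sup>+ x. e2ennreal (f x) \<partial>M) = (\<integral>\<^sup>+ x. ennreal (real_of_ereal (f x)) \<partial>M)"
    by (intro nn_integral_cong_AE) (use fin in \<open>eventually_elim, simp add: e2ennreal_eq_ennreal\<close>)
  moreover have "(\<integral>\<^sup>+ x. e2ennreal (- f x) \<partial>M) = (\<integral>\<^sup>+ x. ennreal (- real_of_ereal (f x)) \<partial>M)"
    by (intro nn_integral_cong_AE) (use fin in \<open>eventually_elim, simp add: e2ennreal_eq_ennreal\<close>)
  ultimately show "(\<integral>\<^sup>+ x. e2ennreal (f x) \<partial>M) = ennreal (enn2real (\<integral>\<^sup>+ x. e2ennreal (f x) \<partial>M))"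
    "(\<integral>\<^sup>+ x. e2ennreal (- f x) \<partial>M) = ennreal (enn2real (\<integral>\<^sup>+ x. e2ennreal (- f x) \<partial>M))"
    "(\<integral>x. real_of_ereal (f x) \<partial>M) =
      enn2real (\<integral>\<^sup>+ x. e2ennreal (f x) \<partial>M) - enn2real (\<integral>\<^sup>+ x. e2ennreal (- f x) \<partial>M)"
    using int real_lebesgue_integral_def[OF int] unfolding real_integrable_def
    by (simp_all add: less_top)
qed

text \<open>The measure \<mu> is mixed with the average \<open>L\<close> of its images under
  \<open>T1\<close> and \<open>T2\<close>. Only cross terms survive at first order, so one argument
  of \<open>E\<close> stays unmoved in the conclusion. The hypotheses on pairs of displaced points
  serve to make the energy of \<open>L\<close> finite.\<close>

lemma first_variation:
  fixes E :: "'a::euclidean_space \<times> 'a \<Rightarrow> ereal"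
  assumes \<mu>: "\<mu> \<in> borel_probs UNIV"
    and E [measurable]: "E \<in> borel_measurable (borel \<Otimes>\<^sub>M borel)"
    and sym: "\<And>x y. E (x, y) = E (y, x)"
    and minimal: "\<And>Q. Q \<in> borel_probs UNIV \<Longrightarrow> ereal_integral (\<mu> \<Otimes>\<^sub>M \<mu>) E \<le> ereal_integral (Q \<Otimes>\<^sub>M Q) E"
    and T [measurable]: "T1 \<in> borel_measurable borel" "T2 \<in> borel_measurable borel"
    and fin: "\<And>f g. f \<in> {id, T1, T2} \<Longrightarrow> g \<in> {id, T1, T2} \<Longrightarrow>
      AE z in \<mu> \<Otimes>\<^sub>M \<mu>. \<bar>E (f (fst z), g (snd z))\<bar> \<noteq> \<infinity>"
    and int: "\<And>f g. f \<in> {id, T1, T2} \<Longrightarrow> g \<in> {id, T1, T2} \<Longrightarrow>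
      integrable (\<mu> \<Otimes>\<^sub>M \<mu>) (\<lambda>z. real_of_ereal (E (f (fst z), g (snd z))))"
  shows "2 * (\<integral>z. real_of_ereal (E z) \<partial>(\<mu> \<Otimes>\<^sub>M \<mu>)) \<le>
    (\<integral>z. real_of_ereal (E (fst z, T1 (snd z))) \<partial>(\<mu> \<Otimes>\<^sub>M \<mu>)) +
    (\<integral>z. real_of_ereal (E (fst z, T2 (snd z))) \<partial>(\<mu> \<Otimes>\<^sub>M \<mu>))"
proof -
  interpret \<mu>: prob_space \<mu> using \<mu> by (simp add: borel_probs_UNIV)
  have sets\<mu> [measurable_cong]: "sets \<mu> = sets borel" using \<mu> by (simp add: borel_probs_UNIV)
  define I where "I = (\<lambda>(F :: 'a \<times> 'a \<Rightarrow> ennreal) f g. \<integral>\<^sup>+ z. F (f (fst z), g (snd z)) \<partial>(\<mu> \<Otimes>\<^sub>M \<mu>))"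
  have maps: "f \<in> borel_measurable borel" if "f \<in> {id, T1, T2}" for f :: "'a \<Rightarrow> 'a"
    using that by auto
  have push: "distr \<mu> borel f \<in> borel_probs UNIV" if "f \<in> {id, T1, T2}" for f
    using maps[OF that]
    by (auto simp: borel_probs_UNIV measurable_cong_sets[OF sets\<mu> refl] intro!: \<mu>.prob_space_distr)
  have push_id: "distr \<mu> borel id = \<mu>"
    using distr_id2[OF sets\<mu>[symmetric]] by (simp add: id_def)
  have mutual_push: "mutual F (distr \<mu> borel f) (distr \<mu> borel g) = I F f g"
    if [measurable]: "F \<in> borel_measurable (borel \<Otimes>\<^sub>M borel)"
      and fg: "f \<in> {id, T1, T2}" "g \<in> {id, T1, T2}" for F f g
  proof -
    note [measurable] = maps[OF fg(1)] maps[OF fg(2)]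
    have m: "(\<lambda>x. \<integral>\<^sup>+ y. F (x, y) \<partial>distr \<mu> borel g) \<in> borel_measurable borel"
    proof -
      interpret D: prob_space "distr \<mu> borel g" using push[OF fg(2)] by (simp add: borel_probs_UNIV)
      show ?thesis by measurable
    qed
    have "mutual F (distr \<mu> borel f) (distr \<mu> borel g)
        = (\<integral>\<^sup>+ x. \<integral>\<^sup>+ y. F (f x, y) \<partial>distr \<mu> borel g \<partial>\<mu>)"
    proof (rule nn_integral_distr)
      show "f \<in> measurable \<mu> borel" by measurable
    qed (use m in simp)
    also have "\<dots> = (\<integral>\<^sup>+ x. \<integral>\<^sup>+ y. F (f x, g y) \<partial>\<mu> \<partial>\<mu>)"
      by (intro nn_integral_cong nn_integral_distr) measurable
    also have "\<dots> = I F f g"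
      unfolding I_def by (subst \<mu>.nn_integral_fst[symmetric]) auto
    finally show ?thesis .
  qed
  obtain L where L: "L \<in> borel_probs UNIV"
    and mix: "\<And>g. g \<in> borel_measurable borel \<Longrightarrow> (\<integral>\<^sup>+ x. g x \<partial>L)
      = ennreal (1 - 1 / 2) * (\<integral>\<^sup>+ x. g x \<partial>distr \<mu> borel T1) + ennreal (1 / 2) * (\<integral>\<^sup>+ x. g x \<partial>distr \<mu> borel T2)"
    using exists_mixture[OF push push, of T1 T2 "1 / 2"] by auto
  have setsL [measurable_cong]: "sets L = sets borel" using L by (simp add: borel_probs_UNIV)
  have half: "ennreal (1 - 1 / 2) = ennreal (1 / 2)" by simp
  have cross: "mutual F A L = ennreal (1 / 2) * (mutual F A (distr \<mu> borel T1) + mutual F A (distr \<mu> borel T2))"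
    if [measurable]: "F \<in> borel_measurable (borel \<Otimes>\<^sub>M borel)" and A [measurable_cong]: "sets A = sets borel" for F A
  proof -
    interpret D1: prob_space "distr \<mu> borel T1" by (rule \<mu>.prob_space_distr) simp
    interpret D2: prob_space "distr \<mu> borel T2" by (rule \<mu>.prob_space_distr) simp
    have "mutual F A L = (\<integral>\<^sup>+ x. ennreal (1 / 2) *
        ((\<integral>\<^sup>+ y. F (x, y) \<partial>distr \<mu> borel T1) + (\<integral>\<^sup>+ y. F (x, y) \<partial>distr \<mu> borel T2)) \<partial>A)"
      by (subst mix) (simp_all only: half distrib_left, measurable)
    also have "\<dots> = ennreal (1 / 2) * (mutual F A (distr \<mu> borel T1) + mutual F A (distr \<mu> borel T2))"
      by (subst nn_integral_cmult, measurable) (subst nn_integral_add, measurable)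
    finally show ?thesis .
  qed
  have cross_\<mu>: "mutual F \<mu> L = ennreal (1 / 2) * (I F id T1 + I F id T2)"
    if F: "F \<in> borel_measurable (borel \<Otimes>\<^sub>M borel)" for F
    using cross[OF F sets\<mu>] mutual_push[OF F, of id T1] mutual_push[OF F, of id T2] push_id by simp
  have self_\<mu>: "mutual F \<mu> \<mu> = I F id id"
    if F: "F \<in> borel_measurable (borel \<Otimes>\<^sub>M borel)" for F
    using mutual_push[OF F, of id id] push_id by simp
  have self_L: "mutual F L L =
      ennreal (1 / 2) * (ennreal (1 / 2) * (I F T1 T1 + I F T1 T2) + ennreal (1 / 2) * (I F T2 T1 + I F T2 T2))"
    if F [measurable]: "F \<in> borel_measurable (borel \<Otimes>\<^sub>M borel)" for F
  proof -
    interpret L: prob_space L using L by (simp add: borel_probs_UNIV)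
    have "mutual F L L = ennreal (1 / 2) * (mutual F (distr \<mu> borel T1) L + mutual F (distr \<mu> borel T2) L)"
      by (subst mix) (simp_all only: half distrib_left, measurable)
    then show ?thesis
      by (simp only: cross[OF F sets_distr] mutual_push[OF F] insert_iff simp_thms)
  qed
  define p n where "p = (\<lambda>f g. enn2real (I (\<lambda>z. e2ennreal (E z)) f g))"
    and "n = (\<lambda>f g. enn2real (I (\<lambda>z. e2ennreal (- E z)) f g))"
  have pn: "
      p f g \<ge> 0 \<and> n f g \<ge> 0 \<and> I (\<lambda>z. e2ennreal (E z)) f g = ennreal (p f g) \<and>
      I (\<lambda>z. e2ennreal (- E z)) f g = ennreal (n f g) \<and>
      (\<integral>z. real_of_ereal (E (f (fst z), g (snd z))) \<partial>(\<mu> \<Otimes>\<^sub>M \<mu>)) = p f g - n f g"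
    if "f \<in> {id, T1, T2}" "g \<in> {id, T1, T2}" for f g
    unfolding p_def n_def I_def using nn_integral_e2ennreal_eq[OF fin[OF that] int[OF that]] by simp
  note pn' = pn[of id id] pn[of id T1] pn[of id T2] pn[of T1 T1] pn[of T1 T2] pn[of T2 T1] pn[of T2 T2]
  have average: "ennreal (1 / 2) * (ennreal a + ennreal b) = ennreal (1 / 2 * (a + b))"
    if "a \<ge> 0" "b \<ge> 0" for a b :: real
    using that by (subst ennreal_plus[symmetric], simp, simp, subst ennreal_mult[symmetric]) simp_all
  have m1: "(\<lambda>z. e2ennreal (E z)) \<in> borel_measurable (borel \<Otimes>\<^sub>M borel)"
    and m2: "(\<lambda>z. e2ennreal (- E z)) \<in> borel_measurable (borel \<Otimes>\<^sub>M borel)" by simp_all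
  have "p id id - n id id \<le> 1 / 2 * (p id T1 + p id T2) - 1 / 2 * (n id T1 + n id T2)"
  proof (rule energy_convexity[OF \<mu> L E sym minimal])
    show "mutual (\<lambda>z. e2ennreal (E z)) \<mu> \<mu> = ennreal (p id id)"
      "mutual (\<lambda>z. e2ennreal (- E z)) \<mu> \<mu> = ennreal (n id id)"
      using pn' by (simp_all add: self_\<mu>[OF m1] self_\<mu>[OF m2])
    show "mutual (\<lambda>z. e2ennreal (E z)) \<mu> L = ennreal (1 / 2 * (p id T1 + p id T2))"
      "mutual (\<lambda>z. e2ennreal (- E z)) \<mu> L = ennreal (1 / 2 * (n id T1 + n id T2))"
      using pn' by (simp_all add: cross_\<mu>[OF m1] cross_\<mu>[OF m2] average
          del: ennreal_half times_divide_eq_left mult_1 ennreal_plus)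
    show "mutual (\<lambda>z. e2ennreal (E z)) L L =
        ennreal (1 / 2 * (1 / 2 * (p T1 T1 + p T1 T2) + 1 / 2 * (p T2 T1 + p T2 T2)))"
      "mutual (\<lambda>z. e2ennreal (- E z)) L L =
        ennreal (1 / 2 * (1 / 2 * (n T1 T1 + n T1 T2) + 1 / 2 * (n T2 T1 + n T2 T2)))"
      using pn' by (simp_all add: self_L[OF m1] self_L[OF m2] average
          del: ennreal_half times_divide_eq_left mult_1 ennreal_plus)
  qed (use pn' in auto)
  moreover have "(\<integral>z. real_of_ereal (E z) \<partial>(\<mu> \<Otimes>\<^sub>M \<mu>)) = p id id - n id id"
    "(\<integral>z. real_of_ereal (E (fst z, T1 (snd z))) \<partial>(\<mu> \<Otimes>\<^sub>M \<mu>)) = p id T1 - n id T1"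
    "(\<integral>z. real_of_ereal (E (fst z, T2 (snd z))) \<partial>(\<mu> \<Otimes>\<^sub>M \<mu>)) = p id T2 - n id T2"
    using pn' by simp_all
  ultimately show ?thesis by argo
qed

text \<open>Both ways in which the minimal energy could be infinite would produce a second minimizer:
  if it is \<open>\<infinity>\<close>, every measure is one; if it is \<open>-\<infinity>\<close>, so is the energy of every
  reweighting of \<open>\<mu>\<close> by a density bounded away from \<open>0\<close> and \<open>\<infinity>\<close>.\<close>

lemma unique_minimizer_integrable:
  fixes E :: "'a::euclidean_space \<times> 'a \<Rightarrow> ereal"
  assumes \<mu>: "\<mu> \<in> borel_probs UNIV"
    and E [measurable]: "E \<in> borel_measurable (borel \<Otimes>\<^sub>M borel)"
    and minimal: "\<And>Q. Q \<in> borel_probs UNIV \<Longrightarrow> ereal_integral (\<mu> \<Otimes>\<^sub>M \<mu>) E \<le> ereal_integral (Q \<Otimes>\<^sub>M Q) E"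
    and unique: "\<And>Q. Q \<in> borel_probs UNIV \<Longrightarrow>
      (\<And>R. R \<in> borel_probs UNIV \<Longrightarrow> ereal_integral (Q \<Otimes>\<^sub>M Q) E \<le> ereal_integral (R \<Otimes>\<^sub>M R) E) \<Longrightarrow> Q = \<mu>"
    and A: "A \<in> sets borel" "measure \<mu> A > 0"
    and bound: "\<And>x y. x \<in> A \<Longrightarrow> y \<in> A \<Longrightarrow> ereal (- C) \<le> E (x, y)"
  shows "AE z in \<mu> \<Otimes>\<^sub>M \<mu>. \<bar>E z\<bar> \<noteq> \<infinity>" "integrable (\<mu> \<Otimes>\<^sub>M \<mu>) (\<lambda>z. real_of_ereal (E z))"
proof -
  interpret \<mu>: prob_space \<mu> using \<mu> by (simp add: borel_probs_UNIV)
  interpret \<mu>\<mu>: pair_prob_space \<mu> \<mu> ..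
  have sets\<mu> [measurable_cong]: "sets \<mu> = sets borel" using \<mu> by (simp add: borel_probs_UNIV)
  have space\<mu>: "space \<mu> = UNIV" using sets_eq_imp_space_eq[OF sets\<mu>] by simp
  note [measurable] = A(1)
  define p n where "p = (\<integral>\<^sup>+ z. e2ennreal (E z) \<partial>(\<mu> \<Otimes>\<^sub>M \<mu>))"
    and "n = (\<integral>\<^sup>+ z. e2ennreal (- E z) \<partial>(\<mu> \<Otimes>\<^sub>M \<mu>))"
  have energy: "ereal_integral (\<mu> \<Otimes>\<^sub>M \<mu>) E = enn2ereal p - enn2ereal n"
    by (simp add: ereal_integral_def p_def n_def)
  have p: "p \<noteq> \<infinity>"
  proof
    assume "p = \<infinity>"
    \<comment> \<open>Here \<open>\<infinity> - \<infinity> = \<infinity>\<close> in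
      \<open>ereal\<close> matters: the negative part might be infinite too.\<close>
    then have "ereal_integral (\<mu> \<Otimes>\<^sub>M \<mu>) E = \<infinity>" by (simp add: energy)
    then have "ereal_integral (R \<Otimes>\<^sub>M R) E = \<infinity>" if "R \<in> borel_probs UNIV" for R
      using minimal[OF that] by simp
    \<comment> \<open>Point masses at two different points would both be the unique
      minimizer.\<close>
    then have eq: "return borel x = \<mu>" for x
      by (intro unique) (auto simp: borel_probs_UNIV prob_space_return)
    have "emeasure (return borel (0::'a)) {0} = emeasure (return borel (SOME b. b \<in> Basis :: 'a)) {0}"
      using eq by simp
    moreover have "(SOME b. b \<in> Basis :: 'a) \<noteq> 0" using nonzero_Basis SOME_Basis by metis
    ultimately show False by simp
  qed
  have n: "n \<noteq> \<infinity>"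
  proof
    assume inf: "n = \<infinity>"
    define m where "m = measure \<mu> A"
    have m: "0 < m" "m \<le> 1" using A by (auto simp: m_def)
    show False
    proof (cases "m = 1")
      \<comment> \<open>Reweighting \<open>A\<close> against its complement has no effect here, but
        then \<open>E\<close> is bounded below almost everywhere, so \<open>n\<close> is finite
        outright.\<close>
      case True
      then have "AE x in \<mu>. x \<in> A" unfolding m_def
        by (intro \<mu>.AE_prob_1) simp
      then have "AE z in \<mu> \<Otimes>\<^sub>M \<mu>. fst z \<in> A \<and> snd z \<in> A"
        by (intro AE_conjI \<mu>\<mu>.AE_pair_measure) (auto intro: AE_mp)
      then have "AE z in \<mu> \<Otimes>\<^sub>M \<mu>. e2ennreal (- E z) \<le> ennreal C"
      proof eventually_elim
        case (elim z)
        then have "- E z \<le> ereal C" using bound[of "fst z" "snd z"]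
          by (cases "E z") auto
        then have "e2ennreal (- E z) \<le> e2ennreal (ereal C)" by (rule e2ennreal_mono)
        then show ?case by (simp add: e2ennreal_ereal)
      qed
      then have "n \<le> (\<integral>\<^sup>+ z. ennreal C \<partial>(\<mu> \<Otimes>\<^sub>M \<mu>))" unfolding n_def by (rule nn_integral_mono_AE)
      then show False using inf by (simp add: \<mu>\<mu>.emeasure_space_1 top_unique)
    next
      case False
      \<comment> \<open>This moves the mass \<open>m * (1 - m) / 2\<close> from the complement of
        \<open>A\<close> into \<open>A\<close>. The total stays 1 while the mass of \<open>A\<close>
        changes, and the density lies between 1/2 and 2, so the positive part of the energy stays
        finite and the negative part infinite.\<close>
      define f where "f = (\<lambda>x. if x \<in> A then 1 + (1 - m) / 2 else 1 - m / 2)"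
      define Q where "Q = density \<mu> (\<lambda>x. ennreal (f x))"
      have f: "1 / 2 \<le> f x" "f x \<le> 2" for x using m by (auto simp: f_def)
      have [measurable]: "f \<in> borel_measurable borel" unfolding f_def by measurable
      have massQ: "emeasure Q B = (\<integral>\<^sup>+ x. ennreal (f x) * indicator B x \<partial>\<mu>)" if "B \<in> sets borel" for B
        unfolding Q_def using that by (subst emeasure_density) auto
      have QA: "emeasure Q A = ennreal ((1 + (1 - m) / 2) * m)"
      proof -
        have "emeasure Q A = (\<integral>\<^sup>+ x. ennreal (1 + (1 - m) / 2) * indicator A x \<partial>\<mu>)"
          unfolding massQ[OF A(1)] by (intro nn_integral_cong) (auto simp: f_def indicator_def)
        also have "\<dots> = ennreal (1 + (1 - m) / 2) * emeasure \<mu> A"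
          by (subst nn_integral_cmult_indicator) auto
        finally show ?thesis using m by (simp add: \<mu>.emeasure_eq_measure m_def ennreal_mult)
      qed
      have "emeasure Q UNIV = ennreal 1"
      proof -
        have "emeasure Q (- A) = (\<integral>\<^sup>+ x. ennreal (1 - m / 2) * indicator (- A) x \<partial>\<mu>)"
          using A(1) by (subst massQ) (auto simp: f_def indicator_def intro!: nn_integral_cong)
        also have "\<dots> = ennreal (1 - m / 2) * emeasure \<mu> (- A)"
          by (subst nn_integral_cmult_indicator) auto
        also have "emeasure \<mu> (- A) = ennreal (1 - m)"
          using \<mu>.prob_compl[of A] by (simp add: \<mu>.emeasure_eq_measure m_def space\<mu> Compl_eq_Diff_UNIV)
        finally have QA': "emeasure Q (- A) = ennreal ((1 - m / 2) * (1 - m))"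
          using m by (simp add: ennreal_mult)
        have "emeasure Q UNIV = emeasure Q A + emeasure Q (- A)"
          using A(1) by (subst plus_emeasure) (auto simp: Q_def sets\<mu>)
        also have "\<dots> = ennreal ((1 + (1 - m) / 2) * m + (1 - m / 2) * (1 - m))"
          unfolding QA QA' using m by (subst ennreal_plus) auto
        also have "(1 + (1 - m) / 2) * m + (1 - m / 2) * (1 - m) = 1" by (simp add: field_simps)
        finally show ?thesis .
      qed
      then have Q: "Q \<in> borel_probs UNIV"
        unfolding borel_probs_UNIV by (auto simp: Q_def space\<mu> sets\<mu> intro!: prob_spaceI)
      have QQ: "Q \<Otimes>\<^sub>M Q = density (\<mu> \<Otimes>\<^sub>M \<mu>) (\<lambda>(x, y). ennreal (f x) * ennreal (f y))"
      proof -
        interpret Q: prob_space Q using Q by (simp add: borel_probs_UNIV)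
        show ?thesis unfolding Q_def
          by (rule pair_measure_density)
            (simp_all add: \<mu>.sigma_finite_measure_axioms Q.sigma_finite_measure_axioms Q_def[symmetric])
      qed
      have int: "(\<integral>\<^sup>+ z. g z \<partial>(Q \<Otimes>\<^sub>M Q)) = (\<integral>\<^sup>+ z. ennreal (f (fst z) * f (snd z)) * g z \<partial>(\<mu> \<Otimes>\<^sub>M \<mu>))"
        if [measurable]: "g \<in> borel_measurable (borel \<Otimes>\<^sub>M borel)" for g
      proof -
        have nn: "f x \<ge> 0" for x using f(1)[of x] by linarith
        show ?thesis unfolding QQ by (subst nn_integral_density)
          (auto simp: ennreal_mult nn split_beta intro!: nn_integral_cong)
      qed
      have "(\<integral>\<^sup>+ z. e2ennreal (E z) \<partial>(Q \<Otimes>\<^sub>M Q)) \<le> (\<integral>\<^sup>+ z. ennreal (2 * 2) * e2ennreal (E z) \<partial>(\<mu> \<Otimes>\<^sub>M \<mu>))"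
      proof (subst int)
        have "f x * f y \<le> 2 * 2" for x y
          using f(2)[of x] f(2)[of y] f(1)[of x] f(1)[of y] by (intro mult_mono) linarith+
        then show "(\<integral>\<^sup>+ z. ennreal (f (fst z) * f (snd z)) * e2ennreal (E z) \<partial>(\<mu> \<Otimes>\<^sub>M \<mu>))
            \<le> (\<integral>\<^sup>+ z. ennreal (2 * 2) * e2ennreal (E z) \<partial>(\<mu> \<Otimes>\<^sub>M \<mu>))"
          by (intro nn_integral_mono mult_right_mono ennreal_leI) auto
      qed simp
      also have "\<dots> = ennreal (2 * 2) * p" unfolding p_def by (rule nn_integral_cmult) simp
      also have "\<dots> < \<infinity>" using p by (subst infinity_ennreal_def, subst ennreal_mult_less_top) (simp add: less_top)
      finally have Qpos: "(\<integral>\<^sup>+ z. e2ennreal (E z) \<partial>(Q \<Otimes>\<^sub>M Q)) < \<infinity>" .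
      have "ennreal (1 / 2 * (1 / 2)) * n = (\<integral>\<^sup>+ z. ennreal (1 / 2 * (1 / 2)) * e2ennreal (- E z) \<partial>(\<mu> \<Otimes>\<^sub>M \<mu>))"
        unfolding n_def by (rule nn_integral_cmult[symmetric]) simp
      also have "\<dots> \<le> (\<integral>\<^sup>+ z. e2ennreal (- E z) \<partial>(Q \<Otimes>\<^sub>M Q))"
      proof (subst int)
        have "1 / 2 * (1 / 2) \<le> f x * f y" for x y
          using f(1)[of x] f(1)[of y] by (intro mult_mono) linarith+
        then show "(\<integral>\<^sup>+ z. ennreal (1 / 2 * (1 / 2)) * e2ennreal (- E z) \<partial>(\<mu> \<Otimes>\<^sub>M \<mu>))
            \<le> (\<integral>\<^sup>+ z. ennreal (f (fst z) * f (snd z)) * e2ennreal (- E z) \<partial>(\<mu> \<Otimes>\<^sub>M \<mu>))"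
          by (intro nn_integral_mono mult_right_mono ennreal_leI) auto
      qed simp
      finally have "(\<integral>\<^sup>+ z. e2ennreal (- E z) \<partial>(Q \<Otimes>\<^sub>M Q)) = \<infinity>"
        using inf by (simp add: ennreal_mult_top top_unique)
      with Qpos have "ereal_integral (Q \<Otimes>\<^sub>M Q) E = -\<infinity>"
        unfolding ereal_integral_def
        by (cases "\<integral>\<^sup>+ z. e2ennreal (E z) \<partial>(Q \<Otimes>\<^sub>M Q)") (auto simp: enn2ereal_ennreal)
      then have "Q = \<mu>" by (intro unique Q) auto
      then have "ennreal ((1 + (1 - m) / 2) * m) = ennreal m"
        using QA by (simp add: \<mu>.emeasure_eq_measure m_def)
      then have "(1 + (1 - m) / 2) * m = m" using m by (subst (asm) ennreal_inj) auto
      then show False using m False by simp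
    qed
  qed
  have [measurable]: "E \<in> borel_measurable (\<mu> \<Otimes>\<^sub>M \<mu>)" by simp
  show "AE z in \<mu> \<Otimes>\<^sub>M \<mu>. \<bar>E z\<bar> \<noteq> \<infinity>" "integrable (\<mu> \<Otimes>\<^sub>M \<mu>) (\<lambda>z. real_of_ereal (E z))"
    using integrable_real_of_ereal[of E "\<mu> \<Otimes>\<^sub>M \<mu>"] p n unfolding p_def n_def by simp_all
qed

section \<open>Radial displacement of a sphere\<close>

text \<open>For \<open>r = 0\<close> the sphere is the origin, which is displaced in the direction \<open>e\<close>.\<close>

definition direction :: "'a::real_normed_vector \<Rightarrow> 'a \<Rightarrow> 'a" where
  "direction e y = (if y = 0 then e else sgn y)"

definition shift :: "real \<Rightarrow> 'a::real_normed_vector \<Rightarrow> real \<Rightarrow> 'a \<Rightarrow> 'a" where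
  "shift r e t y = (if norm y = r then y + t *\<^sub>R direction e y else y)"

lemma norm_direction: "norm e = 1 \<Longrightarrow> norm (direction e y) = 1"
  by (simp add: direction_def norm_sgn)

lemma shift_0 [simp]: "shift r e 0 = id"
  by (auto simp: shift_def)

lemma shift_off: "norm y \<noteq> r \<Longrightarrow> shift r e t y = y"
  by (simp add: shift_def)

lemma shift_on: "norm y = r \<Longrightarrow> shift r e t y = y + t *\<^sub>R direction e y"
  by (simp add: shift_def)

text \<open>For \<open>r > 0\<close> the displacement is a dilation of the sphere, so the distance
  of two points moved by the same amount is scaled by \<open>\<bar>1 + t / r\<bar>\<close>.\<close>

lemma shift_pos: "norm y = r \<Longrightarrow> r > 0 \<Longrightarrow> shift r e t y = (1 + t / r) *\<^sub>R y"
  by (auto simp: shift_def direction_def sgn_div_norm scaleR_add_left divide_inverse)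

lemma norm_shift:
  assumes "norm e = 1" "norm y = r"
  shows "norm (shift r e t y) = \<bar>r + t\<bar>"
proof (cases "y = 0")
  case False
  then have "r > 0" using assms by auto
  then have "\<bar>1 + t / r\<bar> * r = \<bar>(1 + t / r) * r\<bar>" by (simp add: abs_mult)
  also have "(1 + t / r) * r = r + t" using \<open>r > 0\<close> by (simp add: field_simps)
  finally show ?thesis using \<open>r > 0\<close> assms by (simp add: shift_pos)
qed (use assms in \<open>auto simp: shift_def direction_def\<close>)

lemma borel_measurable_shift [measurable]:
  "shift r e t \<in> borel_measurable (borel :: 'a::euclidean_space measure)"
  unfolding shift_def[abs_def] direction_def[abs_def] by measurable

text \<open>Homogeneity: a factor \<open>c\<close> in \<open>X\<close> multiplies the kernel by
  \<open>c powr (- s / 2)\<close>, or subtracts \<open>ln c / 2\<close> if \<open>s = 0\<close>. The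
  constant covers both cases.\<close>

lemma riesz_sq_scale:
  assumes "c > 0" "X > 0 \<or> s < 0" "X \<ge> 0"
  shows "\<bar>riesz_sq s (c * X) - riesz_sq s X\<bar> \<le> (\<bar>c powr (- s / 2) - 1\<bar> + \<bar>ln c\<bar> / 2) * (1 + \<bar>riesz_sq s X\<bar>)"
proof (cases "s = 0")
  case True
  with assms have "riesz_sq s (c * X) - riesz_sq s X = - ln c / 2"
    by (simp add: riesz_sq_def ln_mult field_simps)
  moreover have "\<bar>ln c\<bar> / 2 * 1 \<le> (\<bar>c powr (- s / 2) - 1\<bar> + \<bar>ln c\<bar> / 2) * (1 + \<bar>riesz_sq s X\<bar>)"
    by (intro mult_mono) auto
  ultimately show ?thesis by simp
next
  case False
  then have "riesz_sq s (c * X) - riesz_sq s X = (c powr (- s / 2) - 1) * riesz_sq s X"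
    using powr_mult[of c X "- s / 2"] by (simp add: riesz_sq_def diff_divide_distrib left_diff_distrib)
  then have "\<bar>riesz_sq s (c * X) - riesz_sq s X\<bar> = \<bar>c powr (- s / 2) - 1\<bar> * \<bar>riesz_sq s X\<bar>"
    by (simp add: abs_mult)
  also have "\<dots> \<le> (\<bar>c powr (- s / 2) - 1\<bar> + \<bar>ln c\<bar> / 2) * (1 + \<bar>riesz_sq s X\<bar>)"
    by (intro mult_mono) auto
  finally show ?thesis .
qed

text \<open>This domination carries integrability from the pair energy to its displaced versions. If
  exactly one point lies on the sphere, the points are at least \<delta> apart and the change is
  bounded. Equal displacements of two points of the sphere act as a dilation if
  \<open>r > 0\<close>; unequal ones leave a distance between \<open>t\<close> and
  \<open>2 * (r + t)\<close>, where the kernel is bounded. The kernel enters the bound only for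
  pairs on the sphere: there the field is constant and the pair energy controls the kernel.\<close>

lemma shift_kernel_diff:
  fixes e :: "'a::euclidean_space"
  assumes s: "s \<ge> -1" and e: "norm e = 1" and \<delta>: "\<delta> > 0" and r: "r \<ge> 0" "r = 0 \<longrightarrow> s < 0"
    and t: "t > 0" "t \<le> \<delta> / 2" "r > 0 \<longrightarrow> t \<le> r / 2"
    and ab: "a \<in> {0, t, - t}" "b \<in> {0, t, - t}"
  shows "\<exists>C\<ge>0. \<forall>x y. (norm x = r \<or> \<delta> \<le> \<bar>norm x - r\<bar>) \<longrightarrow> (norm y = r \<or> \<delta> \<le> \<bar>norm y - r\<bar>) \<longrightarrow>
    (x \<noteq> y \<or> s < 0) \<longrightarrow> (shift r e a x \<noteq> shift r e b y \<or> s < 0) \<and>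
    \<bar>riesz_sq s ((norm (shift r e a x - shift r e b y))\<^sup>2) - riesz_sq s ((norm (x - y))\<^sup>2)\<bar>
      \<le> C * (1 + (if norm x = r \<and> norm y = r then \<bar>riesz_sq s ((norm (x - y))\<^sup>2)\<bar> else 0))"
proof -
  define c where "c = (1 + a / r)\<^sup>2"
  define C1 where "C1 = \<bar>c powr (- s / 2) - 1\<bar> + \<bar>ln c\<bar> / 2"
  define C2 where "C2 = \<bar>riesz_sq s (t\<^sup>2)\<bar> + \<bar>riesz_sq s ((2 * (r + t))\<^sup>2)\<bar>"
  define C where "C = 1 + (\<delta> / 2) powr (- s) + C1 + C2"
  have C: "C \<ge> 1" "C1 \<le> C" "1 + C2 \<le> C" "(\<delta> / 2) powr (- s) \<le> C" "C1 \<ge> 0" "C2 \<ge> 0"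
    by (auto simp: C_def C1_def C2_def)
  have *: "(shift r e a x \<noteq> shift r e b y \<or> s < 0) \<and>
    \<bar>riesz_sq s ((norm (shift r e a x - shift r e b y))\<^sup>2) - riesz_sq s ((norm (x - y))\<^sup>2)\<bar>
      \<le> C * (1 + (if norm x = r \<and> norm y = r then \<bar>riesz_sq s ((norm (x - y))\<^sup>2)\<bar> else 0))"
    if x: "norm x = r \<or> \<delta> \<le> \<bar>norm x - r\<bar>" and y: "norm y = r \<or> \<delta> \<le> \<bar>norm y - r\<bar>"
      and xy: "x \<noteq> y \<or> s < 0" for x y
  proof -
    have far: "(z + w \<noteq> 0) \<and> \<bar>riesz_sq s ((norm (z + w))\<^sup>2) - riesz_sq s ((norm z)\<^sup>2)\<bar> \<le> C"
      if "\<delta> \<le> norm z" "norm w \<le> \<delta> / 2" for z w :: 'a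
    proof
      have "norm z \<noteq> norm w" using that \<delta> by linarith
      then show "z + w \<noteq> 0" by (metis add_eq_0_iff norm_minus_cancel)
      show "\<bar>riesz_sq s ((norm (z + w))\<^sup>2) - riesz_sq s ((norm z)\<^sup>2)\<bar> \<le> C"
        using riesz_sq_far_difference[OF s \<delta> that] C by linarith
    qed
    have ab': "\<bar>a\<bar> \<le> \<delta> / 2" "\<bar>b\<bar> \<le> \<delta> / 2" using ab t \<delta> by auto
    consider (off) "norm x \<noteq> r" "norm y \<noteq> r" | (xon) "norm x = r" "norm y \<noteq> r"
      | (yon) "norm x \<noteq> r" "norm y = r" | (eq) "norm x = r" "norm y = r" "a = b"
      | (neq) "norm x = r" "norm y = r" "a \<noteq> b" by blast
    then show ?thesis
    proof cases
      case off
      then show ?thesis using xy C by (simp add: shift_off)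
    next
      case xon
      have "\<delta> \<le> norm (x - y)" using xon y norm_triangle_ineq3[of x y] by auto
      moreover have "norm (a *\<^sub>R direction e x) \<le> \<delta> / 2" using ab' by (simp add: norm_direction[OF e])
      ultimately show ?thesis using far[of "x - y" "a *\<^sub>R direction e x"] xon
        by (simp add: shift_off shift_on algebra_simps)
    next
      case yon
      have "\<delta> \<le> norm (x - y)" using yon x norm_triangle_ineq3[of x y] by auto
      moreover have "norm (- (b *\<^sub>R direction e y)) \<le> \<delta> / 2" using ab' by (simp add: norm_direction[OF e])
      ultimately show ?thesis using far[of "x - y" "- (b *\<^sub>R direction e y)"] yon
        by (simp add: shift_off shift_on algebra_simps)
    next
      case eq
      show ?thesis
      proof (cases "r = 0")
        case True
        then show ?thesis using eq r C by (auto simp: mult_nonneg_nonneg)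
      next
        case False
        then have r0: "r > 0" using r by simp
        have "\<bar>a\<bar> \<le> r / 2" using ab t(1,3) r0 by auto
        then have "\<bar>a / r\<bar> \<le> 1 / 2" using r0 by (simp add: field_simps)
        then have a0: "1 + a / r > 0" by linarith
        then have c0: "c > 0" by (simp add: c_def)
        have shift_eq: "shift r e a x - shift r e b y = (1 + a / r) *\<^sub>R (x - y)"
          using eq r0 by (simp add: shift_pos algebra_simps)
        have nsq: "(norm (shift r e a x - shift r e b y))\<^sup>2 = c * (norm (x - y))\<^sup>2"
          by (simp add: shift_eq c_def power_mult_distrib)
        have "\<bar>riesz_sq s (c * (norm (x - y))\<^sup>2) - riesz_sq s ((norm (x - y))\<^sup>2)\<bar>
            \<le> C1 * (1 + \<bar>riesz_sq s ((norm (x - y))\<^sup>2)\<bar>)"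
          unfolding C1_def using xy c0 by (intro riesz_sq_scale) auto
        also have "\<dots> \<le> C * (1 + \<bar>riesz_sq s ((norm (x - y))\<^sup>2)\<bar>)"
          using C by (intro mult_right_mono) auto
        finally have "\<bar>riesz_sq s ((norm (shift r e a x - shift r e b y))\<^sup>2) - riesz_sq s ((norm (x - y))\<^sup>2)\<bar>
            \<le> C * (1 + \<bar>riesz_sq s ((norm (x - y))\<^sup>2)\<bar>)" by (simp only: nsq)
        moreover have "shift r e a x \<noteq> shift r e b y" if "x \<noteq> y"
        proof -
          have "(1 + a / r) *\<^sub>R (x - y) \<noteq> 0" using that a0 by simp
          then show ?thesis using shift_eq by auto
        qed
        ultimately show ?thesis using xy eq by auto
      qed
    next
      case neq
      have ab_dist: "\<bar>a - b\<bar> \<ge> t" "\<bar>a\<bar> \<le> t" "\<bar>b\<bar> \<le> t" using neq ab t by auto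
      have lower: "t \<le> norm (shift r e a x - shift r e b y)"
      proof (cases "r = 0")
        case True
        then have "shift r e a x - shift r e b y = (a - b) *\<^sub>R e"
          using neq by (simp add: shift_def direction_def algebra_simps)
        then show ?thesis using ab_dist e by simp
      next
        case False
        then have "t \<le> r / 2" using t r by simp
        then have "norm (shift r e a x) = r + a" "norm (shift r e b y) = r + b"
          using ab_dist r neq by (simp_all add: norm_shift[OF e])
        then show ?thesis
          using norm_triangle_ineq3[of "shift r e a x" "shift r e b y"] ab_dist by linarith
      qed
      have "norm (shift r e a x - shift r e b y) \<le> \<bar>r + a\<bar> + \<bar>r + b\<bar>"
        using norm_triangle_ineq4[of "shift r e a x" "shift r e b y"] neq by (simp add: norm_shift[OF e])
      also have "\<dots> \<le> (r + t) + (r + t)" using ab_dist(2,3) r(1) by (intro add_mono) linarith+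
      finally have upper: "norm (shift r e a x - shift r e b y) \<le> 2 * (r + t)" by simp
      have "t\<^sup>2 \<le> (norm (shift r e a x - shift r e b y))\<^sup>2"
        "(norm (shift r e a x - shift r e b y))\<^sup>2 \<le> (2 * (r + t))\<^sup>2"
        using lower upper t by (auto intro!: power_mono)
      moreover have "t\<^sup>2 > 0" using t by simp
      ultimately have "riesz_sq s ((norm (shift r e a x - shift r e b y))\<^sup>2) \<le> riesz_sq s (t\<^sup>2)"
        "riesz_sq s ((2 * (r + t))\<^sup>2) \<le> riesz_sq s ((norm (shift r e a x - shift r e b y))\<^sup>2)"
        by (auto intro!: riesz_sq_antimono simp del: power2_less_eq_zero_iff)
      then have "\<bar>riesz_sq s ((norm (shift r e a x - shift r e b y))\<^sup>2)\<bar> \<le> C2"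
        unfolding C2_def by linarith
      then have "\<bar>riesz_sq s ((norm (shift r e a x - shift r e b y))\<^sup>2) - riesz_sq s ((norm (x - y))\<^sup>2)\<bar>
          \<le> C2 + \<bar>riesz_sq s ((norm (x - y))\<^sup>2)\<bar>" by linarith
      also have "\<dots> \<le> C * 1 + C * \<bar>riesz_sq s ((norm (x - y))\<^sup>2)\<bar>"
        using C mult_right_mono[OF C(1), of "\<bar>riesz_sq s ((norm (x - y))\<^sup>2)\<bar>"] by simp
      finally have "\<bar>riesz_sq s ((norm (shift r e a x - shift r e b y))\<^sup>2) - riesz_sq s ((norm (x - y))\<^sup>2)\<bar>
          \<le> C * (1 + \<bar>riesz_sq s ((norm (x - y))\<^sup>2)\<bar>)" by (simp add: distrib_left)
      moreover have "shift r e a x \<noteq> shift r e b y" using lower t by auto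
      ultimately show ?thesis using neq by simp
    qed
  qed
  show ?thesis by (rule exI[of _ C]) (use C * in auto)
qed

section \<open>Second variation at an isolated sphere\<close>

definition interaction :: "real \<Rightarrow> (real \<Rightarrow> ereal) \<Rightarrow> 'a::euclidean_space \<times> 'a \<Rightarrow> ereal" where
  "interaction s v z =
    riesz_kernel s (fst z - snd z) + radial_field v (fst z) + radial_field v (snd z)"

abbreviation riesz_pair :: "real \<Rightarrow> 'a::real_normed_vector \<Rightarrow> 'a \<Rightarrow> real" where
  "riesz_pair s x y \<equiv> riesz_sq s ((norm (x - y))\<^sup>2)"

lemma riesz_energy_eq:
  "riesz_energy s (radial_field v) \<mu> = ereal_integral (\<mu> \<Otimes>\<^sub>M \<mu>) (interaction s v)"
  unfolding riesz_energy_def by (rule arg_cong[where f = "ereal_integral _"]) (auto simp: interaction_def)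

lemma interaction_commute: "interaction s v (x, y) = interaction s v (y, x)"
proof -
  have "riesz_kernel s (x - y) = riesz_kernel s (y - x)"
    by (simp add: riesz_kernel_def norm_minus_commute)
  then show ?thesis by (simp add: interaction_def add_ac)
qed

lemma interaction_eq:
  assumes "\<bar>radial_field v x\<bar> \<noteq> \<infinity>" "\<bar>radial_field v y\<bar> \<noteq> \<infinity>" "x \<noteq> y \<or> s < 0"
  shows "interaction s v (x, y) =
    ereal (riesz_pair s x y + real_of_ereal (radial_field v x) + real_of_ereal (radial_field v y))"
proof -
  have "x - y \<noteq> 0 \<or> s < 0" using assms(3) by auto
  then have "riesz_kernel s (x - y) = ereal (riesz_pair s x y)" by (rule riesz_kernel_eq_riesz_sq)
  then show ?thesis using assms by (cases "radial_field v x"; cases "radial_field v y") (auto simp: interaction_def)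
qed

text \<open>No summand can be \<open>-\<infinity>\<close>, so a finite sum has finite summands; on
  the diagonal the kernel is \<infinity> unless \<open>s < 0\<close>.\<close>

lemma interaction_finite:
  assumes low: "\<And>\<rho>. \<rho> \<ge> 0 \<Longrightarrow> v \<rho> \<noteq> -\<infinity>" and fin: "\<bar>interaction s v (x, y)\<bar> \<noteq> \<infinity>"
  shows "\<bar>radial_field v x\<bar> \<noteq> \<infinity>" "\<bar>radial_field v y\<bar> \<noteq> \<infinity>" "x \<noteq> y \<or> s < 0"
proof -
  have "radial_field v x \<noteq> -\<infinity>" "radial_field v y \<noteq> -\<infinity>" using low by (auto simp: radial_field_def)
  moreover have "riesz_kernel s (x - y) \<noteq> -\<infinity>" by (auto simp: riesz_kernel_def)
  moreover have "riesz_kernel s (x - y) = \<infinity>" if "\<not> (x \<noteq> y \<or> s < 0)" using that by (auto simp: riesz_kernel_def)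
  ultimately show "\<bar>radial_field v x\<bar> \<noteq> \<infinity>" "\<bar>radial_field v y\<bar> \<noteq> \<infinity>" "x \<noteq> y \<or> s < 0"
    using fin unfolding interaction_def
    by (cases "riesz_kernel s (x - y)"; cases "radial_field v x"; cases "radial_field v y"; force)+
qed

lemma borel_measurable_interaction [measurable]:
  fixes v :: "real \<Rightarrow> ereal"
  assumes [measurable]: "(radial_field v :: 'a::euclidean_space \<Rightarrow> ereal) \<in> borel_measurable borel"
  shows "(interaction s v :: 'a \<times> 'a \<Rightarrow> ereal) \<in> borel_measurable (borel \<Otimes>\<^sub>M borel)"
  unfolding interaction_def[abs_def] by measurable

text \<open>A minimizer with integrable pair energy whose mass lies on the sphere of radius
  \<open>r\<close> or at distance at least \<delta> from it. The origin is included as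
  \<open>r = 0\<close>; the condition \<open>s < 0\<close> in that case reflects that otherwise an
  atom has infinite self-energy.\<close>

locale isolated_sphere =
  fixes s :: real and v :: "real \<Rightarrow> ereal" and \<mu> :: "'a::euclidean_space measure" and r \<delta> :: real and e :: 'a
  assumes \<mu>: "\<mu> \<in> borel_probs UNIV"
    and field: "(radial_field v :: 'a \<Rightarrow> ereal) \<in> borel_measurable borel"
    and low: "\<And>\<rho>. \<rho> \<ge> 0 \<Longrightarrow> v \<rho> \<noteq> -\<infinity>"
    and minimal: "\<And>Q :: 'a measure. Q \<in> borel_probs UNIV \<Longrightarrow>
      ereal_integral (\<mu> \<Otimes>\<^sub>M \<mu>) (interaction s v) \<le> ereal_integral (Q \<Otimes>\<^sub>M Q) (interaction s v)"
    and finite: "AE z in \<mu> \<Otimes>\<^sub>M \<mu>. \<bar>interaction s v z\<bar> \<noteq> \<infinity>"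
    and integrable: "integrable (\<mu> \<Otimes>\<^sub>M \<mu>) (\<lambda>z. real_of_ereal (interaction s v z))"
    and s: "s \<ge> -1" and e: "norm e = 1" and \<delta>: "\<delta> > 0" and r: "r \<ge> 0" "r = 0 \<longrightarrow> s < 0"
    and gap: "AE x in \<mu>. norm x = r \<or> \<delta> \<le> \<bar>norm x - r\<bar>"
    and finite_field: "\<bar>v (r\<^sup>2)\<bar> \<noteq> \<infinity>"
begin

interpretation \<mu>: prob_space \<mu> using \<mu> by (simp add: borel_probs_UNIV)

interpretation \<mu>\<mu>: pair_prob_space \<mu> \<mu> ..

lemma sets_\<mu> [measurable_cong]: "sets \<mu> = sets borel"
  using \<mu> by (simp add: borel_probs_UNIV)

declare field [measurable]

definition good :: "'a \<times> 'a \<Rightarrow> bool" where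
  "good z \<longleftrightarrow> \<bar>radial_field v (fst z)\<bar> \<noteq> \<infinity> \<and> \<bar>radial_field v (snd z)\<bar> \<noteq> \<infinity> \<and> (fst z \<noteq> snd z \<or> s < 0) \<and>
    (norm (fst z) = r \<or> \<delta> \<le> \<bar>norm (fst z) - r\<bar>) \<and> (norm (snd z) = r \<or> \<delta> \<le> \<bar>norm (snd z) - r\<bar>)"

lemma AE_good: "AE z in \<mu> \<Otimes>\<^sub>M \<mu>. good z"
proof -
  define A where "A = {x :: 'a. norm x = r \<or> \<delta> \<le> \<bar>norm x - r\<bar>}"
  have [measurable]: "A \<in> sets borel" unfolding A_def by measurable
  have "AE x in \<mu>. x \<in> A" using gap by (simp add: A_def)
  then have "AE z in \<mu> \<Otimes>\<^sub>M \<mu>. fst z \<in> A \<and> snd z \<in> A"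
    by (intro AE_conjI \<mu>\<mu>.AE_pair_measure) (auto intro: AE_mp)
  with finite show ?thesis
  proof eventually_elim
    case (elim z)
    then show ?case using interaction_finite[OF low, where s = s and x = "fst z" and y = "snd z"]
      by (auto simp: good_def A_def)
  qed
qed

abbreviation field_shift :: "real \<Rightarrow> real" where
  "field_shift t \<equiv> real_of_ereal (v ((r + t)\<^sup>2))"

lemma radial_field_shift:
  assumes "norm y = r"
  shows "radial_field v (shift r e t y) = v ((r + t)\<^sup>2)"
  using norm_shift[OF e assms] by (simp add: radial_field_def)

text \<open>On the sphere the field is a finite constant, so there the kernel is at most the pair
  energy \<open>h\<close> up to a constant. Together with the kernel estimate this bounds the
  displaced pair energy by \<open>(1 + C) * \<bar>h\<bar>\<close> plus a constant.\<close>

lemma interaction_shift: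
  assumes ab: "a \<in> {0, t, - t}" "b \<in> {0, t, - t}"
    and t: "t > 0" "t \<le> \<delta> / 2" "r > 0 \<longrightarrow> t \<le> r / 2"
    and fin: "\<bar>v ((r + t)\<^sup>2)\<bar> \<noteq> \<infinity>" "\<bar>v ((r - t)\<^sup>2)\<bar> \<noteq> \<infinity>"
  shows "AE z in \<mu> \<Otimes>\<^sub>M \<mu>. \<bar>interaction s v (shift r e a (fst z), shift r e b (snd z))\<bar> \<noteq> \<infinity>"
    and "integrable (\<mu> \<Otimes>\<^sub>M \<mu>) (\<lambda>z. real_of_ereal (interaction s v (shift r e a (fst z), shift r e b (snd z))))"
    and "AE z in \<mu> \<Otimes>\<^sub>M \<mu>. real_of_ereal (interaction s v (shift r e a (fst z), shift r e b (snd z))) =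
      riesz_pair s (shift r e a (fst z)) (shift r e b (snd z)) +
      real_of_ereal (radial_field v (shift r e a (fst z))) + real_of_ereal (radial_field v (shift r e b (snd z)))"
proof -
  obtain C where C: "C \<ge> 0" and kernel: "\<And>x y :: 'a. norm x = r \<or> \<delta> \<le> \<bar>norm x - r\<bar> \<Longrightarrow>
      norm y = r \<or> \<delta> \<le> \<bar>norm y - r\<bar> \<Longrightarrow> x \<noteq> y \<or> s < 0 \<Longrightarrow> (shift r e a x \<noteq> shift r e b y \<or> s < 0) \<and>
      \<bar>riesz_pair s (shift r e a x) (shift r e b y) - riesz_pair s x y\<bar>
        \<le> C * (1 + (if norm x = r \<and> norm y = r then \<bar>riesz_pair s x y\<bar> else 0))"
    using shift_kernel_diff[OF s e \<delta> r t ab] by (elim exE conjE) (rule that, assumption, blast)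
  \<comment> \<open>Bounds the change of the field under each displacement and, through the summand
    for 0, the field on the sphere itself.\<close>
  define W where "W = \<bar>field_shift 0\<bar> + \<bar>field_shift t\<bar> + \<bar>field_shift (- t)\<bar>"
  have W0: "\<bar>field_shift 0\<bar> \<le> W" unfolding W_def by linarith
  have W: "W \<ge> 0" unfolding W_def by (intro add_nonneg_nonneg abs_ge_zero)
  have field_shift: "\<bar>radial_field v (shift r e c x)\<bar> \<noteq> \<infinity> \<and>
      \<bar>real_of_ereal (radial_field v (shift r e c x)) - real_of_ereal (radial_field v x)\<bar> \<le> W"
    if c: "c \<in> {0, t, - t}" and x: "\<bar>radial_field v x\<bar> \<noteq> \<infinity>" for c x
  proof (cases "norm x = r")
    case True
    have "radial_field v x = v (r\<^sup>2)" using True by (simp add: radial_field_def)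
    then show ?thesis using c fin finite_field True
      by (auto simp: radial_field_shift W_def)
  next
    case False
    then show ?thesis using x W by (simp add: shift_off)
  qed
  have pointwise: "\<bar>interaction s v (shift r e a (fst z), shift r e b (snd z))\<bar> \<noteq> \<infinity> \<and>
      \<bar>real_of_ereal (interaction s v (shift r e a (fst z), shift r e b (snd z)))\<bar>
        \<le> (1 + C) * \<bar>real_of_ereal (interaction s v z)\<bar> + (C * (1 + 2 * W) + 2 * W) \<and>
      real_of_ereal (interaction s v (shift r e a (fst z), shift r e b (snd z))) =
      riesz_pair s (shift r e a (fst z)) (shift r e b (snd z)) +
      real_of_ereal (radial_field v (shift r e a (fst z))) + real_of_ereal (radial_field v (shift r e b (snd z)))"
    if z: "good z" for z
  proof -
    obtain x y where xy: "z = (x, y)" by (cases z)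
    have g: "\<bar>radial_field v x\<bar> \<noteq> \<infinity>" "\<bar>radial_field v y\<bar> \<noteq> \<infinity>" "x \<noteq> y \<or> s < 0"
      "norm x = r \<or> \<delta> \<le> \<bar>norm x - r\<bar>" "norm y = r \<or> \<delta> \<le> \<bar>norm y - r\<bar>"
      using z by (simp_all add: good_def xy)
    note k = kernel[OF g(4,5,3)]
    note fx = field_shift[OF ab(1) g(1)] and fy = field_shift[OF ab(2) g(2)]
    have eq: "interaction s v (x, y) =
        ereal (riesz_pair s x y + real_of_ereal (radial_field v x) + real_of_ereal (radial_field v y))"
      by (rule interaction_eq[OF g(1-3)])
    have eq': "interaction s v (shift r e a x, shift r e b y) =
        ereal (riesz_pair s (shift r e a x) (shift r e b y) +
        real_of_ereal (radial_field v (shift r e a x)) + real_of_ereal (radial_field v (shift r e b y)))"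
      using fx fy k by (intro interaction_eq) auto
    define h where "h = real_of_ereal (interaction s v (x, y))"
    define h' where "h' = real_of_ereal (interaction s v (shift r e a x, shift r e b y))"
    have "\<bar>h' - h\<bar> \<le> \<bar>riesz_pair s (shift r e a x) (shift r e b y) - riesz_pair s x y\<bar> + 2 * W"
      using fx fy unfolding h_def h'_def eq eq' real_of_ereal.simps by linarith
    also have "\<dots> \<le> C * (1 + (if norm x = r \<and> norm y = r then \<bar>riesz_pair s x y\<bar> else 0)) + 2 * W"
      using k by simp
    also have "\<dots> \<le> C * (1 + (\<bar>h\<bar> + 2 * W)) + 2 * W"
    proof (intro add_right_mono mult_left_mono add_left_mono)
      have "\<bar>riesz_pair s x y\<bar> \<le> \<bar>h\<bar> + 2 * W" if "norm x = r" "norm y = r"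
      proof -
        have "\<bar>real_of_ereal (radial_field v x)\<bar> \<le> W" "\<bar>real_of_ereal (radial_field v y)\<bar> \<le> W"
          using that W0 by (simp_all add: radial_field_def)
        then show ?thesis unfolding h_def eq real_of_ereal.simps by linarith
      qed
      then show "(if norm x = r \<and> norm y = r then \<bar>riesz_pair s x y\<bar> else 0) \<le> \<bar>h\<bar> + 2 * W"
        using W by auto
    qed (rule C)
    finally have "\<bar>h' - h\<bar> \<le> C * (1 + (\<bar>h\<bar> + 2 * W)) + 2 * W" .
    then have "\<bar>h'\<bar> \<le> (1 + C) * \<bar>h\<bar> + (C * (1 + 2 * W) + 2 * W)" by (simp add: algebra_simps)
    then show ?thesis using eq' by (simp add: xy h_def h'_def)
  qed
  show "AE z in \<mu> \<Otimes>\<^sub>M \<mu>. \<bar>interaction s v (shift r e a (fst z), shift r e b (snd z))\<bar> \<noteq> \<infinity>"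
    using AE_good by eventually_elim (rule pointwise[THEN conjunct1])
  show "AE z in \<mu> \<Otimes>\<^sub>M \<mu>. real_of_ereal (interaction s v (shift r e a (fst z), shift r e b (snd z))) =
      riesz_pair s (shift r e a (fst z)) (shift r e b (snd z)) +
      real_of_ereal (radial_field v (shift r e a (fst z))) + real_of_ereal (radial_field v (shift r e b (snd z)))"
    using AE_good by eventually_elim (rule pointwise[THEN conjunct2, THEN conjunct2])
  show "integrable (\<mu> \<Otimes>\<^sub>M \<mu>) (\<lambda>z. real_of_ereal (interaction s v (shift r e a (fst z), shift r e b (snd z))))"
  proof (rule Bochner_Integration.integrable_bound)
    show "integrable (\<mu> \<Otimes>\<^sub>M \<mu>) (\<lambda>z. (1 + C) * \<bar>real_of_ereal (interaction s v z)\<bar> + (C * (1 + 2 * W) + 2 * W))"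
      using integrable by (intro Bochner_Integration.integrable_add integrable_mult_right integrable_abs) auto
    show "AE z in \<mu> \<Otimes>\<^sub>M \<mu>. norm (real_of_ereal (interaction s v (shift r e a (fst z), shift r e b (snd z))))
        \<le> norm ((1 + C) * \<bar>real_of_ereal (interaction s v z)\<bar> + (C * (1 + 2 * W) + 2 * W))"
      using AE_good
    proof eventually_elim
      case (elim z)
      then have "\<bar>real_of_ereal (interaction s v (shift r e a (fst z), shift r e b (snd z)))\<bar>
        \<le> (1 + C) * \<bar>real_of_ereal (interaction s v z)\<bar> + (C * (1 + 2 * W) + 2 * W)"
        by (rule pointwise[THEN conjunct2, THEN conjunct1])
      then show ?case unfolding real_norm_def by (rule order_trans) (rule abs_ge_self)
    qed
  qed measurable
qed

text \<open>Minimality as a test: an integrable majorant \<open>U\<close> of the pointwise second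
  difference has nonnegative integral. Only \<open>y\<close> is displaced, so the roles are not
  symmetric: nothing changes for \<open>y\<close> off the sphere, and for \<open>x\<close> off and
  \<open>y\<close> on it the points are at least \<delta> apart and
  \<open>riesz_sq_far_second_difference\<close> applies.\<close>

lemma second_variation:
  fixes t :: real
  defines "D \<equiv> field_shift t + field_shift (- t) - 2 * field_shift 0"
  assumes t: "t > 0" "t \<le> \<delta> / 2" "r > 0 \<longrightarrow> t \<le> r / 2"
    and fin: "\<bar>v ((r + t)\<^sup>2)\<bar> \<noteq> \<infinity>" "\<bar>v ((r - t)\<^sup>2)\<bar> \<noteq> \<infinity>"
    and U: "integrable (\<mu> \<Otimes>\<^sub>M \<mu>) U"
    and off: "\<And>x y. good (x, y) \<Longrightarrow> norm y \<noteq> r \<Longrightarrow> 0 \<le> U (x, y)"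
    and far: "\<And>x y. good (x, y) \<Longrightarrow> norm x \<noteq> r \<Longrightarrow> norm y = r \<Longrightarrow>
      D + (s + 2) * 4 powr (s / 2 + 2) * \<delta> powr (- s - 2) * t\<^sup>2 \<le> U (x, y)"
    and on: "\<And>x y. good (x, y) \<Longrightarrow> norm x = r \<Longrightarrow> norm y = r \<Longrightarrow>
      D + riesz_pair s x (shift r e t y) + riesz_pair s x (shift r e (- t) y) - 2 * riesz_pair s x y \<le> U (x, y)"
  shows "0 \<le> (\<integral>z. U z \<partial>(\<mu> \<Otimes>\<^sub>M \<mu>))"
proof -
  define h where "h = (\<lambda>a z. real_of_ereal (interaction s v (fst z, shift r e a (snd z))))"
  have h: "AE z in \<mu> \<Otimes>\<^sub>M \<mu>. h a z = riesz_pair s (fst z) (shift r e a (snd z)) +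
      real_of_ereal (radial_field v (fst z)) + real_of_ereal (radial_field v (shift r e a (snd z)))"
    "integrable (\<mu> \<Otimes>\<^sub>M \<mu>) (h a)" if "a \<in> {0, t, - t}" for a
    using interaction_shift(2,3)[of 0 t a, OF _ that t fin] by (simp_all add: h_def)
  have "2 * (\<integral>z. real_of_ereal (interaction s v z) \<partial>(\<mu> \<Otimes>\<^sub>M \<mu>)) \<le>
    (\<integral>z. real_of_ereal (interaction s v (fst z, shift r e t (snd z))) \<partial>(\<mu> \<Otimes>\<^sub>M \<mu>)) +
    (\<integral>z. real_of_ereal (interaction s v (fst z, shift r e (- t) (snd z))) \<partial>(\<mu> \<Otimes>\<^sub>M \<mu>))"
  proof (rule first_variation[OF \<mu> borel_measurable_interaction[OF field] interaction_commute minimal])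
    fix f g assume "f \<in> {id, shift r e t, shift r e (- t)}" "g \<in> {id, shift r e t, shift r e (- t)}"
    then obtain a b where ab: "a \<in> {0, t, - t}" "f = shift r e a" "b \<in> {0, t, - t}" "g = shift r e b"
      by (metis insert_iff shift_0 singletonD)
    show "AE z in \<mu> \<Otimes>\<^sub>M \<mu>. \<bar>interaction s v (f (fst z), g (snd z))\<bar> \<noteq> \<infinity>"
      "integrable (\<mu> \<Otimes>\<^sub>M \<mu>) (\<lambda>z. real_of_ereal (interaction s v (f (fst z), g (snd z))))"
      unfolding ab by (rule interaction_shift[OF ab(1,3) t fin]; assumption)+
  qed auto
  then have "0 \<le> (\<integral>z. h t z + h (- t) z - 2 * h 0 z \<partial>(\<mu> \<Otimes>\<^sub>M \<mu>))"
    using h(2)[of t] h(2)[of "- t"] h(2)[of 0] by (simp add: h_def)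
  also have "\<dots> \<le> (\<integral>z. U z \<partial>(\<mu> \<Otimes>\<^sub>M \<mu>))"
  proof (rule integral_mono_AE)
    show "integrable (\<mu> \<Otimes>\<^sub>M \<mu>) (\<lambda>z. h t z + h (- t) z - 2 * h 0 z)"
      using h(2) by (intro Bochner_Integration.integrable_diff Bochner_Integration.integrable_add integrable_mult_right) auto
    show "AE z in \<mu> \<Otimes>\<^sub>M \<mu>. h t z + h (- t) z - 2 * h 0 z \<le> U z"
      using AE_good h(1)[of t, simplified] h(1)[of "- t", simplified] h(1)[of 0, simplified]
    proof eventually_elim
      case (elim z)
      obtain x y where xy: "z = (x, y)" by (cases z)
      show ?case
      proof (cases "norm y = r")
        case False
        then show ?thesis using elim off[of x y] by (simp add: xy shift_off)
      next
        case True
        have eq: "h t z + h (- t) z - 2 * h 0 z =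
            D + riesz_pair s x (shift r e t y) + riesz_pair s x (shift r e (- t) y) - 2 * riesz_pair s x y"
          using elim(2-4) True radial_field_shift[OF True, of t] radial_field_shift[OF True, of "- t"]
            radial_field_shift[OF True, of 0] by (simp add: xy D_def)
        show ?thesis
        proof (cases "norm x = r")
          case x: True
          show ?thesis unfolding eq using on[of x y] elim(1) True x by (simp add: xy)
        next
          case False
          define w where "w = t *\<^sub>R direction e y"
          have w: "norm w = t" using t by (simp add: w_def norm_direction[OF e])
          have "\<delta> \<le> norm (x - y)"
            using False True elim(1) norm_triangle_ineq3[of x y] by (auto simp: good_def xy)
          then have "riesz_sq s ((norm (x - y + w))\<^sup>2) + riesz_sq s ((norm (x - y - w))\<^sup>2) - 2 * riesz_pair s x y
            \<le> (s + 2) * 4 powr (s / 2 + 2) * \<delta> powr (- s - 2) * (norm w)\<^sup>2"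
            using s \<delta> t w by (intro riesz_sq_far_second_difference) auto
          moreover have shifts: "x - shift r e t y = x - y - w" "x - shift r e (- t) y = x - y + w"
            using True by (simp_all add: shift_on w_def)
          ultimately have "D + riesz_pair s x (shift r e t y) + riesz_pair s x (shift r e (- t) y) - 2 * riesz_pair s x y
              \<le> D + (s + 2) * 4 powr (s / 2 + 2) * \<delta> powr (- s - 2) * t\<^sup>2"
            unfolding w shifts by linarith
          also have "\<dots> \<le> U z" using far[of x y] elim(1) False True by (simp add: xy)
          finally show ?thesis unfolding eq .
        qed
      qed
    qed
  qed (rule U)
  finally show ?thesis .
qed

end

text \<open>For \<open>x\<close>, \<open>y\<close> on the sphere of radius \<open>r\<close> and \<open>X = \<parallel>x - y\<parallel>\<^sup>2\<close>, the squared distances from \<open>x\<close> to the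
  displaced points are \<open>X + t\<^sup>2 \<plusminus> (t / r) X\<close>.  The increments \<open>\<plusminus> (t / r) X\<close> contribute
  \<open>O(t\<^sup>2 X powr (- s / 2))\<close> by convexity; the common increment \<open>t\<^sup>2\<close> yields the last term, whose
  integral over the sphere diverges as \<open>t \<rightarrow> 0\<close> since \<open>s + 2 \<ge> d - 1\<close>.\<close>

lemma sphere_second_difference:
  fixes x y :: "'a::euclidean_space"
  assumes s: "s > -2" and r: "r > 0" and t: "t > 0" "t \<le> r / 2"
    and xy: "norm x = r" "norm y = r" "x \<noteq> y \<or> s < 0"
  shows "riesz_pair s x (shift r e t y) + riesz_pair s x (shift r e (- t) y) - 2 * riesz_pair s x y
    \<le> (s / 2 + 1) / 2 * 2 powr (s / 2 + 2) / r\<^sup>2 * (\<bar>s\<bar> + 1) * (1 + \<bar>riesz_pair s x y\<bar>) * t\<^sup>2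
      - t\<^sup>2 * ((norm (x - y))\<^sup>2 + t\<^sup>2) powr (- (s / 2 + 1))"
proof -
  define X where "X = (norm (x - y))\<^sup>2"
  define K where "K = (s / 2 + 1) / 2 * 2 powr (s / 2 + 2) / r\<^sup>2"
  have K: "K \<ge> 0" using s by (simp add: K_def)
  have X: "X \<ge> 0" "X > 0 \<or> s < 0" using xy(3) by (auto simp: X_def)
  \<comment> \<open>Equal norms make the mixed term of the squared distance proportional to
    \<open>X\<close>, hence harmless near the diagonal.\<close>
  have inner: "(x - y) \<bullet> y = - X / 2"
  proof -
    have "X = 2 * r\<^sup>2 - 2 * (x \<bullet> y)"
      unfolding X_def norm_diff_sq using xy by simp
    moreover have "y \<bullet> y = r\<^sup>2" using xy by (simp add: dot_square_norm)
    ultimately show ?thesis by (simp add: inner_diff_left)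
  qed
  have dist: "(norm (x - shift r e c y))\<^sup>2 = X + c\<^sup>2 + c / r * X" for c
  proof -
    have "x - shift r e c y = (x - y) - (c / r) *\<^sub>R y"
      using r xy by (simp add: shift_pos algebra_simps)
    then have "(norm (x - shift r e c y))\<^sup>2 = X + (norm ((c / r) *\<^sub>R y))\<^sup>2 - 2 * (c / r * (- X / 2))"
      by (simp only: norm_diff_sq X_def inner_scaleR_right inner[unfolded X_def])
    also have "norm ((c / r) *\<^sub>R y) = \<bar>c\<bar>" using r xy by simp
    finally show ?thesis by simp
  qed
  have "riesz_sq s (X + t\<^sup>2 + t / r * X) + riesz_sq s (X + t\<^sup>2 - t / r * X) - 2 * riesz_sq s (X + t\<^sup>2)
    \<le> K * X powr (- s / 2) * t\<^sup>2"
  \<comment> \<open>If \<open>X = 0\<close>, which requires \<open>s < 0\<close>, all three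
    arguments are \<open>t\<^sup>2\<close> and both sides vanish because
    \<open>0 powr a = 0\<close>.\<close>
  proof (cases "X = 0")
    case False
    then have X0: "X > 0" using X by simp
    have "\<bar>t / r * X\<bar> \<le> X / 2"
    proof -
      have "t / r \<le> 1 / 2" using t r by (simp add: field_simps)
      then have "t / r * X \<le> 1 / 2 * X" using X0 by (intro mult_right_mono) auto
      then show ?thesis using t r X0 by simp
    qed
    moreover have "0 \<le> t\<^sup>2" by simp
    ultimately have "X / 2 \<le> X + t\<^sup>2 - \<bar>t / r * X\<bar>" by linarith
    then have "riesz_sq s (X + t\<^sup>2 + t / r * X) + riesz_sq s (X + t\<^sup>2 - t / r * X) - 2 * riesz_sq s (X + t\<^sup>2)
      \<le> (s / 2 + 1) / 2 * (X / 2) powr (- s / 2 - 2) * (t / r * X)\<^sup>2"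
      using X0 by (intro riesz_sq_second_difference[OF s]) auto
    also have "\<dots> = (s / 2 + 1) / 2 * (2 powr (s / 2 + 2) * X powr (- s / 2 - 2)) * (t / r * X)\<^sup>2"
    proof -
      have "2 powr (s / 2 + 2) * 2 powr (- s / 2 - 2) = (1 :: real)" by (simp flip: powr_add)
      then have "2 powr (s / 2 + 2) = 1 / (2 :: real) powr (- s / 2 - 2)" by (simp only: eq_divide_eq) simp
      moreover have "(X / 2) powr (- s / 2 - 2) = X powr (- s / 2 - 2) / 2 powr (- s / 2 - 2)"
        using X0 by (intro powr_divide)
      ultimately show ?thesis by simp
    qed
    also have "\<dots> = K * (X powr (- s / 2 - 2) * X\<^sup>2) * t\<^sup>2"
      by (simp add: K_def power_mult_distrib power_divide)
    also have "X powr (- s / 2 - 2) * X\<^sup>2 = X powr (- s / 2)"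
      using X0 by (simp add: powr_diff)
    finally show ?thesis .
  qed simp
  also have "\<dots> \<le> K * ((\<bar>s\<bar> + 1) * (1 + \<bar>riesz_sq s X\<bar>)) * t\<^sup>2"
  proof (intro mult_right_mono mult_left_mono K)
    \<comment> \<open>Up to sign \<open>X powr (- s / 2)\<close> is \<open>s\<close> times the
      kernel, and it is 1 for \<open>s = 0\<close>; the added ones cover both cases.\<close>
    show "X powr (- s / 2) \<le> (\<bar>s\<bar> + 1) * (1 + \<bar>riesz_sq s X\<bar>)"
    proof (cases "s = 0")
      case True
      then show ?thesis using X by simp
    next
      case False
      then have "X powr (- s / 2) = \<bar>s\<bar> * \<bar>riesz_sq s X\<bar>" by (simp add: riesz_sq_def)
      also have "\<dots> \<le> (\<bar>s\<bar> + 1) * (1 + \<bar>riesz_sq s X\<bar>)" by (intro mult_mono) auto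
      finally show ?thesis .
    qed
  qed simp
  finally have *: "riesz_sq s (X + t\<^sup>2 + t / r * X) + riesz_sq s (X + t\<^sup>2 - t / r * X) - 2 * riesz_sq s (X + t\<^sup>2)
    \<le> K * (\<bar>s\<bar> + 1) * (1 + \<bar>riesz_sq s X\<bar>) * t\<^sup>2" by (simp only: mult.assoc)
  have "- s / 2 - 1 = - (s / 2 + 1)" by simp
  then have "riesz_sq s (X + t\<^sup>2) - riesz_sq s X \<le> - (t\<^sup>2 / 2 * (X + t\<^sup>2) powr (- (s / 2 + 1)))"
    using riesz_sq_diff_le[OF X(2,1) s, of "t\<^sup>2"] t by (simp only:) simp
  with * show ?thesis
    unfolding dist[of t] dist[of "- t"] X_def[symmetric] K_def[symmetric] by simp
qed

section \<open>Contradiction at the origin and at a sphere of positive radius\<close>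

context isolated_sphere
begin

interpretation \<mu>: prob_space \<mu> using \<mu> by (simp add: borel_probs_UNIV)

interpretation \<mu>\<mu>: pair_prob_space \<mu> \<mu> ..

abbreviation far_const :: real where
  "far_const \<equiv> (s + 2) * 4 powr (s / 2 + 2) * \<delta> powr (- s - 2)"

lemma far_const_nonneg: "far_const \<ge> 0"
  using s by simp

lemma sphere_sets [measurable]: "sphere 0 r \<in> sets \<mu>"
  by (simp add: sets_\<mu> borel_closed)

lemma space_\<mu>: "space \<mu> = UNIV"
  using sets_eq_imp_space_eq[OF sets_\<mu>] by simp

lemma measure_Times:
  "A \<in> sets \<mu> \<Longrightarrow> B \<in> sets \<mu> \<Longrightarrow> measure (\<mu> \<Otimes>\<^sub>M \<mu>) (A \<times> B) = measure \<mu> A * measure \<mu> B"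
  by (simp add: measure_def \<mu>.emeasure_pair_measure_Times enn2real_mult)

text \<open>Divided by the mass \<open>m\<close> and in units of \<open>t powr (- s)\<close>, the
  self-interaction contributes \<open>- 2 * q\<close>, the field at most \<open>q / 2\<close> and
  the distant mass at most \<open>q\<close>. The total is negative.\<close>

lemma no_atom_at_origin:
  assumes r0: "r = 0" and mass: "measure \<mu> (sphere 0 r) > 0"
    and fin: "\<And>\<rho>. \<rho> > 0 \<Longrightarrow> \<bar>v \<rho>\<bar> \<noteq> \<infinity>"
    and growth: "\<And>\<eta>. \<eta> > 0 \<Longrightarrow> \<exists>\<epsilon>>0. \<forall>\<rho>. 0 < \<rho> \<and> \<rho> < \<epsilon> \<longrightarrow>
      real_of_ereal (v \<rho>) - real_of_ereal (v 0) \<le> \<eta> * \<rho> powr (- s / 2)"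
  shows False
proof -
  define m where "m = measure \<mu> (sphere 0 r)"
  have m: "m > 0" using mass by (simp add: m_def)
  have s0: "s < 0" using r r0 by simp
  define q where "q = m / (- s)"
  have q: "q > 0" using m s0 by (simp add: q_def divide_pos_neg)
  obtain \<epsilon> where \<epsilon>: "\<epsilon> > 0" "\<And>\<rho>. 0 < \<rho> \<Longrightarrow> \<rho> < \<epsilon> \<Longrightarrow>
      real_of_ereal (v \<rho>) - real_of_ereal (v 0) \<le> q / 4 * \<rho> powr (- s / 2)"
    using growth[of "q / 4"] q by auto
  \<comment> \<open>\<open>t < 1\<close> and \<open>s \<ge> -1\<close> give
    \<open>t \<le> t powr (- s)\<close>, and the last bound gives
    \<open>far_const * t \<le> q\<close>; their product bounds the distant term.\<close>
  define t where "t = min (min (\<delta> / 2) (min 1 \<epsilon> / 2)) (q / (far_const + 1))"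
  have t: "t > 0" "t \<le> \<delta> / 2" "t < 1" "t < \<epsilon>" "t \<le> q / (far_const + 1)"
  proof -
    have "q / (far_const + 1) > 0" using q far_const_nonneg by (intro divide_pos_pos) auto
    then show "t > 0" using \<delta> \<epsilon>(1) by (simp add: t_def)
    show "t \<le> \<delta> / 2" "t \<le> q / (far_const + 1)"
      unfolding t_def min_le_iff_disj by (simp_all only: order_refl simp_thms)
    have "t \<le> min 1 \<epsilon> / 2" unfolding t_def min_le_iff_disj by (simp only: order_refl simp_thms)
    then show "t < 1" "t < \<epsilon>" using \<epsilon>(1) by linarith+
  qed
  define D where "D = field_shift t + field_shift (- t) - 2 * field_shift 0"
  \<comment> \<open>For \<open>x = y = 0\<close> the kernel part of the second difference is
    \<open>2 * riesz_sq s (t\<^sup>2)\<close>, as \<open>riesz_sq s 0 = 0\<close>; the nonnegative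
    distant term is kept there as well.\<close>
  define U :: "'a \<times> 'a \<Rightarrow> real" where "U = (\<lambda>z. (D + far_const * t\<^sup>2) * indicator (UNIV \<times> sphere 0 r) z +
    2 * riesz_sq s (t\<^sup>2) * indicator (sphere 0 r \<times> sphere 0 r) z)"
  have meas: "UNIV \<times> sphere 0 r \<in> sets (\<mu> \<Otimes>\<^sub>M \<mu>)" "sphere 0 r \<times> sphere 0 r \<in> sets (\<mu> \<Otimes>\<^sub>M \<mu>)"
    using pair_measureI[OF sets.top sphere_sets, of \<mu>] by (simp_all add: space_\<mu> pair_measureI)
  have int: "integrable (\<mu> \<Otimes>\<^sub>M \<mu>) (indicat_real (UNIV \<times> sphere 0 r))"
    "integrable (\<mu> \<Otimes>\<^sub>M \<mu>) (indicat_real (sphere 0 r \<times> sphere 0 r))"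
    using meas by (auto simp: \<mu>\<mu>.emeasure_eq_measure)
  have "0 \<le> (\<integral>z. U z \<partial>(\<mu> \<Otimes>\<^sub>M \<mu>))"
  proof (rule second_variation[OF t(1,2)])
    show "integrable (\<mu> \<Otimes>\<^sub>M \<mu>) U" unfolding U_def
      using int by (intro Bochner_Integration.integrable_add integrable_mult_right)
    fix x y :: 'a
    show "norm y \<noteq> r \<Longrightarrow> 0 \<le> U (x, y)" by (simp add: U_def)
    show "norm x \<noteq> r \<Longrightarrow> norm y = r \<Longrightarrow>
      field_shift t + field_shift (- t) - 2 * field_shift 0 + far_const * t\<^sup>2 \<le> U (x, y)"
      by (simp add: U_def D_def)
    show "field_shift t + field_shift (- t) - 2 * field_shift 0 + riesz_pair s x (shift r e t y)
      + riesz_pair s x (shift r e (- t) y) - 2 * riesz_pair s x y \<le> U (x, y)"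
      if "norm x = r" "norm y = r"
    proof -
      have "norm (shift r e c y) = \<bar>c\<bar>" "x = 0" for c
        using that r0 norm_shift[OF e that(2)] by auto
      then show ?thesis using that r0 s0 far_const_nonneg t by (simp add: U_def D_def riesz_sq_def)
    qed
  qed (use t r0 fin in auto)
  also have "(\<integral>z. U z \<partial>(\<mu> \<Otimes>\<^sub>M \<mu>)) = (D + far_const * t\<^sup>2) * m + 2 * riesz_sq s (t\<^sup>2) * (m * m)"
  proof -
    have "measure (\<mu> \<Otimes>\<^sub>M \<mu>) (UNIV \<times> sphere 0 r) = m"
      using measure_Times[OF sets.top sphere_sets] \<mu>.prob_space by (simp add: m_def space_\<mu>)
    moreover have "measure (\<mu> \<Otimes>\<^sub>M \<mu>) (sphere 0 r \<times> sphere 0 r) = m * m"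
      using measure_Times[OF sphere_sets sphere_sets] by (simp add: m_def)
    ultimately show ?thesis unfolding U_def using int meas
      by (subst Bochner_Integration.integral_add) (auto intro: integrable_mult_right)
  qed
  also have "\<dots> = m * (D + far_const * t\<^sup>2 + 2 * m * riesz_sq s (t\<^sup>2))" by (simp add: algebra_simps)
  finally have "0 \<le> D + far_const * t\<^sup>2 + 2 * m * riesz_sq s (t\<^sup>2)" using m by (simp add: zero_le_mult_iff)
  moreover have "m * riesz_sq s (t\<^sup>2) = - q * (t\<^sup>2) powr (- s / 2)"
    using s0 by (simp add: riesz_sq_def q_def)
  moreover have "D \<le> q / 2 * (t\<^sup>2) powr (- s / 2)"
  proof -
    have "t * t \<le> t" using t by (intro mult_left_le) auto
    then have "t\<^sup>2 < \<epsilon>" unfolding power2_eq_square using t by linarith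
    then have "real_of_ereal (v (t\<^sup>2)) - real_of_ereal (v 0) \<le> q / 4 * (t\<^sup>2) powr (- s / 2)"
      using \<epsilon>(2)[of "t\<^sup>2"] t by simp
    then show ?thesis using r0 by (simp add: D_def)
  qed
  moreover have "far_const * t\<^sup>2 \<le> q * (t\<^sup>2) powr (- s / 2)"
  proof -
    have "(t\<^sup>2) powr (- s / 2) = t powr (- s)"
      using t by (simp add: powr_powr flip: powr_numeral)
    also have "\<dots> \<ge> t powr 1" using t s s0 by (intro powr_mono') auto
    finally have "t \<le> (t\<^sup>2) powr (- s / 2)" using t by simp
    moreover have "far_const * t \<le> q"
    proof -
      have "far_const * t \<le> (far_const + 1) * t" using t by (intro mult_right_mono) auto
      also have "\<dots> \<le> (far_const + 1) * (q / (far_const + 1))"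
        using t far_const_nonneg by (intro mult_left_mono) auto
      also have "\<dots> = q" using far_const_nonneg by simp
      finally show ?thesis .
    qed
    ultimately have "far_const * t * t \<le> q * (t\<^sup>2) powr (- s / 2)"
      using t q by (intro mult_mono) auto
    then show ?thesis by (simp add: power2_eq_square mult.assoc)
  qed
  ultimately have "0 \<le> - (q / 2) * (t\<^sup>2) powr (- s / 2)" by linarith
  moreover have "(t\<^sup>2) powr (- s / 2) > 0" using t by simp
  ultimately show False using q by (simp add: zero_le_mult_iff mult_le_0_iff)
qed

text \<open>Divided by \<open>t\<^sup>2\<close>, minimality bounds the integral of
  \<open>((N z)\<^sup>2 + t\<^sup>2) powr (- \<beta>)\<close> over pairs on the sphere by a constant
  \<open>B\<close> independent of \<open>t\<close>, while the estimate \<open>caps\<close> makes it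
  unbounded.\<close>

lemma no_isolated_sphere:
  assumes r0: "r > 0"
    and fin: "\<And>\<rho>. \<rho> > 0 \<Longrightarrow> \<bar>v \<rho>\<bar> \<noteq> \<infinity>"
    and smooth: "\<epsilon> > 0" "\<And>t. \<bar>t\<bar> \<le> \<epsilon> \<Longrightarrow> field_shift t + field_shift (- t) - 2 * field_shift 0 \<le> C * t\<^sup>2"
    and caps: "c > 0" "\<And>\<rho>. 0 < \<rho> \<Longrightarrow> \<rho> \<le> 1 \<Longrightarrow>
      c * \<rho> ^ k \<le> measure (\<mu> \<Otimes>\<^sub>M \<mu>) {z \<in> sphere 0 r \<times> sphere 0 r. norm (fst z - snd z) < \<rho>}"
    and k: "k \<ge> 1" "real k \<le> s + 2"
  shows False
proof -
  define W where "W = \<bar>field_shift 0\<bar>"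
  define K0 where "K0 = (s / 2 + 1) / 2 * 2 powr (s / 2 + 2) / r\<^sup>2 * (\<bar>s\<bar> + 1)"
  define K where "K = K0 * (1 + 2 * W)"
  have K0: "K0 \<ge> 0" using s by (simp add: K0_def)
  have W: "W \<ge> 0" unfolding W_def by (rule abs_ge_zero)
  have K: "K \<ge> 0" unfolding K_def using K0 W by (intro mult_nonneg_nonneg) auto
  define H where "H = (\<lambda>z :: 'a \<times> 'a. \<bar>real_of_ereal (interaction s v z)\<bar>)"
  have H: "integrable (\<mu> \<Otimes>\<^sub>M \<mu>) H" unfolding H_def using integrable by (rule integrable_abs)
  have H0: "H z \<ge> 0" for z unfolding H_def by (rule abs_ge_zero)
  define A where "A = sphere (0 :: 'a) r \<times> sphere (0 :: 'a) r"
  have A [measurable]: "A \<in> sets (\<mu> \<Otimes>\<^sub>M \<mu>)" unfolding A_def by (intro pair_measureI sphere_sets)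
  define N where "N = (\<lambda>z :: 'a \<times> 'a. norm (fst z - snd z))"
  have N [measurable]: "N \<in> borel_measurable (\<mu> \<Otimes>\<^sub>M \<mu>)" unfolding N_def by measurable
  \<comment> \<open>Contributions of the field, of the distant mass and of the convexity error, each
    divided by \<open>t\<^sup>2\<close>.\<close>
  define B where "B = \<bar>C\<bar> + far_const + K * (1 + (\<integral>z. H z \<partial>(\<mu> \<Otimes>\<^sub>M \<mu>)))"
  define \<beta> where "\<beta> = s / 2 + 1"
  have \<beta>: "\<beta> > 0" using s by (simp add: \<beta>_def)
  define t0 where "t0 = min \<epsilon> (min (\<delta> / 2) (r / 2))"
  have t0: "t0 > 0" using smooth(1) \<delta> r0 by (simp add: t0_def)
  have "(\<integral>z. indicator A z * ((N z)\<^sup>2 + t\<^sup>2) powr (- \<beta>) \<partial>(\<mu> \<Otimes>\<^sub>M \<mu>)) \<le> B" if t: "0 < t" "t \<le> t0" for t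
  proof -
    have t': "t \<le> \<epsilon>" "t \<le> \<delta> / 2" "t \<le> r / 2" using t by (auto simp: t0_def)
    define G where "G = (\<lambda>z. indicator A z * ((N z)\<^sup>2 + t\<^sup>2) powr (- \<beta>))"
    have G: "integrable (\<mu> \<Otimes>\<^sub>M \<mu>) G"
    proof (rule \<mu>\<mu>.integrable_const_bound[where B = "(t\<^sup>2) powr (- \<beta>)"])
      have "norm (G z) \<le> (t\<^sup>2) powr (- \<beta>)" for z
        using t \<beta> by (auto simp: G_def indicator_def intro!: powr_mono2')
      then show "AE z in \<mu> \<Otimes>\<^sub>M \<mu>. norm (G z) \<le> (t\<^sup>2) powr (- \<beta>)" by simp
    qed (simp add: G_def)
    \<comment> \<open>One formula for all cases: unless both points lie on the sphere
      \<open>G\<close> vanishes, and the surplus terms are nonnegative.\<close>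
    define U where "U = (\<lambda>z. t\<^sup>2 * (\<bar>C\<bar> + far_const + K * (1 + H z)) - t\<^sup>2 * G z)"
    have D: "field_shift t + field_shift (- t) - 2 * field_shift 0 \<le> t\<^sup>2 * \<bar>C\<bar>"
    proof -
      have "field_shift t + field_shift (- t) - 2 * field_shift 0 \<le> C * t\<^sup>2"
        using t t' by (intro smooth(2)) auto
      also have "\<dots> \<le> \<bar>C\<bar> * t\<^sup>2" by (intro mult_right_mono) auto
      finally show ?thesis by (simp only: mult.commute)
    qed
    have KH: "0 \<le> t\<^sup>2 * (K * (1 + H z))" for z
      using K H0[of z] by (intro mult_nonneg_nonneg add_nonneg_nonneg) auto
    have far0: "0 \<le> t\<^sup>2 * far_const" by (rule mult_nonneg_nonneg[OF zero_le_power2 far_const_nonneg])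
    have "0 \<le> (\<integral>z. U z \<partial>(\<mu> \<Otimes>\<^sub>M \<mu>))"
    proof (rule second_variation[OF t(1) t'(2)])
      show "integrable (\<mu> \<Otimes>\<^sub>M \<mu>) U" unfolding U_def
        using H G by (intro Bochner_Integration.integrable_diff Bochner_Integration.integrable_add integrable_mult_right) auto
      fix x y :: 'a assume good: "good (x, y)"
      have U_off: "U (x, y) = t\<^sup>2 * \<bar>C\<bar> + t\<^sup>2 * far_const + t\<^sup>2 * (K * (1 + H (x, y)))"
        if "norm x \<noteq> r \<or> norm y \<noteq> r"
        using that by (auto simp: U_def G_def A_def algebra_simps)
      show "0 \<le> U (x, y)" if "norm y \<noteq> r"
        using that KH[of "(x, y)"] far0 by (subst U_off) auto
      show "field_shift t + field_shift (- t) - 2 * field_shift 0 + far_const * t\<^sup>2 \<le> U (x, y)"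
        if "norm x \<noteq> r" "norm y = r"
        using that KH[of "(x, y)"] D by (subst U_off) (auto simp: mult.commute)
      show "field_shift t + field_shift (- t) - 2 * field_shift 0 + riesz_pair s x (shift r e t y)
        + riesz_pair s x (shift r e (- t) y) - 2 * riesz_pair s x y \<le> U (x, y)"
        if xy: "norm x = r" "norm y = r"
      proof -
        have ne: "x \<noteq> y \<or> s < 0" and fld: "\<bar>radial_field v x\<bar> \<noteq> \<infinity>" "\<bar>radial_field v y\<bar> \<noteq> \<infinity>"
          using good by (auto simp: good_def)
        have second: "riesz_pair s x (shift r e t y) + riesz_pair s x (shift r e (- t) y) - 2 * riesz_pair s x y
          \<le> K0 * (1 + \<bar>riesz_pair s x y\<bar>) * t\<^sup>2 - t\<^sup>2 * ((norm (x - y))\<^sup>2 + t\<^sup>2) powr (- \<beta>)"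
          unfolding K0_def \<beta>_def using s by (intro sphere_second_difference r0 t t' xy ne) auto
        have "real_of_ereal (interaction s v (x, y)) = riesz_pair s x y + 2 * field_shift 0"
          using xy by (subst interaction_eq[OF fld ne]) (simp add: radial_field_def)
        then have "\<bar>riesz_pair s x y\<bar> \<le> H (x, y) + 2 * W" unfolding H_def W_def by linarith
        moreover have "(1 + 2 * W) * (1 + H (x, y)) = 1 + 2 * W + H (x, y) + 2 * (W * H (x, y))"
          by (simp add: algebra_simps)
        ultimately have "1 + \<bar>riesz_pair s x y\<bar> \<le> (1 + 2 * W) * (1 + H (x, y))"
          using mult_nonneg_nonneg[OF W H0[of "(x, y)"]] by linarith
        then have "K0 * (1 + \<bar>riesz_pair s x y\<bar>) * t\<^sup>2 \<le> K0 * ((1 + 2 * W) * (1 + H (x, y))) * t\<^sup>2"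
          using K0 by (intro mult_right_mono mult_left_mono) auto
        also have "\<dots> = t\<^sup>2 * (K * (1 + H (x, y)))" by (simp add: K_def)
        finally have "field_shift t + field_shift (- t) - 2 * field_shift 0 + riesz_pair s x (shift r e t y)
          + riesz_pair s x (shift r e (- t) y) - 2 * riesz_pair s x y
          \<le> t\<^sup>2 * \<bar>C\<bar> + t\<^sup>2 * far_const + t\<^sup>2 * (K * (1 + H (x, y))) - t\<^sup>2 * ((norm (x - y))\<^sup>2 + t\<^sup>2) powr (- \<beta>)"
          using second D far0 by linarith
        also have "\<dots> = U (x, y)"
          using xy by (simp add: U_def G_def A_def N_def distrib_left)
        finally show ?thesis .
      qed
    qed (use t t' r0 fin in auto)
    also have "(\<integral>z. U z \<partial>(\<mu> \<Otimes>\<^sub>M \<mu>)) = t\<^sup>2 * (B - (\<integral>z. G z \<partial>(\<mu> \<Otimes>\<^sub>M \<mu>)))"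
      using H G \<mu>\<mu>.prob_space by (simp add: U_def B_def right_diff_distrib)
    finally have "0 \<le> B - (\<integral>z. G z \<partial>(\<mu> \<Otimes>\<^sub>M \<mu>))" using t by (simp add: zero_le_mult_iff)
    then show ?thesis by (simp add: G_def)
  qed
  then show False
    using caps k t0 by (intro \<mu>\<mu>.unbounded_truncated_energy[of N A c k \<beta> t0 B])
      (auto simp: A_def N_def \<beta>_def intro!: borel_measurable_norm)
qed

end

section \<open>Supports and radial measures\<close>

text \<open>The complement of the support is covered by the null members of a countable
  basis.\<close>

lemma AE_msupp:
  fixes \<nu> :: "'a::second_countable_topology measure"
  assumes "X \<in> sets borel" and sets: "sets \<nu> = sets (restrict_space borel X)"
  shows "AE x in \<nu>. x \<in> msupp \<nu>"
proof -
  have space: "space \<nu> = X" using sets_eq_imp_space_eq[OF sets] by (simp add: space_restrict_space)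
  obtain B :: "'a set set" where B: "countable B" "topological_basis B"
    using ex_countable_basis by blast
  define N where "N = {U \<in> B. emeasure \<nu> (U \<inter> space \<nu>) = 0}"
  have Bsets: "U \<inter> space \<nu> \<in> sets \<nu>" if "U \<in> B" for U
    using topological_basis_open[OF B(2) that] unfolding sets space sets_restrict_space by auto
  have "(\<Union>U\<in>N. U \<inter> space \<nu>) \<in> null_sets \<nu>"
    using B(1) Bsets by (intro null_sets_UN') (auto simp: N_def null_sets_def)
  moreover have "{x \<in> space \<nu>. x \<notin> msupp \<nu>} \<subseteq> (\<Union>U\<in>N. U \<inter> space \<nu>)"
  proof
    fix x assume "x \<in> {x \<in> space \<nu>. x \<notin> msupp \<nu>}"
    then obtain U where U: "x \<in> space \<nu>" "open U" "x \<in> U" "emeasure \<nu> (U \<inter> space \<nu>) = 0"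
      by (auto simp: msupp_def zero_less_iff_neq_zero)
    obtain V where V: "V \<in> B" "x \<in> V" "V \<subseteq> U" using topological_basisE[OF B(2) U(2,3)] by blast
    have "U \<inter> space \<nu> \<in> sets \<nu>" using U(2) unfolding sets space sets_restrict_space by auto
    then have "emeasure \<nu> (V \<inter> space \<nu>) \<le> emeasure \<nu> (U \<inter> space \<nu>)"
      using V by (intro emeasure_mono) auto
    then show "x \<in> (\<Union>U\<in>N. U \<inter> space \<nu>)" using U V by (auto simp: N_def)
  qed
  ultimately show ?thesis by (rule AE_I')
qed

lemma closed_msupp:
  assumes "closed (space \<nu>)"
  shows "closed (msupp \<nu>)"
proof -
  define W where "W = \<Union>{U. open U \<and> emeasure \<nu> (U \<inter> space \<nu>) = 0}"
  have "msupp \<nu> = space \<nu> \<inter> - W"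
    by (auto simp: msupp_def W_def zero_less_iff_neq_zero)
  moreover have "open W" unfolding W_def by blast
  ultimately show ?thesis using assms by (simp add: closed_Int closed_Compl)
qed

text \<open>A neighbourhood meeting the support only in \<open>r\<close> agrees with
  \<open>{r}\<close> up to a null set, so its positive mass sits at \<open>r\<close>.\<close>

lemma isolated_atom:
  fixes \<nu> :: "real measure"
  assumes X: "closed X" and sets: "sets \<nu> = sets (restrict_space borel X)" and r: "r isolated_in msupp \<nu>"
  obtains \<delta> where "\<delta> > 0" "emeasure \<nu> {r} > 0" "AE x in \<nu>. x = r \<or> \<delta> \<le> \<bar>x - r\<bar>" "r \<in> X"
proof -
  have space: "space \<nu> = X" using sets_eq_imp_space_eq[OF sets] by (simp add: space_restrict_space)
  have supp: "AE x in \<nu>. x \<in> msupp \<nu>" by (rule AE_msupp[OF _ sets]) (simp add: X)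
  obtain U where U: "r \<in> msupp \<nu>" "open U" "U \<inter> msupp \<nu> = {r}"
    using r by (auto simp: isolated_in_def)
  then have rU: "r \<in> U" by auto
  obtain \<delta> where \<delta>: "\<delta> > 0" "ball r \<delta> \<subseteq> U" using openE[OF U(2) rU] by blast
  have rX: "r \<in> X" using U(1) by (simp add: msupp_def space)
  have U_sets: "U \<inter> space \<nu> \<in> sets \<nu>" using U(2) unfolding sets space sets_restrict_space by auto
  have r_sets: "{r} \<in> sets \<nu>" using rX unfolding sets sets_restrict_space by (auto intro!: image_eqI[of _ _ "{r}"])
  have "AE x in \<nu>. x \<in> U \<inter> space \<nu> \<longleftrightarrow> x \<in> {r}"
    using supp by eventually_elim (use U rU rX space in auto)
  then have "emeasure \<nu> (U \<inter> space \<nu>) = emeasure \<nu> {r}"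
    by (intro emeasure_eq_AE U_sets r_sets)
  then have "emeasure \<nu> {r} > 0" using U(1,2) rU by (auto simp: msupp_def)
  moreover have "AE x in \<nu>. x = r \<or> \<delta> \<le> \<bar>x - r\<bar>"
    using supp
  proof eventually_elim
    case (elim x)
    show ?case
    proof (cases "x \<in> ball r \<delta>")
      case True
      then show ?thesis using \<delta> U elim by auto
    qed (auto simp: dist_real_def)
  qed
  ultimately show thesis using \<delta>(1) rX that by blast
qed

section \<open>Measures in polar coordinates and their mass near the diagonal\<close>

locale radial =
  fixes \<nu> :: "real measure"
  assumes \<nu>: "\<nu> \<in> borel_probs {0..}"
begin

sublocale \<nu>: prob_space \<nu> using \<nu> by (simp add: borel_probs_def)

lemma sets_\<nu>: "sets \<nu> = sets (restrict_space borel {0..})"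
  using \<nu> by (simp add: borel_probs_def)

lemma space_\<nu>: "space \<nu> = {0..}"
  using sets_eq_imp_space_eq[OF sets_\<nu>] by (simp add: space_restrict_space)

lemma borel_measurable_\<nu> [measurable]: "f \<in> borel_measurable borel \<Longrightarrow> f \<in> borel_measurable \<nu>"
  by (subst measurable_cong_sets[OF sets_\<nu> refl]) (rule measurable_restrict_space1)

lemma singleton_sets_\<nu>: "r \<ge> 0 \<Longrightarrow> {r} \<in> sets \<nu>"
  unfolding sets_\<nu> sets_restrict_space by (auto intro!: image_eqI[of _ _ "{r}"])

lemma sets_unif_sphere [measurable_cong]: "sets (unif_sphere :: 'a::euclidean_space measure) = sets borel"
  by (simp add: unif_sphere_def)

sublocale \<sigma>: prob_space "unif_sphere :: 'a::euclidean_space measure"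
  by (rule prob_space_unif_sphere)

sublocale polar: pair_prob_space \<nu> "unif_sphere :: 'a::euclidean_space measure" ..

lemma polar_measurable [measurable]:
  "(\<lambda>z. fst z *\<^sub>R snd z) \<in> borel_measurable (\<nu> \<Otimes>\<^sub>M (unif_sphere :: 'a::euclidean_space measure))"
proof -
  have [measurable]: "(\<lambda>z. fst z) \<in> borel_measurable (\<nu> \<Otimes>\<^sub>M (unif_sphere :: 'a measure))"
    by (rule measurable_compose[OF measurable_fst borel_measurable_\<nu>]) simp
  show ?thesis by measurable
qed

lemma radial_measure_eq:
  "radial_measure \<nu> = distr (\<nu> \<Otimes>\<^sub>M (unif_sphere :: 'a::euclidean_space measure)) borel (\<lambda>z. fst z *\<^sub>R snd z)"
  unfolding radial_measure_def by (rule arg_cong[where f = "distr _ _"]) auto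

lemma radial_measure_borel_probs: "(radial_measure \<nu> :: 'a::euclidean_space measure) \<in> borel_probs UNIV"
  unfolding borel_probs_UNIV radial_measure_eq by (auto intro!: polar.P.prob_space_distr)

lemma AE_radial_measure:
  fixes P :: "real \<Rightarrow> bool"
  assumes [measurable]: "Measurable.pred borel P" and P: "AE x in \<nu>. P x"
  shows "AE x in (radial_measure \<nu> :: 'a::euclidean_space measure). P (norm x)"
proof -
  have "AE z in \<nu> \<Otimes>\<^sub>M (unif_sphere :: 'a measure). P (norm (fst z *\<^sub>R snd z))"
  proof (rule polar.AE_pair_measure)
    show "{z \<in> space (\<nu> \<Otimes>\<^sub>M (unif_sphere :: 'a measure)). P (norm (fst z *\<^sub>R snd z))} \<in> sets (\<nu> \<Otimes>\<^sub>M unif_sphere)"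
      by measurable
    have "AE x in \<nu>. x \<ge> 0" using AE_space by eventually_elim (simp add: space_\<nu>)
    with P show "AE x in \<nu>. AE y in (unif_sphere :: 'a measure). P (norm (fst (x, y) *\<^sub>R snd (x, y)))"
    proof eventually_elim
      case (elim x)
      show ?case using AE_unif_sphere by eventually_elim (use elim in simp)
    qed
  qed
  then show ?thesis unfolding radial_measure_eq by (subst AE_distr_iff) auto
qed

text \<open>Keeps only the slice of the product measure at radius \<open>r\<close>. Testing
  \<open>sub\<close> on unit vectors suffices, as \<open>unif_sphere\<close> is a measure on the
  whole space carried by the sphere.\<close>

lemma radial_measure_cap:
  fixes x :: "'a::euclidean_space"
  assumes r: "r \<ge> 0" and A: "A \<in> sets borel" "B \<in> sets borel"
    and sub: "\<And>\<theta>. norm \<theta> = 1 \<Longrightarrow> \<theta> \<in> A \<Longrightarrow> r *\<^sub>R \<theta> \<in> B"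
  shows "measure \<nu> {r} * measure (unif_sphere :: 'a measure) A \<le> measure (radial_measure \<nu> :: 'a measure) B"
proof -
  have S: "A \<inter> sphere 0 1 \<in> sets (unif_sphere :: 'a measure)" using A(1) by (simp add: sets_unif_sphere borel_closed)
  have "AE \<theta> in (unif_sphere :: 'a measure). \<theta> \<in> A \<longleftrightarrow> \<theta> \<in> A \<inter> sphere 0 1"
    using AE_unif_sphere by eventually_elim auto
  then have "measure (unif_sphere :: 'a measure) A = measure unif_sphere (A \<inter> sphere 0 1)"
    using S A(1) by (intro measure_eq_AE) (auto simp: sets_unif_sphere)
  then have "measure \<nu> {r} * measure (unif_sphere :: 'a measure) A = measure (\<nu> \<Otimes>\<^sub>M unif_sphere) ({r} \<times> (A \<inter> sphere 0 1))"
    using singleton_sets_\<nu>[OF r] S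
    by (simp add: measure_def \<sigma>.emeasure_pair_measure_Times enn2real_mult)
  also have "\<dots> \<le> measure (\<nu> \<Otimes>\<^sub>M unif_sphere)
      ((\<lambda>z. fst z *\<^sub>R snd z) -` B \<inter> space (\<nu> \<Otimes>\<^sub>M (unif_sphere :: 'a measure)))"
  proof (rule polar.P.finite_measure_mono)
    show "{r} \<times> (A \<inter> sphere 0 1) \<subseteq> (\<lambda>z. fst z *\<^sub>R snd z) -` B \<inter> space (\<nu> \<Otimes>\<^sub>M (unif_sphere :: 'a measure))"
      using r sub by (auto simp: space_pair_measure space_\<nu> unif_sphere_def)
    show "(\<lambda>z. fst z *\<^sub>R snd z) -` B \<inter> space (\<nu> \<Otimes>\<^sub>M (unif_sphere :: 'a measure)) \<in> sets (\<nu> \<Otimes>\<^sub>M unif_sphere)"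
      using A(2) polar_measurable by (rule measurable_sets[rotated])
  qed
  also have "\<dots> = measure (radial_measure \<nu> :: 'a measure) B"
    unfolding radial_measure_eq using A(2) polar_measurable by (subst measure_distr) auto
  finally show ?thesis .
qed

text \<open>Around each \<open>x\<close> on the sphere the points within \<rho> contain a scaled
  cap, of mass at least \<open>c' * \<rho> ^ k\<close>; integration over \<open>x\<close> on the
  sphere gives another factor \<open>m\<close>.\<close>

lemma radial_measure_near_diagonal:
  fixes r :: real
  defines "\<mu> \<equiv> (radial_measure \<nu> :: (real ^ 'n) measure)"
  assumes r: "r > 0" and atom: "measure \<nu> {r} > 0"
  shows "\<exists>c>0. \<forall>\<rho>. 0 < \<rho> \<longrightarrow> \<rho> \<le> 1 \<longrightarrow> c * \<rho> ^ (CARD('n) - 1) \<le>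
    measure (\<mu> \<Otimes>\<^sub>M \<mu>) {z \<in> sphere 0 r \<times> sphere 0 r. norm (fst z - snd z) < \<rho>}"
proof -
  define k where "k = CARD('n) - 1"
  define m where "m = measure \<nu> {r}"
  have m: "m > 0" using atom by (simp add: m_def)
  interpret \<mu>: prob_space \<mu> using radial_measure_borel_probs[where 'a = "real ^ 'n"] by (simp add: \<mu>_def borel_probs_UNIV)
  interpret \<mu>\<mu>: pair_prob_space \<mu> \<mu> ..
  have sets\<mu> [measurable_cong]: "sets \<mu> = sets borel"
    using radial_measure_borel_probs[where 'a = "real ^ 'n"] by (simp add: \<mu>_def borel_probs_UNIV)
  obtain c where c: "c > 0" "\<And>(\<theta> :: real ^ 'n) \<rho>. norm \<theta> = 1 \<Longrightarrow> 0 < \<rho> \<Longrightarrow> \<rho> \<le> 1 \<Longrightarrow>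
      c * \<rho> ^ k \<le> measure unif_sphere (ball \<theta> \<rho>)"
    using unif_sphere_cap[where 'n = 'n] unfolding k_def by blast
  \<comment> \<open>A cap of radius \<open>q * \<rho>\<close> on the unit sphere, scaled by
    \<open>r\<close>, stays within \<rho>, and \<open>q * \<rho> \<le> 1\<close> keeps it in the
    range of the cap estimate.\<close>
  define q where "q = min 1 (1 / r)"
  have q: "0 < q" "q \<le> 1" "q * r \<le> 1" using r by (auto simp: q_def min_def field_simps)
  define c' where "c' = m * c * q ^ k"
  have c': "c' > 0" using m c q by (simp add: c'_def)
  have sphere: "m \<le> measure \<mu> (sphere 0 r)"
  proof -
    have "m * measure (unif_sphere :: (real ^ 'n) measure) UNIV \<le> measure \<mu> (sphere 0 r)"
      unfolding m_def \<mu>_def using r by (intro radial_measure_cap) (auto simp: borel_closed)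
    then show ?thesis using \<sigma>.prob_space[where 'a = "real ^ 'n"] by (simp add: unif_sphere_def)
  qed
  have cap: "c' * \<rho> ^ k \<le> measure \<mu> (sphere 0 r \<inter> ball x \<rho>)"
    if \<rho>: "0 < \<rho>" "\<rho> \<le> 1" and x: "norm x = r" for x \<rho>
  proof -
    define \<theta> where "\<theta> = (1 / r) *\<^sub>R x"
    have \<theta>: "norm \<theta> = 1" "x = r *\<^sub>R \<theta>" using r x by (auto simp: \<theta>_def)
    have "q * \<rho> \<le> 1" using q \<rho> mult_mono[of q 1 \<rho> 1] by simp
    then have "m * (c * (q * \<rho>) ^ k) \<le> m * measure unif_sphere (ball \<theta> (q * \<rho>))"
      using q \<rho> m by (intro mult_left_mono c(2) \<theta>) auto
    also have "\<dots> \<le> measure \<mu> (sphere 0 r \<inter> ball x \<rho>)"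
      unfolding m_def \<mu>_def
    proof (rule radial_measure_cap)
      fix y :: "real ^ 'n" assume y: "norm y = 1" "y \<in> ball \<theta> (q * \<rho>)"
      have "dist x (r *\<^sub>R y) = r * dist \<theta> y"
        using r unfolding \<theta>(2) dist_norm by (simp flip: scaleR_diff_right)
      also have "\<dots> < r * (q * \<rho>)" using y r by simp
      also have "\<dots> \<le> \<rho>" using q(3) \<rho> mult_right_mono[of "q * r" 1 \<rho>] by (simp add: mult_ac)
      finally show "r *\<^sub>R y \<in> sphere 0 r \<inter> ball x \<rho>" using y r by simp
    qed (use r in \<open>auto simp: borel_closed borel_open\<close>)
    finally show ?thesis by (simp add: c'_def power_mult_distrib mult_ac)
  qed
  have "m * c' * \<rho> ^ k \<le> measure (\<mu> \<Otimes>\<^sub>M \<mu>) {z \<in> sphere 0 r \<times> sphere 0 r. norm (fst z - snd z) < \<rho>}"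
    if \<rho>: "0 < \<rho>" "\<rho> \<le> 1" for \<rho>
  proof -
    define Z where "Z = {z \<in> sphere (0 :: real ^ 'n) r \<times> sphere 0 r. norm (fst z - snd z) < \<rho>}"
    have S [measurable]: "sphere (0 :: real ^ 'n) r \<in> sets borel" by (simp add: borel_closed)
    have Z [measurable]: "Z \<in> sets (\<mu> \<Otimes>\<^sub>M \<mu>)"
    proof -
      have "Z = {z \<in> space (\<mu> \<Otimes>\<^sub>M \<mu>). norm (fst z) = r \<and> norm (snd z) = r \<and> norm (fst z - snd z) < \<rho>}"
        using sets_eq_imp_space_eq[OF sets\<mu>] by (auto simp: Z_def space_pair_measure)
      then show ?thesis by simp
    qed
    have "ennreal (c' * \<rho> ^ k) * emeasure \<mu> (sphere 0 r) = (\<integral>\<^sup>+ x. ennreal (c' * \<rho> ^ k) * indicator (sphere 0 r) x \<partial>\<mu>)"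
      by (rule nn_integral_cmult_indicator[symmetric]) (simp add: sets\<mu>)
    also have "\<dots> \<le> (\<integral>\<^sup>+ x. emeasure \<mu> (Pair x -` Z) \<partial>\<mu>)"
    proof (rule nn_integral_mono)
      fix x :: "real ^ 'n"
      show "ennreal (c' * \<rho> ^ k) * indicator (sphere 0 r) x \<le> emeasure \<mu> (Pair x -` Z)"
      proof (cases "norm x = r")
        case True
        have "Pair x -` Z = sphere 0 r \<inter> ball x \<rho>" using True by (auto simp: Z_def dist_norm)
        then show ?thesis using cap[OF \<rho> True] True by (simp add: \<mu>.emeasure_eq_measure ennreal_leI)
      qed (simp add: indicator_def)
    qed
    also have "\<dots> = emeasure (\<mu> \<Otimes>\<^sub>M \<mu>) Z" by (rule \<mu>.emeasure_pair_measure_alt[symmetric]) (rule Z)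
    finally have "c' * \<rho> ^ k * measure \<mu> (sphere 0 r) \<le> measure (\<mu> \<Otimes>\<^sub>M \<mu>) Z"
      using c' \<rho> by (simp add: \<mu>.emeasure_eq_measure \<mu>\<mu>.emeasure_eq_measure flip: ennreal_mult)
    moreover have "c' * \<rho> ^ k * m \<le> c' * \<rho> ^ k * measure \<mu> (sphere 0 r)"
      using c' \<rho> sphere by (intro mult_left_mono) auto
    ultimately show ?thesis by (simp add: Z_def mult_ac)
  qed
  then show ?thesis using c' m unfolding k_def by (intro exI[of _ "m * c'"]) auto
qed

end

section \<open>Properties of the given field and exclusion of isolated points\<close>

lemma radial_field_measurable:
  assumes "continuous_on {0..} v"
  shows "(radial_field v :: 'a::euclidean_space \<Rightarrow> ereal) \<in> borel_measurable borel"
proof (rule borel_measurable_continuous_onI)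
  show "continuous_on UNIV (radial_field v :: 'a \<Rightarrow> ereal)"
    unfolding radial_field_def[abs_def]
    by (rule continuous_on_compose2[OF assms]) (auto intro!: continuous_intros)
qed

text \<open>Distances on the sphere are at most \<open>2 * r\<close> and the kernel decreases. For
  \<open>s \<le> 0\<close> the kernel has no lower bound on the whole space, so the sphere serves as
  the set of positive mass on which \<open>unique_minimizer_integrable\<close> requires one.\<close>

lemma interaction_bounded_below_on_sphere:
  fixes x y :: "'a::euclidean_space"
  assumes c: "\<And>\<rho>. \<rho> \<ge> 0 \<Longrightarrow> ereal c \<le> v \<rho>" and xy: "norm x = r" "norm y = r"
  shows "ereal (- (\<bar>riesz_sq s ((2 * r)\<^sup>2)\<bar> + 2 * \<bar>c\<bar>)) \<le> interaction s v (x, y)"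
proof -
  have "ereal (- \<bar>riesz_sq s ((2 * r)\<^sup>2)\<bar>) \<le> riesz_kernel s (x - y)"
  proof (cases "x = y")
    case False
    have "norm (x - y) \<le> 2 * r" using norm_triangle_ineq4[of x y] xy by simp
    then have "(norm (x - y))\<^sup>2 \<le> (2 * r)\<^sup>2" by (intro power_mono) auto
    then have "riesz_sq s ((2 * r)\<^sup>2) \<le> riesz_pair s x y"
      using False by (intro riesz_sq_antimono) auto
    then show ?thesis using False by (subst riesz_kernel_eq_riesz_sq) auto
  qed (auto simp: riesz_kernel_def)
  moreover have "ereal (- \<bar>c\<bar>) \<le> radial_field v z" for z :: 'a
    unfolding radial_field_def by (rule order_trans[OF _ c]) auto
  ultimately have "ereal (- \<bar>riesz_sq s ((2 * r)\<^sup>2)\<bar>) + ereal (- \<bar>c\<bar>) + ereal (- \<bar>c\<bar>) \<le> interaction s v (x, y)"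
    unfolding interaction_def by (intro add_mono) auto
  moreover have "- (\<bar>riesz_sq s ((2 * r)\<^sup>2)\<bar> + 2 * \<bar>c\<bar>) = - \<bar>riesz_sq s ((2 * r)\<^sup>2)\<bar> + - \<bar>c\<bar> + - \<bar>c\<bar>"
    by simp
  ultimately show ?thesis by (simp only: plus_ereal.simps)
qed

theorem theorem1p1:
  fixes s :: real
    and v :: "real \<Rightarrow> ereal"
    and \<mu>eq :: "(real ^ 'n) measure"
    and \<nu> :: "real measure"
  assumes "2 \<le> CARD('n)"
    and "real CARD('n) - 3 \<le> s" and "s < real CARD('n)"
    and "lsc_on {0..} v" and "finite_on_some_interval v"
    and "bounded_below_on {0..} v"
    and "ext_Ck_on 2 {0..} v"
    and "\<forall>\<rho>>0. \<bar>(ext_deriv {0..} ^^ 2) v \<rho>\<bar> \<noteq> \<infinity>"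
    and "\<exists>!\<mu> :: (real ^ 'n) measure. equilibrium_measure s (radial_field v) \<mu>"
    and "equilibrium_measure s (radial_field v) \<mu>eq"
    and "CARD('n) = 2 \<and> - 1 \<le> s \<and> s < 0 \<longrightarrow>
      ((\<lambda>\<rho>. ereal (\<rho> powr (s / 2 + 1)) * ext_deriv {0..} v \<rho>) \<longlongrightarrow> 0) (at_right 0)"
    and "\<nu> \<in> borel_probs {0..}"
    and "\<mu>eq = radial_measure \<nu>"
  shows "perfect_set (msupp \<nu>)"
proof -
  note dim = assms(1-3) and smooth = assms(7) and finite_second = assms(8)
    and unique = assms(9) and eq = assms(10) and origin = assms(11) and radial = assms(13)
  interpret radial \<nu> by standard (rule assms(12))
  have False if isolated: "r isolated_in msupp \<nu>" for r
  proof -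
    obtain \<delta> where iso: "\<delta> > 0" "emeasure \<nu> {r} > 0" "AE x in \<nu>. x = r \<or> \<delta> \<le> \<bar>x - r\<bar>" "r \<ge> 0"
      using isolated_atom[OF closed_real_atLeast sets_\<nu> isolated] by auto
    have atom: "measure \<nu> {r} > 0" using iso(2) by (simp add: \<nu>.emeasure_eq_measure)
    obtain c where c: "\<And>\<rho>. \<rho> \<ge> 0 \<Longrightarrow> ereal c \<le> v \<rho>"
      using assms(6) by (auto simp: bounded_below_on_def)
    have low: "v \<rho> \<noteq> -\<infinity>" if "\<rho> \<ge> 0" for \<rho> using c[OF that] by auto
    have cont: "continuous_on {0..} v" by (rule ext_Ck_on_imp_continuous_on[OF smooth])
    note field = radial_field_measurable[OF cont, where 'a = "real ^ 'n"]
    have \<mu>: "\<mu>eq \<in> borel_probs UNIV"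
      and minimal: "\<And>Q :: (real ^ 'n) measure. Q \<in> borel_probs UNIV \<Longrightarrow>
        ereal_integral (\<mu>eq \<Otimes>\<^sub>M \<mu>eq) (interaction s v) \<le> ereal_integral (Q \<Otimes>\<^sub>M Q) (interaction s v)"
      using eq by (auto simp: equilibrium_measure_def riesz_energy_eq)
    have uniq: "Q = \<mu>eq" if "Q \<in> borel_probs UNIV" "\<And>R :: (real ^ 'n) measure. R \<in> borel_probs UNIV \<Longrightarrow>
        ereal_integral (Q \<Otimes>\<^sub>M Q) (interaction s v) \<le> ereal_integral (R \<Otimes>\<^sub>M R) (interaction s v)"
      for Q :: "(real ^ 'n) measure"
    proof -
      have "equilibrium_measure s (radial_field v) Q"
        using that by (auto simp: equilibrium_measure_def riesz_energy_eq)
      then show ?thesis using unique eq by blast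
    qed
    interpret \<mu>: prob_space \<mu>eq using \<mu> by (simp add: borel_probs_UNIV)
    interpret \<mu>\<mu>: pair_prob_space \<mu>eq \<mu>eq ..
    have sets\<mu>: "sets \<mu>eq = sets borel" using \<mu> by (simp add: borel_probs_UNIV)
    have sphere: "measure \<mu>eq (sphere 0 r) > 0"
    proof -
      have "measure \<nu> {r} * measure (unif_sphere :: (real ^ 'n) measure) UNIV \<le> measure \<mu>eq (sphere 0 r)"
        unfolding radial using iso(4) by (intro radial_measure_cap) (auto simp: borel_closed)
      then show ?thesis using atom \<sigma>.prob_space[where 'a = "real ^ 'n"] by (simp add: unif_sphere_def)
    qed
    note integrable = unique_minimizer_integrable[OF \<mu> borel_measurable_interaction[OF field] minimal uniq
        borel_closed[OF closed_sphere] sphere interaction_bounded_below_on_sphere[OF c]]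
    have fin: "AE z in \<mu>eq \<Otimes>\<^sub>M \<mu>eq. \<bar>interaction s v z\<bar> \<noteq> \<infinity>" by (rule integrable(1)) auto
    have int: "Bochner_Integration.integrable (\<mu>eq \<Otimes>\<^sub>M \<mu>eq) (\<lambda>z. real_of_ereal (interaction s v z))"
      by (rule integrable(2)) auto
    \<comment> \<open>Pairs on the sphere have positive measure, so the pair energy is finite at one
      of them. That pair yields finiteness of the field on the sphere and, if \<open>r = 0\<close>,
      also \<open>s < 0\<close>, as both points are then the origin.\<close>
    have "\<exists>z \<in> sphere (0 :: real ^ 'n) r \<times> sphere 0 r. \<bar>interaction s v z\<bar> \<noteq> \<infinity>"
    proof (rule ccontr)
      assume none: "\<not> (\<exists>z \<in> sphere (0 :: real ^ 'n) r \<times> sphere 0 r. \<bar>interaction s v z\<bar> \<noteq> \<infinity>)"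
      have "AE z in \<mu>eq \<Otimes>\<^sub>M \<mu>eq. z \<notin> sphere 0 r \<times> sphere 0 r"
        using fin
      proof eventually_elim
        case (elim z)
        show ?case
        proof
          assume z: "z \<in> sphere 0 r \<times> sphere 0 r"
          show False by (rule notE[OF none], rule bexI, rule elim, rule z)
        qed
      qed
      moreover have "sphere 0 r \<times> sphere 0 r \<in> sets (\<mu>eq \<Otimes>\<^sub>M \<mu>eq)"
        by (intro pair_measureI) (auto simp: sets\<mu> borel_closed)
      ultimately have "emeasure (\<mu>eq \<Otimes>\<^sub>M \<mu>eq) (sphere 0 r \<times> sphere 0 r) = 0"
        using AE_iff_null_sets by blast
      then show False using sphere
        by (subst (asm) \<mu>.emeasure_pair_measure_Times) (auto simp: sets\<mu> borel_closed \<mu>.emeasure_eq_measure)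
    qed
    then obtain x y :: "real ^ 'n" where xy: "norm x = r" "norm y = r" "\<bar>interaction s v (x, y)\<bar> \<noteq> \<infinity>" by auto
    have finite_field: "\<bar>v (r\<^sup>2)\<bar> \<noteq> \<infinity>"
      using interaction_finite(1)[OF low xy(3)] xy(1) by (simp add: radial_field_def)
    have neg: "r = 0 \<longrightarrow> s < 0" using interaction_finite(3)[OF low xy(3)] xy by auto
    \<comment> \<open>Any unit vector may serve as the direction of displacement at the
      origin.\<close>
    fix i :: 'n
    interpret isolated_sphere s v \<mu>eq r \<delta> "axis i 1"
    proof
      show "AE x in \<mu>eq. norm x = r \<or> \<delta> \<le> \<bar>norm x - r\<bar>"
        unfolding radial by (rule AE_radial_measure[OF _ iso(3)]) simp
    qed (use \<mu> field low minimal fin int dim iso neg finite_field in auto)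
    have fin0: "\<bar>v \<rho>\<bar> \<noteq> \<infinity>" and fin1: "\<bar>ext_deriv {0..} v \<rho>\<bar> \<noteq> \<infinity>" if "\<rho> > 0" for \<rho>
      using ext_Ck_on_imp_finite[OF smooth _ that, of 0] ext_Ck_on_imp_finite[OF smooth _ that, of 1] by auto
    have d0: "((\<lambda>x. real_of_ereal (v x)) has_real_derivative real_of_ereal (ext_deriv {0..} v \<rho>)) (at \<rho>)"
      if "\<rho> > 0" for \<rho>
      using ext_Ck_on_has_real_derivative[OF smooth _ that, of 0] fin1[OF that] by simp
    have d1: "((\<lambda>x. real_of_ereal (ext_deriv {0..} v x)) has_real_derivative
        real_of_ereal ((ext_deriv {0..} ^^ 2) v \<rho>)) (at \<rho>)" if "\<rho> > 0" for \<rho>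
      using ext_Ck_on_has_real_derivative[OF smooth _ that, of 1] finite_second that by (simp add: eval_nat_numeral)
    show False
    proof (cases "r = 0")
      case True
      \<comment> \<open>\<open>d - 3 \<le> s < 0\<close> leaves only \<open>d = 2\<close>, the case
        in which the condition on the derivative at 0 is available.\<close>
      then have s: "s < 0" "-1 \<le> s" "CARD('n) = 2" using neg dim by auto
      show False
      proof (rule no_atom_at_origin[OF True sphere fin0])
        fix \<eta> :: real assume \<eta>: "\<eta> > 0"
        have "(v \<longlongrightarrow> v 0) (at_right 0)"
          using cont by (simp add: continuous_on_def flip: at_within_Ici_at_right)
        then have lim0: "((\<lambda>x. real_of_ereal (v x)) \<longlongrightarrow> real_of_ereal (v 0)) (at_right 0)"
          using finite_field True by (intro lim_real_of_ereal) (simp add: ereal_real)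
        have "((\<lambda>\<rho>. ereal (\<rho> powr (s / 2 + 1)) * ext_deriv {0..} v \<rho>) \<longlongrightarrow> ereal 0) (at_right 0)"
          using origin s by (simp add: zero_ereal_def[symmetric])
        then have "((\<lambda>\<rho>. real_of_ereal (ereal (\<rho> powr (s / 2 + 1)) * ext_deriv {0..} v \<rho>)) \<longlongrightarrow> 0) (at_right 0)"
          by (rule lim_real_of_ereal)
        \<comment> \<open>The exponent \<open>s / 2 + 1\<close> is written as \<open>1 - p\<close>
          with \<open>p = - s / 2\<close> to fit \<open>growth_at_zero\<close>.\<close>
        then have lim1: "((\<lambda>\<rho>. \<rho> powr (1 - (- s / 2)) * real_of_ereal (ext_deriv {0..} v \<rho>)) \<longlongrightarrow> 0) (at_right 0)"
          by (simp add: add.commute)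
        show "\<exists>\<epsilon>>0. \<forall>\<rho>. 0 < \<rho> \<and> \<rho> < \<epsilon> \<longrightarrow>
            real_of_ereal (v \<rho>) - real_of_ereal (v 0) \<le> \<eta> * \<rho> powr (- s / 2)"
          by (rule growth_at_zero[OF _ \<eta> lim0 d0 lim1]) (use s in auto)
      qed
    next
      case False
      then have r: "r > 0" using iso(4) by simp
      have r2: "r\<^sup>2 > 0" using r by simp
      have "isCont (\<lambda>x. real_of_ereal ((ext_deriv {0..} ^^ 2) v x)) (r\<^sup>2)"
        using ext_Ck_on_isCont[OF smooth _ r2, of 2] finite_second r2 by auto
      then obtain C \<epsilon> where C: "\<epsilon> > 0" "\<And>t. \<bar>t\<bar> \<le> \<epsilon> \<Longrightarrow>
          real_of_ereal (v ((r + t)\<^sup>2)) + real_of_ereal (v ((r - t)\<^sup>2)) - 2 * real_of_ereal (v (r\<^sup>2)) \<le> C * t\<^sup>2"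
        using radial_second_difference[OF r d0 d1] by auto
      obtain c where caps: "c > 0" "\<And>\<rho>. 0 < \<rho> \<Longrightarrow> \<rho> \<le> 1 \<Longrightarrow> c * \<rho> ^ (CARD('n) - 1) \<le>
          measure (\<mu>eq \<Otimes>\<^sub>M \<mu>eq) {z \<in> sphere 0 r \<times> sphere 0 r. norm (fst z - snd z) < \<rho>}"
        using radial_measure_near_diagonal[OF r atom, where 'n = 'n] unfolding radial by blast
      \<comment> \<open>\<open>d - 3 \<le> s\<close> enters as \<open>d - 1 \<le> s + 2\<close>, the
        divergence condition for caps of exponent \<open>d - 1 \<ge> 1\<close>.\<close>
      show False
        by (rule no_isolated_sphere[OF r fin0 C(1) _ caps]) (use C(2) dim in auto)
    qed
  qed
  moreover have "closed (msupp \<nu>)" by (rule closed_msupp) (simp add: space_\<nu>)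
  ultimately show ?thesis unfolding perfect_set_def by blast
qed

end
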